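(* Let $R$ be an even skew-invertible involutive symmetry of bi-rank $(m|0)$ on $V$, $\dim_{\mathbb C}V=N$, let $u_1,\dots,u_K$ be pairwise distinct complex numbers, and let $M(1),\dots,M(K)$ be $N\times N$ matrices whose entries generate the unital associative algebra with the relations $$M(k)_{\overline1}M(l)_{\overline2}=M(l)_{\overline2}M(k)_{\overline1},\quad k\ne l,$$ $$M(k)_{\overline1}M(k)_{\overline2}-M(k)_{\overline2}M(k)_{\overline1}=M(k)_{\overline1}R-M(k)_{\overline2}R,\quad 1\le k\le K.$$ Put $\tilde L(u)=\sum_{k=1}^K\frac{M(k)}{u-u_k}$. Then the elements $$QH_k(u)=\mathrm{Tr}_{R(1\dots m)}A^{(m)}_{1\dots m}\Big(\tilde L_{\overline1}(u)-I\frac{d}{du}\Big)\Big(\tilde L_{\overline2}(u)-I\frac{d}{du}\Big)\cdots\Big(\tilde L_{\overline k}(u)-I\frac{d}{du}\Big)\triangleright 1,\qquad 1\le k\le m,$$ commute with each other: $QH_k(u)QH_l(v)=QH_l(v)QH_k(u)$ for all $k,l$ and all $u,v$.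
   Context: Let $V$ be a complex vector space of dimension $N$. An involutive symmetry is an operator $R\in\mathrm{End}(V^{\otimes2})$ with $R_1R_2R_1=R_2R_1R_2$ in $\mathrm{End}(V^{\otimes3})$ and $R^2=I$, where $R_k=R_{k\,k+1}$ denotes $R$ acting in the positions $k,k+1$ of a tensor power of $V$. Skew-symmetrizers: $A^{(1)}=I$, $A^{(k+1)}_{1\dots k+1}=\frac{k}{k+1}A^{(k)}_{1\dots k}\left(\frac1k I-R_k\right)A^{(k)}_{1\dots k}$, $k\ge1$. $R$ is skew-invertible if there is $\Psi\in\mathrm{End}(V^{\otimes2})$ with $\mathrm{Tr}_{(2)}R_{12}\Psi_{23}=P_{13}=\mathrm{Tr}_{(2)}\Psi_{12}R_{23}$ ($P$ is the flip). Then $C=\mathrm{Tr}_{(2)}\Psi_{12}$ satisfies $\mathrm{Tr}_{(2)}R_{12}C_2=I_1$ and $R_kC_kC_{k+1}=C_kC_{k+1}R_k$. $R$ is even of bi-rank $(m|0)$ if $A^{(m+1)}=0$ and $\mathrm{rank}\,A^{(m)}=1$; then $\mathrm{Tr}\,C=m$. $R$-trace: $\mathrm{Tr}_{R(12\dots k)}X=\mathrm{Tr}_{(12\dots k)}(C_1C_2\cdots C_kX)$ for $X\in(\mathrm{Mat}_N(\mathcal A))^{\otimes k}$. Overlined copies of an $N\times N$ matrix $X$: $X_{\overline1}=X_1$, $X_{\overline{k+1}}=R_kX_{\overline k}R_k^{-1}$ for $k\ge1$. The symbol $\triangleright1$ means that the differential operator in $u$ to its left (with coefficients in the algebra) is applied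 to the unit, i.e. after moving all derivatives to the right only the term containing no derivative is kept. *)

theory Defs
  imports "HOL-Analysis.Analysis" "HOL-Library.Poly_Mapping"
    "HOL-Library.Function_Algebras"
begin

section \<open>Tensor powers with named positions\<close>

text \<open>
  V is \<open>\<complex>\<^sup>N\<close> with basis indexed by a finite type \<open>'n\<close>, \<open>N = CARD('n)\<close>.  For a finite set \<open>S\<close> of
  positions, the basis of \<open>V\<^bsup>\<otimes>S\<^esup>\<close> is indexed by \<open>multi_idx S\<close>, and an element of
  \<open>End(V\<^bsup>\<otimes>S\<^esup>) \<otimes> A\<close> is a matrix \<open>X i j\<close> (row \<open>i\<close>, column \<open>j\<close>) with entries in \<open>A\<close>; only the entries
  with \<open>i, j \<in> multi_idx S\<close> are meaningful, so equality of such matrices is \<open>tensor_eq S\<close>.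
\<close>

type_synonym ('n, 'a) tensor = "(nat \<Rightarrow> 'n) \<Rightarrow> (nat \<Rightarrow> 'n) \<Rightarrow> 'a"

definition multi_idx :: "nat set \<Rightarrow> (nat \<Rightarrow> 'n) set"
  where "multi_idx S = S \<rightarrow>\<^sub>E UNIV"

definition tensor_eq :: "nat set \<Rightarrow> ('n, 'a) tensor \<Rightarrow> ('n, 'a) tensor \<Rightarrow> bool"
  where "tensor_eq S X Y \<longleftrightarrow> (\<forall>i\<in>multi_idx S. \<forall>j\<in>multi_idx S. X i j = Y i j)"

definition tensor_one :: "nat set \<Rightarrow> ('n, 'a::zero_neq_one) tensor"
  where "tensor_one S = (\<lambda>i j. if \<forall>c\<in>S. i c = j c then 1 else 0)"

definition tensor_mult ::
  "nat set \<Rightarrow> ('n, 'a::semiring_0) tensor \<Rightarrow> ('n, 'a) tensor \<Rightarrow> ('n, 'a) tensor"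
  where "tensor_mult S X Y = (\<lambda>i j. \<Sum>k\<in>multi_idx S. X i k * Y k j)"

definition tensor_prod_list ::
  "nat set \<Rightarrow> ('n, 'a::semiring_1) tensor list \<Rightarrow> ('n, 'a) tensor"
  where "tensor_prod_list S Xs = foldr (tensor_mult S) Xs (tensor_one S)"

text \<open>\<open>place1 S a X\<close> is \<open>X\<^sub>a\<close> and \<open>place2 S a b X\<close> is \<open>X\<^bsub>a b\<^esub>\<close>, acting in \<open>V\<^bsup>\<otimes>S\<^esup>\<close>.\<close>

definition place1 :: "nat set \<Rightarrow> nat \<Rightarrow> 'a::zero ^ 'n ^ 'n \<Rightarrow> ('n::finite, 'a) tensor"
  where "place1 S a X = (\<lambda>i j. if \<forall>c\<in>S - {a}. i c = j c then X $ i a $ j a else 0)"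

definition place2 ::
  "nat set \<Rightarrow> nat \<Rightarrow> nat \<Rightarrow> 'a::zero ^ ('n \<times> 'n) ^ ('n \<times> 'n) \<Rightarrow> ('n::finite, 'a) tensor"
  where "place2 S a b X =
    (\<lambda>i j. if \<forall>c\<in>S - {a, b}. i c = j c then X $ (i a, i b) $ (j a, j b) else 0)"

text \<open>Trace over the positions in \<open>T\<close>, mapping \<open>End(V\<^bsup>\<otimes>S\<^esup>)\<close> to \<open>End(V\<^bsup>\<otimes>(S - T)\<^esup>)\<close> for \<open>T \<subseteq> S\<close>.\<close>

definition partial_trace :: "nat set \<Rightarrow> ('n, 'a::comm_monoid_add) tensor \<Rightarrow> ('n, 'a) tensor"
  where "partial_trace T X =
    (\<lambda>i j. \<Sum>t\<in>multi_idx T. X (override_on i t T) (override_on j t T))"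

definition full_trace :: "nat set \<Rightarrow> ('n, 'a::comm_monoid_add) tensor \<Rightarrow> 'a"
  where "full_trace S X = (\<Sum>t\<in>multi_idx S. X t t)"

text \<open>The rank is the dimension of the image, inside the functions supported on \<open>multi_idx S\<close>.\<close>

definition tensor_rank :: "nat set \<Rightarrow> ('n, complex) tensor \<Rightarrow> nat"
  where "tensor_rank S X =
    vector_space.dim (\<lambda>(c::complex) f i. c * f i)
      (range (\<lambda>v i. if i \<in> multi_idx S then \<Sum>j\<in>multi_idx S. X i j * v j else 0))"


section \<open>Even skew-invertible involutive symmetries\<close>

definition involutive_symmetry :: "complex ^ ('n::finite \<times> 'n) ^ ('n \<times> 'n) \<Rightarrow> bool"
  where "involutive_symmetry R \<longleftrightarrow>
    (let S = {1, 2, 3}; R1 = place2 S 1 2 R; R2 = place2 S 2 3 R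
     in tensor_eq S (tensor_prod_list S [R1, R2, R1]) (tensor_prod_list S [R2, R1, R2]))
    \<and> R ** R = mat 1"

definition flip :: "complex ^ ('n::finite \<times> 'n) ^ ('n \<times> 'n)"
  where "flip = (\<chi> p q. if fst p = snd q \<and> snd p = fst q then 1 else 0)"

definition skew_inverse ::
  "complex ^ ('n::finite \<times> 'n) ^ ('n \<times> 'n) \<Rightarrow> complex ^ ('n \<times> 'n) ^ ('n \<times> 'n) \<Rightarrow> bool"
  where "skew_inverse R \<Psi> \<longleftrightarrow>
    (let S = {1, 2, 3}; P13 = place2 {1, 3} 1 3 flip in
      tensor_eq {1, 3}
        (partial_trace {2} (tensor_mult S (place2 S 1 2 R) (place2 S 2 3 \<Psi>))) P13 \<and>
      tensor_eq {1, 3}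
        P13 (partial_trace {2} (tensor_mult S (place2 S 1 2 \<Psi>) (place2 S 2 3 R))))"

text \<open>\<open>C = Tr\<^bsub>(2)\<^esub> \<Psi>\<^bsub>12\<^esub>\<close>\<close>

definition C_matrix :: "complex ^ ('n::finite \<times> 'n) ^ ('n \<times> 'n) \<Rightarrow> complex ^ 'n ^ 'n"
  where "C_matrix \<Psi> = (\<chi> a b. \<Sum>x\<in>UNIV. \<Psi> $ (a, x) $ (b, x))"

text \<open>\<open>skew_sym S R k\<close> is \<open>A\<^bsup>(k)\<^esup>\<^bsub>1\<dots>k\<^esub>\<close> in \<open>End(V\<^bsup>\<otimes>S\<^esup>)\<close>; the value at \<open>k = 0\<close> is a dummy.\<close>

fun skew_sym ::
  "nat set \<Rightarrow> complex ^ ('n::finite \<times> 'n) ^ ('n \<times> 'n) \<Rightarrow> nat \<Rightarrow> ('n, complex) tensor"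
  where
    "skew_sym S R 0 = tensor_one S"
  | "skew_sym S R (Suc 0) = tensor_one S"
  | "skew_sym S R (Suc (Suc n)) =
      (let k = Suc n; A = skew_sym S R k;
           B = (\<lambda>i j. (1 / of_nat k) * tensor_one S i j - place2 S k (k + 1) R i j)
       in (\<lambda>i j. of_nat k / of_nat (k + 1) * tensor_prod_list S [A, B, A] i j))"

text \<open>Even of bi-rank \<open>(m|0)\<close>.  For \<open>m = 0\<close> this never holds, since \<open>A\<^bsup>(1)\<^esup> = I \<noteq> 0\<close>.\<close>

definition even_bi_rank :: "complex ^ ('n::finite \<times> 'n) ^ ('n \<times> 'n) \<Rightarrow> nat \<Rightarrow> bool"
  where "even_bi_rank R m \<longleftrightarrow>
    tensor_eq {1..m + 1} (skew_sym {1..m + 1} R (m + 1)) (\<lambda>i j. 0) \<and>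
    tensor_rank {1..m} (skew_sym {1..m} R m) = 1"


section \<open>Unital associative algebras given by generators and relations\<close>

text \<open>
  The free algebra on \<open>'g\<close> is the monoid algebra of the free monoid.  The type of words is separate
  from lists because the multiplication of polynomial mappings is the convolution for the
  \<^emph>\<open>additively\<close> written monoid of exponents.
\<close>

datatype 'g fword = FWord "'g list"

instantiation fword :: (type) monoid_add
begin

definition zero_fword :: "'a fword" where "zero_fword = FWord []"

fun plus_fword :: "'a fword \<Rightarrow> 'a fword \<Rightarrow> 'a fword"
  where "plus_fword (FWord xs) (FWord ys) = FWord (xs @ ys)"

instance
proof
  fix a b c :: "'a fword"
  show "a + b + c = a + (b + c)" by (cases a; cases b; cases c) simp
  show "0 + a = a" by (cases a) (simp add: zero_fword_def)
  show "a + 0 = a" by (cases a) (simp add: zero_fword_def)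
qed

end

type_synonym 'g free_alg = "'g fword \<Rightarrow>\<^sub>0 complex"

definition fa_gen :: "'g \<Rightarrow> 'g free_alg"
  where "fa_gen g = Poly_Mapping.single (FWord [g]) 1"

definition fa_const :: "complex \<Rightarrow> 'g free_alg"
  where "fa_const c = Poly_Mapping.single 0 c"

inductive_set two_sided_ideal :: "'a::ring_1 set \<Rightarrow> 'a set" for rels
  where
    base: "r \<in> rels \<Longrightarrow> r \<in> two_sided_ideal rels"
  | zero: "0 \<in> two_sided_ideal rels"
  | add: "x \<in> two_sided_ideal rels \<Longrightarrow> y \<in> two_sided_ideal rels \<Longrightarrow> x + y \<in> two_sided_ideal rels"
  | lmult: "x \<in> two_sided_ideal rels \<Longrightarrow> a * x \<in> two_sided_ideal rels"
  | rmult: "x \<in> two_sided_ideal rels \<Longrightarrow> x * a \<in> two_sided_ideal rels"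

text \<open>
  Equality of (the classes of) two elements in the algebra with generators \<open>'g\<close> and relators
  \<open>rels\<close>, that is, in the quotient of the free algebra by the two-sided ideal of the relators.
\<close>

definition presented_eq :: "'g free_alg set \<Rightarrow> 'g free_alg \<Rightarrow> 'g free_alg \<Rightarrow> bool"
  where "presented_eq rels x y \<longleftrightarrow> x - y \<in> two_sided_ideal rels"

text \<open>
  Coefficientwise derivative.  It is meaningful where all coefficients are differentiable and only
  finitely many words have non-zero derivative, as for the rational functions used below (with
  finitely many words overall), away from their poles.  It descends to rational functions with
  values in the quotient algebra.
\<close>

definition fa_deriv :: "(complex \<Rightarrow> 'g free_alg) \<Rightarrow> complex \<Rightarrow> 'g free_alg"
  where "fa_deriv f z = Abs_poly_mapping (\<lambda>w. deriv (\<lambda>x. Poly_Mapping.lookup (f x) w) z)"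

definition lift_tensor :: "('n, complex) tensor \<Rightarrow> ('n, 'g free_alg) tensor"
  where "lift_tensor X = (\<lambda>i j. fa_const (X i j))"


section \<open>The algebra of the matrices \<open>M(k)\<close>\<close>

text \<open>
  \<open>overlined S R X k\<close> is the overlined copy \<open>X\<^sub>k\<close> in \<open>End(V\<^bsup>\<otimes>S\<^esup>) \<otimes> A\<close>; the value at \<open>k = 0\<close> is a dummy.
\<close>

fun overlined ::
  "nat set \<Rightarrow> complex ^ ('n::finite \<times> 'n) ^ ('n \<times> 'n) \<Rightarrow> 'g free_alg ^ 'n ^ 'n \<Rightarrow> nat
    \<Rightarrow> ('n, 'g free_alg) tensor"
  where
    "overlined S R X 0 = place1 S 1 X"
  | "overlined S R X (Suc 0) = place1 S 1 X"
  | "overlined S R X (Suc (Suc n)) =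
      (let k = Suc n in
       tensor_prod_list S
         [lift_tensor (place2 S k (k + 1) R), overlined S R X k,
          lift_tensor (place2 S k (k + 1) (matrix_inv R))])"

text \<open>Generators: \<open>(k, a, b)\<close> is the entry of \<open>M(k)\<close> in row \<open>a\<close> and column \<open>b\<close>.\<close>

definition M_gen :: "'k \<Rightarrow> ('k \<times> 'n \<times> 'n) free_alg ^ ('n::finite) ^ 'n"
  where "M_gen k = (\<chi> a b. fa_gen (k, a, b))"

definition M_relators ::
  "complex ^ ('n::finite \<times> 'n) ^ ('n \<times> 'n) \<Rightarrow> ('k \<times> 'n \<times> 'n) free_alg set"
  where "M_relators R =
    (let S = {1, 2};
         M1 = (\<lambda>k. overlined S R (M_gen k) 1);
         M2 = (\<lambda>k. overlined S R (M_gen k) 2);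
         RR = lift_tensor (place2 S 1 2 R);
         mul = tensor_mult S
     in {mul (M1 k) (M2 l) i j - mul (M2 l) (M1 k) i j | k l i j.
           k \<noteq> l \<and> i \<in> multi_idx S \<and> j \<in> multi_idx S}
      \<union> {(mul (M1 k) (M2 k) i j - mul (M2 k) (M1 k) i j)
           - (mul (M1 k) RR i j - mul (M2 k) RR i j) | k i j.
           i \<in> multi_idx S \<and> j \<in> multi_idx S})"


section \<open>The elements \<open>QH\<^sub>k(u)\<close>\<close>

definition L_tilde ::
  "('k::finite \<Rightarrow> complex) \<Rightarrow> complex \<Rightarrow> ('k \<times> 'n \<times> 'n) free_alg ^ ('n::finite) ^ 'n"
  where "L_tilde u z = (\<chi> a b. \<Sum>k\<in>UNIV. fa_const (1 / (z - u k)) * M_gen k $ a $ b)"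

text \<open>
  The operator \<open>L\<^sub>j(z) - I d/dz\<close> (\<open>L\<^sub>j\<close> the \<open>j\<close>-th overlined copy) on matrix-valued functions of \<open>z\<close>, and
  the result of applying \<open>(L\<^sub>1(z) - I d/dz) \<dots> (L\<^sub>k(z) - I d/dz)\<close> to the constant unit matrix.
\<close>

definition L_minus_d ::
  "nat set \<Rightarrow> complex ^ ('n::finite \<times> 'n) ^ ('n \<times> 'n) \<Rightarrow> ('k::finite \<Rightarrow> complex) \<Rightarrow> nat
    \<Rightarrow> (complex \<Rightarrow> ('n, ('k \<times> 'n \<times> 'n) free_alg) tensor)
    \<Rightarrow> (complex \<Rightarrow> ('n, ('k \<times> 'n \<times> 'n) free_alg) tensor)"
  where "L_minus_d S R u j F =
    (\<lambda>z i i'. tensor_mult S (overlined S R (L_tilde u z) j) (F z) i i'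
              - fa_deriv (\<lambda>x. F x i i') z)"

definition L_minus_d_prod_unit ::
  "nat set \<Rightarrow> complex ^ ('n::finite \<times> 'n) ^ ('n \<times> 'n) \<Rightarrow> ('k::finite \<Rightarrow> complex) \<Rightarrow> nat
    \<Rightarrow> complex \<Rightarrow> ('n, ('k \<times> 'n \<times> 'n) free_alg) tensor"
  where "L_minus_d_prod_unit S R u k = foldr (L_minus_d S R u) [1..<k + 1] (\<lambda>z. tensor_one S)"

definition R_trace ::
  "nat \<Rightarrow> complex ^ ('n::finite \<times> 'n) ^ ('n \<times> 'n) \<Rightarrow> ('n, 'g free_alg) tensor \<Rightarrow> 'g free_alg"
  where "R_trace m \<Psi> X =
    (let S = {1..m} in
     full_trace S
       (tensor_mult S
         (lift_tensor (tensor_prod_list S (map (\<lambda>a. place1 S a (C_matrix \<Psi>)) [1..<m + 1]))) X))"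

text \<open>
  The coefficients of \<open>A\<^bsup>(m)\<^esup>\<close> and of the trace do not depend on \<open>z\<close>, so the operators may be applied
  to the unit before multiplying by \<open>A\<^bsup>(m)\<^esup>\<close> and taking the trace.
\<close>

definition QH ::
  "complex ^ ('n::finite \<times> 'n) ^ ('n \<times> 'n) \<Rightarrow> complex ^ ('n \<times> 'n) ^ ('n \<times> 'n) \<Rightarrow> nat
    \<Rightarrow> ('k::finite \<Rightarrow> complex) \<Rightarrow> nat \<Rightarrow> complex \<Rightarrow> ('k \<times> 'n \<times> 'n) free_alg"
  where "QH R \<Psi> m u k z =
    (let S = {1..m} in
     R_trace m \<Psi>
       (tensor_mult S (lift_tensor (skew_sym S R m)) (L_minus_d_prod_unit S R u k z)))"

end

(*
  The Gaudin elements are the leading coefficients at h = 0 of a finite-difference system.  For a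
  parameter h, the ordered product T_1(z) of the factors 1 + h M(k)/(z - u_k) satisfies the RTT
  relation (R_k + h/(v-u)) T_k(u) T_{k+1}(v) = T_k(v) T_{k+1}(u) (R_k + h/(v-u)), where
  T_{k+1} = R_k T_k R_k.  Hence the transfer matrices tau_k(z) = Tr_R A^{(k)} T_1(z) T_2(z-h) ...
  T_k(z-(k-1)h) commute: the product of two of them is a single R-trace, and a block R-matrix,
  which is compatible with the skew-symmetrizers by fusion, exchanges the two blocks.  The R-trace of
  A^{(m)} (T_1(z) e^{-h d/dz} - 1) ... (T_k(z) e^{-h d/dz} - 1) applied to 1 is a combination of the
  tau_j(z), because A^{(m)} allows one to move the factors T_j to the leftmost positions; and
  T_j(z) e^{-h d/dz} - 1 = h (L_j(z) - d/dz) + O(h^2), so its coefficient at h^k is QH_k(z).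
*)
theory Submission
  imports Defs
begin

section \<open>Algebras over the complex numbers\<close>

text \<open>All tensor positions, the \<open>R_k\<close> and the entries of the \<open>M(k)\<close>
  are put into one ring, the operators on functions of infinitely many indices with values in the
  free algebra. There End(V^n) \<otimes> A lands in the commutant of the matrix units beyond
  position n, and an element of the free algebra acts as zero exactly when it lies in the ideal of
  the relators, so commutation of operators suffices. The R-trace is not cyclic: only elements
  generated by the \<open>R_k\<close> may be rotated, so the argument moves skew-symmetrizers and
  R-matrices around the trace and never a \<open>T\<close>. Two obstacles shape the limit. The block
  R-matrix is inverted only for generic arguments, which excludes z = w; the second argument is
  therefore shifted by h/2, and the shift vanishes with h. And the algebra carries no topology, so
  expansions are exact identities whose remainders are finite sums of scalar rational functions
  times fixed elements, and a linear functional reduces the limit to complex numbers.\<close>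

locale c_algebra = vector_space sc
  for sc :: "complex \<Rightarrow> 'e::ring_1 \<Rightarrow> 'e" (infixr "\<odot>" 75) +
  assumes sc_mult_left: "(c \<odot> x) * y = c \<odot> (x * y)"
    and sc_mult_right: "x * (c \<odot> y) = c \<odot> (x * y)"
begin

lemmas sc_simps = sc_mult_left sc_mult_right scale_right_distrib scale_right_diff_distrib
  scale_minus_right

definition is_unit_of :: "'e \<Rightarrow> 'e \<Rightarrow> bool"
  where "is_unit_of x y \<longleftrightarrow> x * y = 1 \<and> y * x = 1"

definition inv_el :: "'e \<Rightarrow> bool"
  where "inv_el x \<longleftrightarrow> (\<exists>y. is_unit_of x y)"

lemma inv_el_one: "inv_el 1"
  unfolding inv_el_def is_unit_of_def by auto

lemma inv_el_mult:
  assumes "inv_el x" "inv_el y"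
  shows "inv_el (x * y)"
proof -
  obtain a b where "x * a = 1" "a * x = 1" "y * b = 1" "b * y = 1"
    using assms unfolding inv_el_def is_unit_of_def by blast
  then have "x * y * (b * a) = 1" "b * a * (x * y) = 1"
    by (metis mult.assoc mult.right_neutral)+
  then show ?thesis
    unfolding inv_el_def is_unit_of_def by blast
qed

end


section \<open>Representations of symmetric groups and skew-symmetrizers\<close>

locale braid_sym = c_algebra sc
  for sc :: "complex \<Rightarrow> 'e::ring_1 \<Rightarrow> 'e" (infixr "\<odot>" 75) +
  fixes r :: "nat \<Rightarrow> 'e"
  assumes r_sq: "1 \<le> k \<Longrightarrow> r k * r k = 1"
    and r_braid: "1 \<le> k \<Longrightarrow> r k * r (Suc k) * r k = r (Suc k) * r k * r (Suc k)"
    and r_far: "1 \<le> k \<Longrightarrow> k + 2 \<le> l \<Longrightarrow> r k * r l = r l * r k"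
begin

lemma r_sq': "1 \<le> k \<Longrightarrow> r k * (r k * x) = x"
  by (metis mult.assoc mult_1 r_sq)

lemma r_far': "1 \<le> k \<Longrightarrow> 1 \<le> l \<Longrightarrow> k + 2 \<le> l \<or> l + 2 \<le> k \<Longrightarrow> r k * r l = r l * r k"
  using r_far by metis

text \<open>The condition is the division-free form of additivity of spectral parameters: for
  \<open>x = h / a\<close> and \<open>z = h / b\<close> it gives \<open>y = h / (a + b)\<close>. It
  also admits the coefficient 1, where \<open>r k + 1\<close> is twice a projector; fusion rests on
  this case.\<close>

lemma r_yang_baxter:
  assumes "1 \<le> k" and "x * z = y * (x + z)"
  shows "(r k + x \<odot> 1) * (r (Suc k) + y \<odot> 1) * (r k + z \<odot> 1)
    = (r (Suc k) + z \<odot> 1) * (r k + y \<odot> 1) * (r (Suc k) + x \<odot> 1)"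
proof -
  have k: "1 \<le> Suc k" by simp
  have e: "y * x + y * z = x * z" using assms(2) by (simp add: algebra_simps)
  have "(r k + x \<odot> 1) * (r (Suc k) + y \<odot> 1) * (r k + z \<odot> 1)
    = r k * r (Suc k) * r k + x \<odot> (r (Suc k) * r k) + z \<odot> (r k * r (Suc k)) + y \<odot> 1
      + (y * x + y * z) \<odot> r k + (x * z) \<odot> r (Suc k) + (x * y * z) \<odot> 1"
    using assms(1) by (simp add: algebra_simps sc_simps r_sq scale_left_distrib)
  \<comment> \<open>The two expansions differ only in the cubic terms, equal by the braid relation,
    and in the coefficients of \<open>r k\<close> and \<open>r (Suc k)\<close>, which
    \<open>e\<close> equates.\<close>
  also have "\<dots> = r (Suc k) * r k * r (Suc k) + x \<odot> (r (Suc k) * r k) + z \<odot> (r k * r (Suc k)) + y \<odot> 1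
      + (x * z) \<odot> r k + (y * x + y * z) \<odot> r (Suc k) + (x * y * z) \<odot> 1"
    unfolding e using r_braid[OF assms(1)] by simp
  also have "\<dots> = (r (Suc k) + z \<odot> 1) * (r k + y \<odot> 1) * (r (Suc k) + x \<odot> 1)"
    using k by (simp add: algebra_simps sc_simps r_sq scale_left_distrib)
  finally show ?thesis .
qed

text \<open>As \<open>r k\<close> is an involution, \<open>(r k + x) (r k - x)\<close> is the scalar
  \<open>1 - x^2\<close>.\<close>

lemma inv_el_r_plus:
  assumes "1 \<le> k" and "x \<noteq> 1" and "x \<noteq> -1"
  shows "inv_el (r k + x \<odot> 1)"
proof -
  have n: "1 - x * x \<noteq> 0"
    using assms(2,3) by (metis eq_iff_diff_eq_0 square_eq_1_iff)
  have a: "(r k + x \<odot> 1) * (r k - x \<odot> 1) = (1 - x * x) \<odot> 1"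
    "(r k - x \<odot> 1) * (r k + x \<odot> 1) = (1 - x * x) \<odot> 1"
    using assms(1) by (simp_all add: algebra_simps sc_simps r_sq scale_left_diff_distrib)
  have "is_unit_of (r k + x \<odot> 1) ((1 / (1 - x * x)) \<odot> (r k - x \<odot> 1))"
    unfolding is_unit_of_def sc_mult_left sc_mult_right a using n by simp
  then show ?thesis
    unfolding inv_el_def by blast
qed

text \<open>\<open>skewer p k\<close> is the skew-symmetrizer on the positions \<open>p + 1, \<dots>, p + k\<close>.\<close>

fun skewer :: "nat \<Rightarrow> nat \<Rightarrow> 'e"
  where
    "skewer p 0 = 1"
  | "skewer p (Suc 0) = 1"
  | "skewer p (Suc (Suc n)) =
      (of_nat (Suc n) / of_nat (Suc (Suc n))) \<odot>
        (skewer p (Suc n) * ((1 / of_nat (Suc n)) \<odot> 1 - r (p + Suc n)) * skewer p (Suc n))"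

lemma skewer_comm:
  assumes "\<And>l. p < l \<Longrightarrow> l < p + k \<Longrightarrow> x * r l = r l * x"
  shows "x * skewer p k = skewer p k * x"
  using assms
proof (induction p k rule: skewer.induct)
  case (3 p n)
  let ?A = "skewer p (Suc n)" and ?r = "r (p + Suc n)"
  have A: "x * ?A = ?A * x" using 3 by simp
  have r: "x * ?r = ?r * x" using 3 by simp
  have A': "x * (?A * y) = ?A * (x * y)" for y by (metis A mult.assoc)
  have r': "x * (?r * y) = ?r * (x * y)" for y by (metis r mult.assoc)
  show ?case
    by (simp add: sc_simps algebra_simps A A' r r' del: add_Suc_right)
qed auto

text \<open>On an element with \<open>x * r l = - x\<close> the bracket of the recursion acts as
  \<open>1 / n + 1\<close>; the prefactor \<open>n / (n + 1)\<close> compensates exactly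
  this.\<close>

lemma skewer_coeff:
  "of_nat (Suc n) / of_nat (Suc (Suc n)) * (1 / of_nat (Suc n) + 1) = (1 :: complex)"
proof -
  have 1: "(of_nat (Suc n) :: complex) \<noteq> 0" "(of_nat (Suc n) + 1 :: complex) \<noteq> 0"
    using of_nat_neq_0[of n] of_nat_neq_0[of "Suc n"] by (simp_all only: of_nat_Suc add.commute not_False_eq_True)
  have "a / (a + 1) * (1 / a + 1) = 1" if "a \<noteq> 0" "a + 1 \<noteq> 0" for a :: complex
  proof -
    have "1 / a + 1 = (a + 1) / a" using that by (simp add: field_simps)
    then show ?thesis using that by simp
  qed
  from this[OF 1] show ?thesis
    by (simp only: of_nat_Suc[of "Suc n"] add.commute)
qed

text \<open>An element on which all \<open>r l\<close> act by -1 passes through the recursion as a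
  scalar, and the scalars multiply to 1. Antisymmetry of \<open>skewer\<close> is not presupposed,
  so this is available inside the induction that proves it.\<close>

lemma skewer_absorb_right:
  assumes "\<And>l. p < l \<Longrightarrow> l < p + k \<Longrightarrow> x * (r l + 1) = 0"
  shows "x * skewer p k = x"
  using assms
proof (induction p k rule: skewer.induct)
  case (3 p n)
  have A: "x * skewer p (Suc n) = x" using 3 by simp
  have "x * (r (p + Suc n) + 1) = 0" using 3 by simp
  then have r: "x * r (p + Suc n) = - x" by (simp add: distrib_left eq_neg_iff_add_eq_0)
  have "x * skewer p (Suc (Suc n)) = (of_nat (Suc n) / of_nat (Suc (Suc n))) \<odot>
     (x * skewer p (Suc n) * ((1 / of_nat (Suc n)) \<odot> 1 - r (p + Suc n)) * skewer p (Suc n))"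
    by (simp add: sc_mult_right mult.assoc)
  also have "x * skewer p (Suc n) * ((1 / of_nat (Suc n)) \<odot> 1 - r (p + Suc n)) * skewer p (Suc n)
      = ((1 / of_nat (Suc n)) \<odot> x + 1 \<odot> x) * skewer p (Suc n)"
    unfolding A by (simp add: right_diff_distrib sc_mult_right r del: add_Suc_right of_nat_Suc)
  also have "\<dots> = (1 / of_nat (Suc n) + 1) \<odot> x"
    by (simp add: A sc_mult_left distrib_right scale_left_distrib)
  also have "(of_nat (Suc n) / of_nat (Suc (Suc n))) \<odot> \<dots> = 1 \<odot> x"
    unfolding scale_scale skewer_coeff ..
  finally show ?case by simp
qed auto

lemma skewer_absorb_left:
  assumes "\<And>l. p < l \<Longrightarrow> l < p + k \<Longrightarrow> (r l + 1) * x = 0"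
  shows "skewer p k * x = x"
  using assms
proof (induction p k rule: skewer.induct)
  case (3 p n)
  have A: "skewer p (Suc n) * x = x" using 3 by simp
  have "(r (p + Suc n) + 1) * x = 0" using 3 by simp
  then have r: "r (p + Suc n) * x = - x" by (simp add: distrib_right eq_neg_iff_add_eq_0)
  have "skewer p (Suc (Suc n)) * x = (of_nat (Suc n) / of_nat (Suc (Suc n))) \<odot>
     (skewer p (Suc n) * (((1 / of_nat (Suc n)) \<odot> 1 - r (p + Suc n)) * (skewer p (Suc n) * x)))"
    by (simp add: sc_mult_left mult.assoc)
  also have "skewer p (Suc n) * (((1 / of_nat (Suc n)) \<odot> 1 - r (p + Suc n)) * (skewer p (Suc n) * x))
      = skewer p (Suc n) * ((1 / of_nat (Suc n)) \<odot> x + 1 \<odot> x)"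
    unfolding A by (simp add: left_diff_distrib sc_mult_left r del: add_Suc_right of_nat_Suc)
  also have "\<dots> = (1 / of_nat (Suc n) + 1) \<odot> x"
    by (simp add: A sc_mult_right distrib_left scale_left_distrib)
  also have "(of_nat (Suc n) / of_nat (Suc (Suc n))) \<odot> \<dots> = 1 \<odot> x"
    unfolding scale_scale skewer_coeff ..
  finally show ?case by simp
qed auto

lemma skewer_scaled:
  "of_nat (Suc (Suc n)) \<odot> skewer p (Suc (Suc n)) = of_nat (Suc n) \<odot>
     (skewer p (Suc n) * ((1 / of_nat (Suc n)) \<odot> 1 - r (p + Suc n)) * skewer p (Suc n))"
proof -
  have "(of_nat (Suc (Suc n)) :: complex) \<noteq> 0"
    using of_nat_neq_0 by blast
  then show ?thesis
    unfolding skewer.simps scale_scale by simp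
qed

text \<open>For \<open>l\<close> below the last index the outer factors of the recursion already
  annihilate \<open>r l + 1\<close>. For the last index one copy of \<open>A\<close> is rewritten
  through the smaller skew-symmetrizer \<open>B\<close>, which commutes with the last generator, and
  the braid relation finishes.\<close>

lemma skewer_skew:
  assumes "p < l" and "l < p + k"
  shows "skewer p k * (r l + 1) = 0 \<and> (r l + 1) * skewer p k = 0"
  using assms
proof (induction k arbitrary: l rule: less_induct)
  case (less k)
  have "2 \<le> k" using less.prems by simp
  then obtain n where k: "k = Suc (Suc n)"
    by (metis add_2_eq_Suc le_Suc_ex)
  let ?A = "skewer p (Suc n)" and ?B = "skewer p n" and ?r = "r (p + Suc n)" and ?s = "r (p + n)"
  let ?m = "of_nat (Suc n) :: complex"
  have IH: "skewer p (Suc n) * (r l + 1) = 0" "(r l + 1) * skewer p (Suc n) = 0"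
    if "l < p + Suc n" using less.IH[of "Suc n"] that less.prems k by auto
  show ?case
  proof (cases "l = p + Suc n")
    case False
    then have l: "l < p + Suc n" using less.prems k by simp
    have "?A * (r l + 1) = 0" "(r l + 1) * ?A = 0" using IH[OF l] by auto
    moreover have "(r l + 1) * (x \<odot> (?A * y * ?A)) = x \<odot> (((r l + 1) * ?A) * y * ?A)"
      "(x \<odot> (?A * y * ?A)) * (r l + 1) = x \<odot> (?A * y * (?A * (r l + 1)))" for x y
      by (simp_all only: sc_simps mult.assoc)
    ultimately show ?thesis
      unfolding k skewer.simps by simp
  next
    case l: True
    have m: "?m \<noteq> 0" using of_nat_neq_0 by blast
    have rr: "?r * ?r = 1" by (rule r_sq) simp
    \<comment> \<open>These two identities suffice: with them and \<open>A * A = A\<close> the two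
      terms of \<open>A (1/m - r) A (r + 1)\<close> cancel, and likewise in the mirror
      image.\<close>
    have "?m \<odot> (?A * ?r * ?A * (?r + 1)) = ?A * (?r + 1)
      \<and> ?m \<odot> ((?r + 1) * ?A * ?r * ?A) = (?r + 1) * ?A"
    proof (cases n)
      case 0
      then show ?thesis using rr by (simp add: algebra_simps)
    next
      case (Suc q)
      have Ai: "?A * (r i + 1) = 0" "(r i + 1) * ?A = 0" if "p < i" "i < p + Suc n" for i
        using less.IH[of "Suc n" i] that k by auto
      have Bi: "?B * (r i + 1) = 0" "(r i + 1) * ?B = 0" if "p < i" "i < p + n" for i
        using less.IH[of n i] that k by auto
      have BB: "?B * ?B = ?B" by (intro skewer_absorb_right Bi)
      have AB: "?A * ?B = ?A" by (intro skewer_absorb_right Ai) auto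
      have BA: "?B * ?A = ?A" by (intro skewer_absorb_left Ai) auto
      have rB: "?r * ?B = ?B * ?r" by (rule skewer_comm) (simp add: r_far')
      have "?A * (?s + 1) = 0" "(?s + 1) * ?A = 0" using Ai[of "p + n"] Suc by auto
      then have As: "?A * ?s = - ?A" "?s * ?A = - ?A"
        by (simp_all add: distrib_left distrib_right eq_neg_iff_add_eq_0)
      have BrA: "?B * (?r * ?A) = ?r * ?A" by (metis BA mult.assoc rB)
      have rsr: "?r * ?s * ?r = ?s * ?r * ?s"
        using r_braid[of "p + n"] Suc by simp
      \<comment> \<open>Only one of the two factors \<open>A\<close> is expanded in this way; the
        other one stays intact to absorb \<open>B\<close> and \<open>s\<close>.\<close>
      have mA: "?m \<odot> ?A = ?B - of_nat n \<odot> (?B * ?s * ?B)"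
      proof -
        have "(of_nat n :: complex) \<noteq> 0" using Suc of_nat_neq_0 by metis
        then have "?m \<odot> ?A = of_nat n \<odot> (?B * ((1 / of_nat n) \<odot> 1 - ?s) * ?B)"
          using skewer_scaled[of "n - 1" p] Suc by simp
        also have "\<dots> = ?B - of_nat n \<odot> (?B * ?s * ?B)"
          using \<open>(of_nat n :: complex) \<noteq> 0\<close> BB by (simp add: algebra_simps sc_simps)
        finally show ?thesis .
      qed
      have "?m \<odot> (?A * ?r * ?A * (?r + 1)) = ?A * ?r * (?m \<odot> ?A) * (?r + 1)"
        by (simp add: sc_simps)
      also have "\<dots> = (?A * ?r * ?B - of_nat n \<odot> (?A * ?r * ?B * ?s * ?B)) * (?r + 1)"
        unfolding mA by (simp add: algebra_simps sc_simps)
      also have "?A * ?r * ?B = ?A * ?r" by (metis AB mult.assoc rB)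
      also have "(?A * ?r - of_nat n \<odot> (?A * ?r * ?s * ?B)) * (?r + 1)
          = ?A * ?r * (?r + 1) - of_nat n \<odot> (?A * ?r * ?s * (?B * (?r + 1)))"
        by (simp add: left_diff_distrib sc_simps mult.assoc)
      also have "?B * (?r + 1) = (?r + 1) * ?B" by (simp only: distrib_left distrib_right rB mult_1_left mult_1_right)
      also have "?A * ?r * ?s * ((?r + 1) * ?B) = (?A * (?r * ?s * ?r) + ?A * ?r * ?s) * ?B"
        by (simp add: algebra_simps)
      \<comment> \<open>By the braid relation \<open>r s r = s r s\<close>, and
        \<open>A s = - A\<close>; the result cancels the other summand, so the whole term with
        coefficient \<open>n\<close> disappears.\<close>
      also have "?A * (?r * ?s * ?r) = - (?A * ?r * ?s)"
        unfolding rsr using As by (simp flip: mult.assoc)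
      also have "?A * ?r * (?r + 1) = ?A * (?r + 1)" using rr by (simp add: algebra_simps)
      finally have 1: "?m \<odot> (?A * ?r * ?A * (?r + 1)) = ?A * (?r + 1)" by simp
      have "?m \<odot> ((?r + 1) * ?A * ?r * ?A) = (?r + 1) * (?m \<odot> ?A) * ?r * ?A"
        by (simp add: sc_simps)
      also have "\<dots> = (?r + 1) * (?B * ?r * ?A - of_nat n \<odot> (?B * ?s * ?B * ?r * ?A))"
        unfolding mA by (simp add: algebra_simps sc_simps)
      also have "?B * ?r * ?A = ?r * ?A" by (simp only: mult.assoc BrA)
      also have "?B * ?s * ?B * ?r * ?A = ?B * ?s * ?r * ?A" by (simp only: mult.assoc BrA)
      also have "(?r + 1) * (?r * ?A - of_nat n \<odot> (?B * ?s * ?r * ?A))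
          = (?r + 1) * ?r * ?A - of_nat n \<odot> (((?r + 1) * ?B) * ?s * ?r * ?A)"
        by (simp add: right_diff_distrib sc_simps mult.assoc)
      also have "(?r + 1) * ?B = ?B * (?r + 1)" by (simp only: distrib_left distrib_right rB mult_1_left mult_1_right)
      also have "?B * (?r + 1) * ?s * ?r * ?A = ?B * ((?r * ?s * ?r) * ?A + ?s * ?r * ?A)"
        by (simp add: algebra_simps)
      also have "(?r * ?s * ?r) * ?A = - (?s * ?r * ?A)"
        unfolding rsr using As by (simp add: mult.assoc)
      also have "(?r + 1) * ?r * ?A = (?r + 1) * ?A" using rr by (simp add: algebra_simps flip: mult.assoc)
      finally have 2: "?m \<odot> ((?r + 1) * ?A * ?r * ?A) = (?r + 1) * ?A" by simp
      show ?thesis using 1 2 by blast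
    qed
    then have 0: "(1 / ?m) \<odot> ?m \<odot> (?A * ?r * ?A * (?r + 1)) = (1 / ?m) \<odot> (?A * (?r + 1))"
      "(1 / ?m) \<odot> ?m \<odot> ((?r + 1) * ?A * ?r * ?A) = (1 / ?m) \<odot> ((?r + 1) * ?A)"
      by (simp_all only:)
    have "1 / ?m * ?m = 1" using m by simp
    then have e: "?A * ?r * ?A * (?r + 1) = (1 / ?m) \<odot> (?A * (?r + 1))"
      "(?r + 1) * ?A * ?r * ?A = (1 / ?m) \<odot> ((?r + 1) * ?A)"
      using 0 by (simp_all only: scale_scale scale_one)
    have AA: "?A * ?A = ?A"
      by (rule skewer_absorb_right) (use less.IH[of "Suc n"] k in auto)
    have "?A * ((1 / ?m) \<odot> 1 - ?r) * ?A * (?r + 1)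
      = (1 / ?m) \<odot> (?A * ?A * (?r + 1)) - ?A * ?r * ?A * (?r + 1)"
      by (simp only: right_diff_distrib left_diff_distrib sc_simps mult_1_right)
    then have 1: "?A * ((1 / ?m) \<odot> 1 - ?r) * ?A * (?r + 1) = 0"
      unfolding e AA by simp
    have "(?r + 1) * (?A * ((1 / ?m) \<odot> 1 - ?r) * ?A)
      = (1 / ?m) \<odot> ((?r + 1) * (?A * ?A)) - (?r + 1) * ?A * ?r * ?A"
      by (simp only: right_diff_distrib left_diff_distrib sc_simps mult_1_right mult.assoc)
    then have 2: "(?r + 1) * (?A * ((1 / ?m) \<odot> 1 - ?r) * ?A) = 0"
      unfolding e AA by simp
    show ?thesis
      unfolding k l skewer.simps sc_simps 1 2 by simp
  qed
qed

lemma skewer_idem: "skewer p k * skewer p k = skewer p k"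
  by (intro skewer_absorb_right) (simp add: skewer_skew)

lemma skewer_r:
  assumes "p < l" and "l < p + k"
  shows "skewer p k * r l = - skewer p k" and "r l * skewer p k = - skewer p k"
  using skewer_skew[OF assms] by (simp_all add: distrib_left distrib_right eq_neg_iff_add_eq_0)

lemma skewer_Suc:
  "of_nat (Suc (Suc n)) \<odot> skewer p (Suc (Suc n))
    = skewer p (Suc n) - of_nat (Suc n) \<odot> (skewer p (Suc n) * r (p + Suc n) * skewer p (Suc n))"
proof -
  have "(of_nat (Suc n) :: complex) \<noteq> 0"
    using of_nat_neq_0 by blast
  then have "(of_nat (Suc n) * (1 / of_nat (Suc n)) :: complex) = 1" by simp
  then show ?thesis
    unfolding skewer_scaled
    by (simp only: right_diff_distrib left_diff_distrib sc_simps mult_1_right skewer_idem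
        scale_right_diff_distrib scale_scale scale_one)
qed

end

lemma comm_mult:
  fixes x :: "'e::semigroup_mult"
  assumes "x * a = a * x" "x * b = b * x"
  shows "x * (a * b) = a * b * x"
proof -
  have "x * (a * b) = (x * a) * b" by (rule mult.assoc[symmetric])
  also have "\<dots> = a * (x * b)" unfolding assms(1) by (rule mult.assoc)
  also have "\<dots> = a * b * x" unfolding assms(2) by (rule mult.assoc[symmetric])
  finally show ?thesis .
qed

section \<open>Towers with R-traces\<close>

text \<open>
  \<open>N n\<close> plays the role of \<open>End(V\<^bsup>\<otimes>n\<^esup>) \<otimes> A\<close> and \<open>E n\<close> that of the R-trace over position \<open>n\<close>.
\<close>

locale r_tower = braid_sym sc r
  for sc :: "complex \<Rightarrow> 'e::ring_1 \<Rightarrow> 'e" (infixr "\<odot>" 75) and r :: "nat \<Rightarrow> 'e" +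
  fixes N :: "nat \<Rightarrow> 'e set" and E :: "nat \<Rightarrow> 'e \<Rightarrow> 'e" and d :: complex
  assumes N_mono: "m \<le> n \<Longrightarrow> x \<in> N m \<Longrightarrow> x \<in> N n"
    and N_one: "1 \<in> N n"
    and N_add: "x \<in> N n \<Longrightarrow> y \<in> N n \<Longrightarrow> x + y \<in> N n"
    and N_mult: "x \<in> N n \<Longrightarrow> y \<in> N n \<Longrightarrow> x * y \<in> N n"
    and N_sc: "x \<in> N n \<Longrightarrow> c \<odot> x \<in> N n"
    and N_unit: "x \<in> N n \<Longrightarrow> is_unit_of x y \<Longrightarrow> y \<in> N n"
    and r_N: "1 \<le> k \<Longrightarrow> r k \<in> N (Suc k)"
    and N_r_comm: "x \<in> N l \<Longrightarrow> l < k \<Longrightarrow> x * r k = r k * x"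
    and E_add: "E n (x + y) = E n x + E n y"
    and E_sc: "E n (c \<odot> x) = c \<odot> E n x"
    and E_N: "x \<in> N (Suc n) \<Longrightarrow> E (Suc n) x \<in> N n"
    and E_left: "y \<in> N n \<Longrightarrow> E (Suc n) (y * x) = y * E (Suc n) x"
    and E_right: "y \<in> N n \<Longrightarrow> E (Suc n) (x * y) = E (Suc n) x * y"
    and E_one: "E (Suc n) 1 = d \<odot> 1"
    and E_r: "1 \<le> k \<Longrightarrow> E (Suc k) (r k) = 1"
    and E_r_conj: "1 \<le> k \<Longrightarrow> y \<in> N k \<Longrightarrow> E (Suc k) (r k * y * r k) = E k y"
    and E_cyclic: "1 \<le> k \<Longrightarrow> x \<in> N (Suc k) \<Longrightarrow> E k (E (Suc k) (r k * x)) = E k (E (Suc k) (x * r k))"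
begin

lemma E_diff: "E n (x - y) = E n x - E n y"
  using E_add[of n "x - y" y] by (simp add: algebra_simps)

lemma N_diff: "x \<in> N n \<Longrightarrow> y \<in> N n \<Longrightarrow> x - y \<in> N n"
  using N_add[of x n "(- 1) \<odot> y"] N_sc[of y n "- 1"] by simp

section \<open>Iterated R-traces and the elements that may be rotated under them\<close>

text \<open>The highest position is removed first, because \<open>E (Suc n)\<close> is a bimodule
  map over \<open>N n\<close> only.\<close>

fun ptr :: "nat \<Rightarrow> nat \<Rightarrow> 'e \<Rightarrow> 'e"
  where
    "ptr q 0 x = x"
  | "ptr q (Suc j) x = ptr q j (E (q + Suc j) x)"

lemma ptr_N: "x \<in> N (q + j) \<Longrightarrow> ptr q j x \<in> N q"
  by (induction j arbitrary: x) (use E_N in auto)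

lemma ptr_left: "y \<in> N q \<Longrightarrow> ptr q j (y * x) = y * ptr q j x"
proof (induction j arbitrary: x)
  case (Suc j)
  then have "y \<in> N (q + j)" using N_mono[of q "q + j"] by simp
  then show ?case using Suc E_left by simp
qed simp

lemma ptr_right: "y \<in> N q \<Longrightarrow> ptr q j (x * y) = ptr q j x * y"
proof (induction j arbitrary: x)
  case (Suc j)
  then have "y \<in> N (q + j)" using N_mono[of q "q + j"] by simp
  then show ?case using Suc E_right by simp
qed simp

lemma ptr_add: "ptr q j (x + y) = ptr q j x + ptr q j y"
  by (induction j arbitrary: x y) (simp_all add: E_add)

lemma ptr_sc: "ptr q j (c \<odot> x) = c \<odot> ptr q j x"
  by (induction j arbitrary: x) (simp_all add: E_sc)

lemma ptr_diff: "ptr q j (x - y) = ptr q j x - ptr q j y"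
  by (induction j arbitrary: x y) (simp_all add: E_diff)

lemma ptr_ptr: "ptr q (i + j) x = ptr q i (ptr (q + i) j x)"
  by (induction j arbitrary: x) (simp_all add: add.assoc)

abbreviation tr :: "nat \<Rightarrow> 'e \<Rightarrow> 'e"
  where "tr n \<equiv> ptr 0 n"

text \<open>Positions beyond \<open>l + 1\<close> are traced out by the bimodule property, which
  lets \<open>r l\<close> pass; once \<open>l + 1\<close> is the last position,
  \<open>E_cyclic\<close> applies.\<close>

lemma tr_r_cyclic:
  assumes "1 \<le> l" "l < n" "x \<in> N n"
  shows "tr n (r l * x) = tr n (x * r l)"
  using assms
proof (induction n arbitrary: x)
  case (Suc n)
  show ?case
  proof (cases "l = n")
    case True
    then obtain p where n: "n = Suc p" using Suc.prems by (metis Suc_le_D One_nat_def)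
    have "E n (E (Suc n) (r n * x)) = E n (E (Suc n) (x * r n))"
      using E_cyclic[of n x] Suc.prems True by simp
    then show ?thesis unfolding True n by simp
  next
    case False
    then have "r l \<in> N n"
      using Suc.prems r_N N_mono[of "Suc l" n] by auto
    then have "tr (Suc n) (r l * x) = tr n (r l * E (Suc n) x)"
      "tr (Suc n) (x * r l) = tr n (E (Suc n) x * r l)"
      using E_left E_right by simp_all
    then show ?thesis
      using Suc.IH[of "E (Suc n) x"] False Suc.prems E_N by simp
  qed
qed simp

text \<open>The R-trace is not cyclic for general elements. Those that may be rotated are closed
  under sums, products, scalars and inverses, and they contain the generators \<open>r l\<close>,
  hence the skew-symmetrizers and the block R-matrices.\<close>

definition cyc :: "nat \<Rightarrow> 'e \<Rightarrow> bool"
  where "cyc n x \<longleftrightarrow> x \<in> N n \<and> (\<forall>y\<in>N n. tr n (x * y) = tr n (y * x))"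

lemma cyc_r: "1 \<le> l \<Longrightarrow> l < n \<Longrightarrow> cyc n (r l)"
  unfolding cyc_def using tr_r_cyclic r_N N_mono[of "Suc l" n] by auto

lemma cyc_one: "cyc n 1"
  unfolding cyc_def by (simp add: N_one)

lemma cyc_mult:
  assumes "cyc n x" "cyc n y"
  shows "cyc n (x * y)"
proof -
  have "tr n (x * y * w) = tr n (w * (x * y))" if "w \<in> N n" for w
  proof -
    have m: "y * w \<in> N n" "w * x \<in> N n"
      using assms that N_mult unfolding cyc_def by auto
    have "tr n (x * (y * w)) = tr n (y * w * x)"
      using assms(1) m unfolding cyc_def by blast
    also have "\<dots> = tr n (y * (w * x))" by (simp only: mult.assoc)
    also have "\<dots> = tr n (w * x * y)"
      using assms(2) m unfolding cyc_def by blast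
    finally have "tr n (x * y * w) = tr n (w * (x * y))" by (simp only: mult.assoc)
    then show ?thesis .
  qed
  then show ?thesis
    using assms N_mult unfolding cyc_def by blast
qed

lemma cyc_add: "cyc n x \<Longrightarrow> cyc n y \<Longrightarrow> cyc n (x + y)"
  unfolding cyc_def using N_add by (auto simp: distrib_left distrib_right ptr_add)

lemma cyc_sc: "cyc n x \<Longrightarrow> cyc n (c \<odot> x)"
  unfolding cyc_def using N_sc by (auto simp: sc_simps ptr_sc)

lemma cyc_diff: "cyc n x \<Longrightarrow> cyc n y \<Longrightarrow> cyc n (x - y)"
  unfolding cyc_def using N_diff by (auto simp: left_diff_distrib right_diff_distrib ptr_diff)

text \<open>With \<open>y\<close> inverse to \<open>x\<close>:
  \<open>tr (y w) = tr (y w y x) = tr (x y w y) = tr (w y)\<close>.\<close>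

lemma cyc_unit:
  assumes "cyc n x" "is_unit_of x y"
  shows "cyc n y"
proof -
  have y: "y \<in> N n" using assms N_unit unfolding cyc_def by blast
  have xy: "x * y = 1" "y * x = 1" using assms(2) unfolding is_unit_of_def by auto
  have "tr n (y * w) = tr n (w * y)" if "w \<in> N n" for w
  proof -
    have "tr n (x * (y * w * y)) = tr n (y * w * y * x)"
      using assms(1) that y N_mult unfolding cyc_def by blast
    moreover have "x * (y * w * y) = (x * y) * (w * y)" "y * w * y * x = y * w * (y * x)"
      by (simp_all only: mult.assoc)
    ultimately show ?thesis using xy by simp
  qed
  then show ?thesis using y unfolding cyc_def by blast
qed

lemma cyc_skewer: "p + k \<le> n \<Longrightarrow> cyc n (skewer p k)"
proof (induction p k rule: skewer.induct)
  case (3 p n')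
  have "cyc n (skewer p (Suc n'))" using 3 by simp
  then show ?case
    unfolding skewer.simps by (intro cyc_sc cyc_mult cyc_diff cyc_one cyc_r) (use 3 in auto)
qed (simp_all add: cyc_one)

lemma skewer_N: "p + k \<le> n \<Longrightarrow> skewer p k \<in> N n"
  using cyc_skewer unfolding cyc_def by blast

text \<open>In the recursion the term without \<open>r\<close> contributes the loop value
  \<open>d\<close>, the other one \<open>A * E(r) * A = A\<close>. The scalar is
  \<open>(d - (n + 1)) / (n + 2)\<close>; only proportionality matters, so it stays unnamed and may
  vanish.\<close>

lemma E_skewer:
  "\<exists>c. E (Suc (Suc n)) (skewer 0 (Suc (Suc n))) = c \<odot> skewer 0 (Suc n)"
proof -
  let ?A = "skewer 0 (Suc n)" and ?M = "of_nat (Suc (Suc n)) :: complex"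
  have A: "?A \<in> N (Suc n)" by (simp add: skewer_N)
  have 1: "E (Suc (Suc n)) ?A = d \<odot> ?A"
    using E_left[OF A, of 1] by (simp add: E_one sc_simps)
  have 2: "E (Suc (Suc n)) (?A * r (Suc n) * ?A) = ?A"
    using E_left[OF A, of "r (Suc n) * ?A"] E_right[OF A, of "r (Suc n)"] E_r[of "Suc n"]
    by (simp add: mult.assoc skewer_idem)
  have "E (Suc (Suc n)) (?M \<odot> skewer 0 (Suc (Suc n))) = (d - of_nat (Suc n)) \<odot> ?A"
    unfolding skewer_Suc E_diff E_sc add_0 1 2 by (simp only: scale_left_diff_distrib)
  then have "(1 / ?M) \<odot> ?M \<odot> E (Suc (Suc n)) (skewer 0 (Suc (Suc n)))
      = ((1 / ?M) * (d - of_nat (Suc n))) \<odot> ?A"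
    by (simp only: E_sc scale_scale)
  moreover have "1 / ?M * ?M = 1" using of_nat_neq_0[of "Suc n"] by (metis divide_self_if nonzero_divide_eq_eq)
  ultimately show ?thesis by (auto simp only: scale_scale scale_one)
qed

lemma ptr_skewer: "1 \<le> k \<Longrightarrow> \<exists>c. ptr k j (skewer 0 (k + j)) = c \<odot> skewer 0 k"
proof (induction j)
  case 0
  then show ?case by (metis add_0_right ptr.simps(1) scale_one)
next
  case (Suc j)
  then obtain n where n: "k + j = Suc n" by (metis Suc_le_D One_nat_def plus_nat.simps(2))
  obtain c where "ptr k j (skewer 0 (k + j)) = c \<odot> skewer 0 k" using Suc by blast
  moreover obtain c' where "E (Suc (Suc n)) (skewer 0 (Suc (Suc n))) = c' \<odot> skewer 0 (Suc n)"
    using E_skewer by blast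
  ultimately have "ptr k (Suc j) (skewer 0 (k + Suc j)) = (c' * c) \<odot> skewer 0 k"
    using n by (simp add: ptr_sc del: skewer.simps)
  then show ?case by blast
qed

text \<open>\<open>QH_k\<close> contains the skew-symmetrizer on \<open>m\<close> positions but only
  \<open>k\<close> operators. The positions beyond \<open>k\<close> meet nothing except the
  skew-symmetrizer and are traced out first.\<close>

lemma tr_skewer_reduce:
  assumes "1 \<le> k" "k \<le> m"
  shows "\<exists>c. \<forall>x\<in>N k. tr m (skewer 0 m * x) = c \<odot> tr k (skewer 0 k * x)"
proof -
  obtain j where m: "m = k + j" using assms(2) le_Suc_ex by blast
  obtain c where "ptr k j (skewer 0 (k + j)) = c \<odot> skewer 0 k"
    using ptr_skewer[OF assms(1)] by blast
  then show ?thesis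
    unfolding m using ptr_ptr[of 0 k j] by (auto simp: ptr_right ptr_sc sc_simps)
qed

end


section \<open>Commuting transfer matrices\<close>

text \<open>\<open>T k z\<close> is the overlined copy number \<open>k\<close> of one matrix
  function, and \<Omega> is the set of arguments off its poles. With \<open>h\<close> nonzero the
  relation has distinct arguments at which its coefficient is 1; these produce the compatibility
  with skew-symmetrizers.\<close>

locale rtt_tower = r_tower sc r N E d
  for sc :: "complex \<Rightarrow> 'e::ring_1 \<Rightarrow> 'e" (infixr "\<odot>" 75) and r N E d +
  fixes T :: "nat \<Rightarrow> complex \<Rightarrow> 'e" and \<Omega> :: "complex set" and h :: complex
  assumes T_one_N: "T 1 z \<in> N 1"
    and T_Suc: "1 \<le> k \<Longrightarrow> T (Suc k) z = r k * T k z * r k"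
    and rtt_one: "u \<in> \<Omega> \<Longrightarrow> v \<in> \<Omega> \<Longrightarrow> u \<noteq> v \<Longrightarrow>
      (r 1 + (h / (v - u)) \<odot> 1) * (T 1 u * T 2 v) = T 1 v * T 2 u * (r 1 + (h / (v - u)) \<odot> 1)"
    and h_nz: "h \<noteq> 0"
begin

lemma T_N: "1 \<le> k \<Longrightarrow> T k z \<in> N k"
proof (induction k rule: dec_induct)
  case base
  then show ?case using T_one_N by simp
next
  case (step n)
  then show ?case
    unfolding T_Suc[OF step(1)] using r_N N_mono[of n "Suc n"] by (intro N_mult) auto
qed

section \<open>The RTT relation in all positions\<close>

lemma r_T: "1 \<le> k \<Longrightarrow> r k * T k z = T (Suc k) z * r k" "1 \<le> k \<Longrightarrow> r k * T (Suc k) z = T k z * r k"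
  by (simp_all add: T_Suc mult.assoc r_sq r_sq')

text \<open>For \<open>k < l\<close> this is locality. For \<open>l + 2 \<le> k\<close> locality
  gives nothing, since an overlined copy occupies all positions up to \<open>k\<close>; the case
  \<open>k = l + 2\<close> uses the braid relation, and larger \<open>k\<close> follow by
  induction.\<close>

lemma T_r_comm: "1 \<le> k \<Longrightarrow> 1 \<le> l \<Longrightarrow> k \<noteq> l \<Longrightarrow> k \<noteq> Suc l \<Longrightarrow> T k z * r l = r l * T k z"
proof (induction k arbitrary: l rule: less_induct)
  case (less k)
  show ?case
  proof (cases "k < l")
    case True
    then show ?thesis using N_r_comm T_N less.prems by blast
  next
    case False
    then have "l + 2 \<le> k" using less.prems by linarith
    then obtain i where "k = l + 2 + i" using le_Suc_ex by blast
    then obtain j where j: "k = Suc j" "1 \<le> j" "l < j" using less.prems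
      by (intro that[of "l + 1 + i"]) auto
    show ?thesis
    proof (cases "j = Suc l")
      case True
      have Tl: "T k z = r j * (r l * (T l z * (r l * r j)))"
        using j True less.prems by (simp add: T_Suc mult.assoc)
      have br: "r l * (r j * r l) = r j * (r l * r j)"
        using r_braid[of l] less.prems True by (simp add: mult.assoc)
      have IH: "T l z * r j = r j * T l z"
        using less.IH[of l j] j True less.prems by simp
      have "T k z * r l = r j * (r l * (T l z * (r l * (r j * r l))))"
        unfolding Tl by (simp only: mult.assoc)
      also have "\<dots> = r j * (r l * (T l z * r j * (r l * r j)))"
        unfolding br by (simp only: mult.assoc)
      also have "\<dots> = (r j * (r l * r j)) * (T l z * (r l * r j))"
        unfolding IH by (simp only: mult.assoc)
      also have "\<dots> = r l * T k z"
        unfolding br[symmetric] Tl by (simp only: mult.assoc)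
      finally show ?thesis .
    next
      case False
      have IH: "T j z * r l = r l * T j z"
        using less.IH[of j l] j False less.prems by simp
      have rr: "r j * r l = r l * r j"
        using r_far'[of j l] j False less.prems by simp
      have "T k z * r l = r j * T j z * (r j * r l)"
        unfolding j(1) T_Suc[OF j(2)] by (simp only: mult.assoc)
      also have "\<dots> = r j * (T j z * r l) * r j"
        unfolding rr by (simp only: mult.assoc)
      also have "\<dots> = (r j * r l) * T j z * r j"
        unfolding IH by (simp only: mult.assoc)
      also have "\<dots> = r l * T k z"
        unfolding rr j(1) T_Suc[OF j(2)] by (simp only: mult.assoc)
      finally show ?thesis .
    qed
  qed
qed

text \<open>Conjugation by \<open>g = r k * r (Suc k)\<close> moves \<open>T k\<close>,
  \<open>T (Suc k)\<close> and \<open>r k\<close> up by one position, so the relation propagates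
  from position 1.\<close>

lemma rtt:
  assumes "1 \<le> k" "u \<in> \<Omega>" "v \<in> \<Omega>" "u \<noteq> v"
  shows "(r k + (h / (v - u)) \<odot> 1) * (T k u * T (Suc k) v)
    = T k v * T (Suc k) u * (r k + (h / (v - u)) \<odot> 1)"
  using assms(1)
proof (induction k rule: dec_induct)
  case base
  then show ?case using rtt_one assms by (simp add: numeral_2_eq_2)
next
  case (step k)
  let ?s = "(h / (v - u)) \<odot> 1" and ?g = "r k * r (Suc k)" and ?g' = "r (Suc k) * r k"
  have k: "1 \<le> k" using step by simp
  have gg: "?g * ?g' = 1" using k by (simp add: mult.assoc r_sq' r_sq)
  have gr: "?g * r k = r (Suc k) * ?g"
    using r_braid[OF k] by (simp add: mult.assoc)
  have T1: "?g * T k z = T (Suc k) z * ?g" for z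
  proof -
    have "?g * T k z = r k * (T k z * r (Suc k))"
      using T_r_comm[of k "Suc k" z] k by (simp add: mult.assoc)
    also have "\<dots> = T (Suc k) z * ?g"
      unfolding mult.assoc[symmetric] r_T(1)[OF k] ..
    finally show ?thesis .
  qed
  have T2: "?g * T (Suc k) z = T (Suc (Suc k)) z * ?g" for z
  proof -
    have "?g * T (Suc k) z = r k * T (Suc (Suc k)) z * r (Suc k)"
      using r_T(1)[of "Suc k" z] by (simp add: mult.assoc)
    also have "r k * T (Suc (Suc k)) z = T (Suc (Suc k)) z * r k"
      using T_r_comm[of "Suc (Suc k)" k z] k by simp
    finally show ?thesis by (simp add: mult.assoc)
  qed
  have g: "?g * (r k + ?s) = (r (Suc k) + ?s) * ?g"
    using gr by (simp add: distrib_left distrib_right sc_simps)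
  have "(r (Suc k) + ?s) * (T (Suc k) u * T (Suc (Suc k)) v) * ?g
      = (r (Suc k) + ?s) * (T (Suc k) u * (?g * T (Suc k) v))"
    unfolding T2 by (simp only: mult.assoc)
  also have "\<dots> = (r (Suc k) + ?s) * ((T (Suc k) u * ?g) * T (Suc k) v)"
    by (simp only: mult.assoc)
  also have "\<dots> = ((r (Suc k) + ?s) * ?g) * (T k u * T (Suc k) v)"
    unfolding T1[symmetric] by (simp only: mult.assoc)
  also have "\<dots> = ?g * ((r k + ?s) * (T k u * T (Suc k) v))"
    unfolding g[symmetric] by (simp only: mult.assoc)
  also have "\<dots> = (?g * T k v) * (T (Suc k) u * (r k + ?s))"
    unfolding step.IH by (simp only: mult.assoc)
  also have "\<dots> = T (Suc k) v * ((?g * T (Suc k) u) * (r k + ?s))"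
    unfolding T1 by (simp only: mult.assoc)
  also have "\<dots> = T (Suc k) v * T (Suc (Suc k)) u * (?g * (r k + ?s))"
    unfolding T2 by (simp only: mult.assoc)
  also have "\<dots> = T (Suc k) v * T (Suc (Suc k)) u * (r (Suc k) + ?s) * ?g"
    unfolding g by (simp only: mult.assoc)
  finally have "(r (Suc k) + ?s) * (T (Suc k) u * T (Suc (Suc k)) v) * ?g * ?g'
      = T (Suc k) v * T (Suc (Suc k)) u * (r (Suc k) + ?s) * ?g * ?g'"
    by (rule arg_cong)
  then show ?case unfolding mult.assoc[of _ ?g] gg by simp
qed

subsection \<open>Block R-matrices\<close>

fun Tl :: "nat \<Rightarrow> complex list \<Rightarrow> 'e"
  where
    "Tl p [] = 1"
  | "Tl p (u # us) = T (Suc p) u * Tl (Suc p) us"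

text \<open>Carries \<open>T(w)\<close> from the right end of a block with arguments
  \<open>us\<close> to its left end, with one R-matrix \<open>r + h / (w - u)\<close> per crossing;
  the rightmost factor acts first.\<close>

fun row :: "nat \<Rightarrow> complex list \<Rightarrow> complex \<Rightarrow> 'e"
  where
    "row p [] w = 1"
  | "row p (u # us) w = (r (Suc p) + (h / (w - u)) \<odot> 1) * row (Suc p) us w"

text \<open>Carries the elements of the second block across \<open>us\<close> one after the other.
  Once \<open>w\<close> has passed, the block \<open>us\<close> begins one position later, whence
  \<open>Suc p\<close>.\<close>

fun blk :: "nat \<Rightarrow> complex list \<Rightarrow> complex list \<Rightarrow> 'e"
  where
    "blk p us [] = 1"
  | "blk p us (w # ws) = blk (Suc p) us ws * row p us w"

lemma Tl_append: "Tl p (us @ ws) = Tl p us * Tl (p + length us) ws"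
  by (induction us arbitrary: p) (simp_all add: mult.assoc)

lemma Tl_comm:
  assumes "\<And>k z. p < k \<Longrightarrow> k \<le> p + length us \<Longrightarrow> x * T k z = T k z * x"
  shows "x * Tl p us = Tl p us * x"
  using assms
proof (induction us arbitrary: p)
  case (Cons u us)
  have 1: "x * T (Suc p) u = T (Suc p) u * x" using Cons.prems by simp
  have 2: "x * Tl (Suc p) us = Tl (Suc p) us * x" using Cons by simp
  show ?case unfolding Tl.simps by (rule comm_mult) fact+
qed simp

lemma row_comm:
  assumes "\<And>k. p < k \<Longrightarrow> k \<le> p + length us \<Longrightarrow> x * r k = r k * x"
  shows "x * row p us w = row p us w * x"
  using assms
proof (induction us arbitrary: p)
  case (Cons u us)
  have "x * r (Suc p) = r (Suc p) * x" using Cons.prems by simp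
  then have 1: "x * (r (Suc p) + (h / (w - u)) \<odot> 1) = (r (Suc p) + (h / (w - u)) \<odot> 1) * x"
    by (simp add: distrib_left distrib_right sc_simps)
  have 2: "x * row (Suc p) us w = row (Suc p) us w * x" using Cons by simp
  show ?case unfolding row.simps by (rule comm_mult) fact+
qed simp

lemma blk_comm:
  assumes "\<And>k. p < k \<Longrightarrow> k < p + length us + length ws \<Longrightarrow> x * r k = r k * x"
  shows "x * blk p us ws = blk p us ws * x"
  using assms
proof (induction ws arbitrary: p)
  case (Cons w ws)
  have 1: "x * row p us w = row p us w * x" using Cons.prems by (intro row_comm) simp
  have 2: "x * blk (Suc p) us ws = blk (Suc p) us ws * x" using Cons by simp
  show ?case unfolding blk.simps by (rule comm_mult) fact+
qed simp

lemma row_T: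
  assumes "set us \<subseteq> \<Omega>" "w \<in> \<Omega>" "w \<notin> set us"
  shows "row p us w * Tl p (us @ [w]) = Tl p (w # us) * row p us w"
  using assms
proof (induction us arbitrary: p)
  case (Cons u us)
  let ?s = "(h / (w - u)) \<odot> 1" and ?R = "row (Suc p) us w"
  have c1: "T (Suc p) u * ?R = ?R * T (Suc p) u"
    by (rule row_comm) (simp add: T_r_comm)
  have "r (Suc p) * Tl (Suc (Suc p)) us = Tl (Suc (Suc p)) us * r (Suc p)"
    by (rule Tl_comm) (simp add: T_r_comm)
  then have c2: "(r (Suc p) + ?s) * Tl (Suc (Suc p)) us = Tl (Suc (Suc p)) us * (r (Suc p) + ?s)"
    by (simp add: distrib_left distrib_right sc_simps)
  have rt: "(r (Suc p) + ?s) * (T (Suc p) u * T (Suc (Suc p)) w)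
      = T (Suc p) w * T (Suc (Suc p)) u * (r (Suc p) + ?s)"
    using Cons.prems by (intro rtt) auto
  have IH: "?R * Tl (Suc p) (us @ [w]) = T (Suc (Suc p)) w * (Tl (Suc (Suc p)) us * ?R)"
    using Cons by (simp add: mult.assoc)
  have "row p (u # us) w * Tl p ((u # us) @ [w])
      = (r (Suc p) + ?s) * ((?R * T (Suc p) u) * Tl (Suc p) (us @ [w]))"
    by (simp add: mult.assoc)
  also have "\<dots> = (r (Suc p) + ?s) * (T (Suc p) u * (?R * Tl (Suc p) (us @ [w])))"
    unfolding c1[symmetric] by (simp only: mult.assoc)
  also have "\<dots> = ((r (Suc p) + ?s) * (T (Suc p) u * T (Suc (Suc p)) w)) * Tl (Suc (Suc p)) us * ?R"
    unfolding IH by (simp only: mult.assoc)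
  also have "\<dots> = T (Suc p) w * T (Suc (Suc p)) u * ((r (Suc p) + ?s) * Tl (Suc (Suc p)) us) * ?R"
    unfolding rt by (simp only: mult.assoc)
  also have "\<dots> = Tl p (w # u # us) * row p (u # us) w"
    unfolding c2 by (simp add: mult.assoc)
  finally show ?case .
qed simp

lemma blk_T:
  assumes "set us \<subseteq> \<Omega>" "set ws \<subseteq> \<Omega>" "set us \<inter> set ws = {}"
  shows "blk p us ws * Tl p (us @ ws) = Tl p (ws @ us) * blk p us ws"
  using assms
proof (induction ws arbitrary: p)
  case (Cons w ws)
  let ?B = "blk (Suc p) us ws" and ?R = "row p us w"
  have "Tl (p + length us + 1) ws * ?R = ?R * Tl (p + length us + 1) ws"
    using T_r_comm by (intro row_comm Tl_comm[symmetric]) auto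
  then have c1: "?R * Tl (p + length (us @ [w])) ws = Tl (p + length (us @ [w])) ws * ?R"
    by simp
  have c2: "T (Suc p) w * ?B = ?B * T (Suc p) w"
    using T_r_comm by (intro blk_comm) auto
  have IH: "?B * Tl (Suc p) (us @ ws) = Tl (Suc p) (ws @ us) * ?B"
    using Cons by simp
  have R: "?R * Tl p (us @ [w]) = T (Suc p) w * Tl (Suc p) us * ?R"
    using row_T[of us w p] Cons.prems by simp
  have "Tl p (us @ w # ws) = Tl p (us @ [w]) * Tl (p + length (us @ [w])) ws"
    using Tl_append[of p "us @ [w]" ws] by simp
  then have "blk p us (w # ws) * Tl p (us @ w # ws)
      = ?B * ((?R * Tl p (us @ [w])) * Tl (p + length (us @ [w])) ws)"
    by (simp add: mult.assoc)
  also have "\<dots> = ?B * (T (Suc p) w * (Tl (Suc p) us * (?R * Tl (p + length (us @ [w])) ws)))"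
    unfolding R by (simp only: mult.assoc)
  also have "\<dots> = (?B * T (Suc p) w) * (Tl (Suc p) us * Tl (p + length (us @ [w])) ws) * ?R"
    unfolding c1 by (simp only: mult.assoc)
  also have "Tl (Suc p) us * Tl (p + length (us @ [w])) ws = Tl (Suc p) (us @ ws)"
    using Tl_append[of "Suc p" us ws] by simp
  also have "?B * T (Suc p) w * Tl (Suc p) (us @ ws) * ?R
      = T (Suc p) w * (?B * Tl (Suc p) (us @ ws)) * ?R"
    unfolding c2[symmetric] by (simp only: mult.assoc)
  also have "\<dots> = Tl p ((w # ws) @ us) * blk p us (w # ws)"
    unfolding IH by (simp add: mult.assoc)
  finally show ?case .
qed simp

section \<open>Fusion: how block R-matrices transport \<open>r k + 1\<close>\<close>

text \<open>
  If \<open>x\<close> pushes \<open>k\<close> to \<open>l\<close>, then so does its inverse from \<open>l\<close> to \<open>k\<close>; this makes the fusion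
  property of the block R-matrix and that of its inverse a single statement.
\<close>

definition pushes :: "'e \<Rightarrow> nat \<Rightarrow> nat \<Rightarrow> bool"
  where "pushes x k l \<longleftrightarrow> inv_el x \<and> (\<exists>y. inv_el y \<and> x * (r k + 1) = (r l + 1) * y)"

lemma pushes_trans: "pushes x k l \<Longrightarrow> pushes y l q \<Longrightarrow> pushes (y * x) k q"
proof -
  assume "pushes x k l" "pushes y l q"
  then obtain x' y' where *: "inv_el x'" "x * (r k + 1) = (r l + 1) * x'" "inv_el y'"
      "y * (r l + 1) = (r q + 1) * y'" "inv_el x" "inv_el y"
    unfolding pushes_def by blast
  have "y * x * (r k + 1) = y * (r l + 1) * x'"
    unfolding mult.assoc *(2) ..
  then have "y * x * (r k + 1) = (r q + 1) * (y' * x')"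
    unfolding *(4) by (simp only: mult.assoc)
  then show "pushes (y * x) k q"
    unfolding pushes_def using * inv_el_mult by blast
qed

lemma pushes_comm: "inv_el x \<Longrightarrow> x * r k = r k * x \<Longrightarrow> pushes x k k"
  unfolding pushes_def by (auto simp: distrib_left distrib_right)

lemma pushes_inverse:
  assumes "pushes x k l" "is_unit_of x y"
  shows "\<exists>z. y * (r l + 1) = (r k + 1) * z"
proof -
  obtain x' z where *: "is_unit_of x' z" "x * (r k + 1) = (r l + 1) * x'"
    using assms unfolding pushes_def inv_el_def by blast
  have "y * (r l + 1) = y * ((r l + 1) * x') * z"
    using *(1) unfolding is_unit_of_def by (simp add: mult.assoc)
  also have "\<dots> = (y * x) * (r k + 1) * z"
    unfolding *(2)[symmetric] by (simp only: mult.assoc)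
  also have "\<dots> = (r k + 1) * z"
    using assms(2) unfolding is_unit_of_def by simp
  finally show ?thesis by blast
qed

text \<open>Yang-Baxter with one coefficient equal to 1. The condition says
  \<open>1 / b = 1 / a + 1\<close>: from \<open>a = h / x\<close> it produces
  \<open>b = h / (x + h)\<close>, which is why the arguments of a fused block have spacing
  \<open>h\<close>.\<close>

lemma pushes_pair:
  assumes "1 \<le> k" "a = b * (a + 1)" "a \<notin> {1, - 1}" "b \<notin> {1, - 1}"
  shows "pushes ((r k + a \<odot> 1) * (r (Suc k) + b \<odot> 1)) k (Suc k)"
    and "pushes ((r (Suc k) + a \<odot> 1) * (r k + b \<odot> 1)) (Suc k) k"
proof -
  have i: "inv_el (r k + c \<odot> 1)" "inv_el (r (Suc k) + c \<odot> 1)" if "c \<in> {a, b}" for c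
    using that assms inv_el_r_plus by auto
  have "a * 1 = b * (a + 1)" "1 * a = b * (1 + a)"
    using assms(2) by (simp_all add: add.commute)
  note yb = r_yang_baxter[OF assms(1) this(1)] r_yang_baxter[OF assms(1) this(2)]
  have "(r k + a \<odot> 1) * (r (Suc k) + b \<odot> 1) * (r k + 1)
      = (r (Suc k) + 1) * ((r k + b \<odot> 1) * (r (Suc k) + a \<odot> 1))"
    using yb(1) by (simp only: mult.assoc scale_one)
  then show "pushes ((r k + a \<odot> 1) * (r (Suc k) + b \<odot> 1)) k (Suc k)"
    unfolding pushes_def using inv_el_mult i[of a] i[of b] by auto
  have "(r (Suc k) + a \<odot> 1) * (r k + b \<odot> 1) * (r (Suc k) + 1)
      = (r k + 1) * ((r (Suc k) + b \<odot> 1) * (r k + a \<odot> 1))"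
    using yb(2)[symmetric] by (simp only: mult.assoc scale_one)
  then show "pushes ((r (Suc k) + a \<odot> 1) * (r k + b \<odot> 1)) (Suc k) k"
    unfolding pushes_def using inv_el_mult i[of a] i[of b] by auto
qed

text \<open>The difference 0 is a pole of \<open>h / (w - u)\<close>; at \<open>h\<close> and
  \<open>- h\<close> this coefficient is 1 or -1, the values excluded in
  \<open>inv_el_r_plus\<close>.\<close>

definition generic :: "complex \<Rightarrow> complex \<Rightarrow> bool"
  where "generic u w \<longleftrightarrow> w - u \<noteq> 0 \<and> w - u \<noteq> h \<and> w - u \<noteq> - h"

lemma generic_coeff:
  assumes "generic u w"
  shows "h / (w - u) \<notin> {1, - 1}"
  using assms unfolding generic_def by (auto simp: divide_eq_eq)

lemma generic_step:
  assumes "generic u w" "generic u' w'" "w' - u' = w - u + h"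
  shows "h / (w - u) = h / (w' - u') * (h / (w - u) + 1)"
proof -
  have "w - u \<noteq> 0" "w - u + h \<noteq> 0"
    using assms unfolding generic_def by (auto simp: add_eq_0_iff)
  moreover have "h / x = h / (x + h) * (h / x + 1)" if "x \<noteq> 0" "x + h \<noteq> 0" for x
  proof -
    have "h / x + 1 = (x + h) / x" using that by (simp add: field_simps)
    then show ?thesis using that by simp
  qed
  ultimately show ?thesis unfolding assms(3) by blast
qed

lemma inv_el_row: "(\<And>u. u \<in> set us \<Longrightarrow> generic u w) \<Longrightarrow> inv_el (row p us w)"
proof (induction us arbitrary: p)
  case (Cons u us)
  have "generic u w" using Cons.prems by simp
  then have "inv_el (r (Suc p) + (h / (w - u)) \<odot> 1)"
    using generic_coeff by (intro inv_el_r_plus) auto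
  then show ?case using Cons by (auto intro: inv_el_mult)
qed (simp add: inv_el_one)

lemma inv_el_blk:
  "(\<And>u w. u \<in> set us \<Longrightarrow> w \<in> set ws \<Longrightarrow> generic u w) \<Longrightarrow> inv_el (blk p us ws)"
  by (induction ws arbitrary: p) (auto intro!: inv_el_one inv_el_mult inv_el_row)

text \<open>The two crossings with \<open>us ! i\<close> and \<open>us ! Suc i\<close> are adjacent
  factors whose coefficients fit \<open>pushes_pair\<close>; all other factors of the row commute
  with the \<open>r + 1\<close> being carried.\<close>

lemma row_pushes:
  assumes "\<And>u. u \<in> set us \<Longrightarrow> generic u w" "Suc i < length us" "us ! i - us ! Suc i = h"
  shows "pushes (row p us w) (p + Suc i) (p + Suc (Suc i))"
  using assms
proof (induction us arbitrary: p i)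
  case (Cons u us)
  show ?case
  proof (cases i)
    case 0
    with Cons.prems obtain v vs where us: "us = v # vs" by (cases us) auto
    have uv: "u - v = h" using Cons.prems us 0 by simp
    have g: "generic u w" "generic v w" "\<And>x. x \<in> set vs \<Longrightarrow> generic x w"
      using Cons.prems us by auto
    have w: "w - v = w - u + h" using uv by (simp add: algebra_simps)
    let ?a = "h / (w - u)" and ?b = "h / (w - v)"
    have 1: "pushes ((r (Suc p) + ?a \<odot> 1) * (r (Suc (Suc p)) + ?b \<odot> 1)) (Suc p) (Suc (Suc p))"
      using g generic_coeff generic_step[OF g(1,2) w] by (intro pushes_pair(1)) auto
    have 2: "pushes (row (Suc (Suc p)) vs w) (Suc p) (Suc p)"
      using g(3) r_far' by (intro pushes_comm inv_el_row row_comm[symmetric]) auto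
    show ?thesis
      using pushes_trans[OF 2 1] unfolding us 0 by (simp add: mult.assoc)
  next
    case (Suc j)
    have 1: "pushes (row (Suc p) us w) (Suc p + Suc j) (Suc p + Suc (Suc j))"
      using Cons Suc by (intro Cons.IH) auto
    have "generic u w" using Cons.prems by simp
    then have "inv_el (r (Suc p) + (h / (w - u)) \<odot> 1)"
      using generic_coeff by (intro inv_el_r_plus) auto
    moreover have "r (Suc p) * r (Suc p + Suc (Suc j)) = r (Suc p + Suc (Suc j)) * r (Suc p)"
      by (rule r_far') auto
    ultimately have 2: "pushes (r (Suc p) + (h / (w - u)) \<odot> 1) (Suc p + Suc (Suc j)) (Suc p + Suc (Suc j))"
      by (intro pushes_comm) (simp_all only: distrib_left distrib_right sc_simps mult_1_left mult_1_right)
    show ?thesis using pushes_trans[OF 1 2] Suc by simp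
  qed
qed simp

text \<open>Each of the \<open>length ws\<close> rows raises the index by one.\<close>

lemma blk_pushes_left:
  assumes "\<And>u w. u \<in> set us \<Longrightarrow> w \<in> set ws \<Longrightarrow> generic u w"
    "Suc i < length us" "us ! i - us ! Suc i = h"
  shows "pushes (blk p us ws) (p + Suc i) (p + Suc i + length ws)"
  using assms
proof (induction ws arbitrary: p)
  case Nil
  then show ?case by (simp add: pushes_comm inv_el_one)
next
  case (Cons w ws)
  have "pushes (row p us w) (p + Suc i) (p + Suc (Suc i))"
    using Cons.prems by (intro row_pushes) auto
  moreover have "pushes (blk (Suc p) us ws) (Suc p + Suc i) (Suc p + Suc i + length ws)"
    by (rule Cons.IH) (simp_all add: Cons.prems)
  ultimately show ?case using pushes_trans by simp
qed

text \<open>Here the neighbouring arguments are the moving ones, so two consecutive rows are treated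
  together: after reordering, the two crossings with each single \<open>u\<close> form a pair that
  lowers the index by one.\<close>

lemma two_rows_push:
  assumes "\<And>u. u \<in> set us \<Longrightarrow> generic u w \<and> generic u w'" "w - w' = h"
  shows "pushes (row (Suc p) us w' * row p us w) (Suc (p + length us)) (Suc p)"
  using assms
proof (induction us arbitrary: p)
  case Nil
  then show ?case by (simp add: pushes_comm inv_el_one)
next
  case (Cons u us)
  let ?a = "h / (w' - u)" and ?b = "h / (w - u)"
  have g: "generic u w'" "generic u w" using Cons.prems by auto
  have w: "w - u = w' - u + h" using Cons.prems by (simp add: algebra_simps)
  have 1: "pushes ((r (Suc (Suc p)) + ?a \<odot> 1) * (r (Suc p) + ?b \<odot> 1)) (Suc (Suc p)) (Suc p)"
    using g generic_coeff generic_step[OF g w] by (intro pushes_pair(2)) auto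
  have 2: "pushes (row (Suc (Suc p)) us w' * row (Suc p) us w) (Suc (Suc p + length us)) (Suc (Suc p))"
    by (rule Cons.IH) (simp_all add: Cons.prems)
  have "r (Suc p) * row (Suc (Suc p)) us w' = row (Suc (Suc p)) us w' * r (Suc p)"
    using r_far' by (intro row_comm) auto
  then have c: "row (Suc (Suc p)) us w' * (r (Suc p) + ?b \<odot> 1) = (r (Suc p) + ?b \<odot> 1) * row (Suc (Suc p)) us w'"
    by (simp add: distrib_left distrib_right sc_simps)
  have "row (Suc p) (u # us) w' * row p (u # us) w
    = (r (Suc (Suc p)) + ?a \<odot> 1) * (row (Suc (Suc p)) us w' * (r (Suc p) + ?b \<odot> 1)) * row (Suc p) us w"
    by (simp add: mult.assoc)
  also have "\<dots> = ((r (Suc (Suc p)) + ?a \<odot> 1) * (r (Suc p) + ?b \<odot> 1)) * (row (Suc (Suc p)) us w' * row (Suc p) us w)"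
    unfolding c by (simp only: mult.assoc)
  finally show ?case using pushes_trans[OF 2 1] by simp
qed

lemma blk_pushes_right:
  assumes "\<And>u w. u \<in> set us \<Longrightarrow> w \<in> set ws \<Longrightarrow> generic u w"
    "Suc j < length ws" "ws ! j - ws ! Suc j = h"
  shows "pushes (blk p us ws) (p + length us + Suc j) (p + Suc j)"
  using assms
proof (induction ws arbitrary: p j)
  case (Cons w ws)
  show ?case
  proof (cases j)
    case 0
    with Cons.prems obtain v vs where ws: "ws = v # vs" by (cases ws) auto
    have 1: "pushes (row (Suc p) us v * row p us w) (Suc (p + length us)) (Suc p)"
      using Cons.prems ws 0 by (intro two_rows_push) auto
    have 2: "pushes (blk (Suc (Suc p)) us vs) (Suc p) (Suc p)"
      using Cons.prems ws r_far' by (intro pushes_comm inv_el_blk blk_comm[symmetric]) auto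
    show ?thesis using pushes_trans[OF 1 2] unfolding ws 0 by (simp add: mult.assoc)
  next
    case (Suc i)
    have 1: "pushes (row p us w) (p + length us + Suc j) (p + length us + Suc j)"
      using Cons.prems Suc r_far' by (intro pushes_comm inv_el_row row_comm[symmetric]) auto
    have 2: "pushes (blk (Suc p) us ws) (Suc p + length us + Suc i) (Suc p + Suc i)"
      using Cons Suc by (intro Cons.IH) auto
    show ?thesis using pushes_trans[of _ "p + length us + Suc j"] 1 2 Suc by simp
  qed
qed simp

end

context rtt_tower
begin

subsection \<open>Shifting along the tower\<close>

text \<open>The product \<open>r (q + 1) ... r (q + j)\<close>. Conjugation by it moves a block in
  the positions \<open>q + 1, ..., q + j\<close> up by one, including its overlined
  matrices.\<close>

fun cycle :: "nat \<Rightarrow> nat \<Rightarrow> 'e"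
  where
    "cycle q 0 = 1"
  | "cycle q (Suc j) = cycle q j * r (q + Suc j)"

fun cycle_inv :: "nat \<Rightarrow> nat \<Rightarrow> 'e"
  where
    "cycle_inv q 0 = 1"
  | "cycle_inv q (Suc j) = r (q + Suc j) * cycle_inv q j"

lemma cycle_inverse: "cycle q j * cycle_inv q j = 1"
proof (induction j)
  case (Suc j)
  have "cycle q (Suc j) * cycle_inv q (Suc j) = cycle q j * (r (q + Suc j) * (r (q + Suc j) * cycle_inv q j))"
    by (simp add: mult.assoc)
  then show ?case using r_sq'[of "q + Suc j"] Suc by simp
qed simp

lemma cycle_N: "cycle q j \<in> N (Suc (q + j)) \<and> cycle_inv q j \<in> N (Suc (q + j))"
proof (induction j)
  case (Suc j)
  have "r (q + Suc j) \<in> N (Suc (q + Suc j))" by (rule r_N) simp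
  moreover have "cycle q j \<in> N (Suc (q + Suc j))" "cycle_inv q j \<in> N (Suc (q + Suc j))"
    using Suc N_mono[of "Suc (q + j)"] by auto
  ultimately show ?case by (simp only: cycle.simps cycle_inv.simps N_mult simp_thms)
qed (simp add: N_one)

lemma cycle_comm:
  assumes "\<And>k. q < k \<Longrightarrow> k \<le> q + j \<Longrightarrow> x * r k = r k * x"
  shows "x * cycle q j = cycle q j * x"
  using assms
proof (induction j)
  case (Suc j)
  have "x * cycle q j = cycle q j * x" "x * r (q + Suc j) = r (q + Suc j) * x"
    using Suc by auto
  then show ?case unfolding cycle.simps by (rule comm_mult)
qed simp

lemma cycle_r: "q < k \<Longrightarrow> k < q + j \<Longrightarrow> cycle q j * r k = r (Suc k) * cycle q j"
proof (induction j)
  case (Suc j)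
  let ?r = "r (q + Suc j)"
  show ?case
  proof (cases "k = q + j")
    case True
    then obtain i where j: "j = Suc i" using Suc.prems by (cases j) auto
    have br: "r k * (?r * r k) = ?r * (r k * ?r)"
      using r_braid[of k] True Suc.prems by (simp add: mult.assoc)
    have c: "?r * cycle q i = cycle q i * ?r"
      using j r_far' by (intro cycle_comm) auto
    have "cycle q (Suc j) * r k = cycle q i * (r k * (?r * r k))"
      using j True by (simp add: mult.assoc)
    also have "\<dots> = (cycle q i * ?r) * (r k * ?r)"
      unfolding br by (simp only: mult.assoc)
    also have "\<dots> = r (Suc k) * cycle q (Suc j)"
      unfolding c[symmetric] using j True by (simp add: mult.assoc)
    finally show ?thesis .
  next
    case False
    then have k: "k < q + j" using Suc.prems by simp
    have c: "?r * r k = r k * ?r" using k Suc.prems by (intro r_far') auto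
    have "cycle q (Suc j) * r k = (cycle q j * r k) * ?r"
      using c by (simp add: mult.assoc)
    also have "\<dots> = r (Suc k) * cycle q (Suc j)"
      using Suc.IH[OF Suc.prems(1) k] by (simp add: mult.assoc)
    finally show ?thesis .
  qed
qed simp

lemma cycle_T: "q < k \<Longrightarrow> k \<le> q + j \<Longrightarrow> cycle q j * T k z = T (Suc k) z * cycle q j"
proof (induction j)
  case (Suc j)
  let ?r = "r (q + Suc j)"
  show ?case
  proof (cases "k = q + Suc j")
    case True
    have c: "T (Suc k) z * cycle q j = cycle q j * T (Suc k) z"
      using True T_r_comm by (intro cycle_comm) auto
    have "cycle q (Suc j) * T k z = cycle q j * (r k * T k z)"
      using True by (simp add: mult.assoc)
    also have "r k * T k z = T (Suc k) z * r k" using True by (intro r_T) simp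
    also have "cycle q j * (T (Suc k) z * r k) = (T (Suc k) z * cycle q j) * r k"
      unfolding c by (simp only: mult.assoc)
    finally show ?thesis using True by (simp add: mult.assoc)
  next
    case False
    then have k: "k \<le> q + j" using Suc.prems by simp
    have c: "T k z * ?r = ?r * T k z" using k Suc.prems by (intro T_r_comm) auto
    have "cycle q (Suc j) * T k z = (cycle q j * T k z) * ?r"
      using c by (simp add: mult.assoc)
    also have "\<dots> = T (Suc k) z * cycle q (Suc j)"
      using Suc.IH[OF Suc.prems(1) k] by (simp add: mult.assoc)
    finally show ?thesis .
  qed
qed simp

lemma intertwine_mult:
  assumes "(g::'e) * a = a' * g" "g * b = b' * g"
  shows "g * (a * b) = a' * b' * g"
proof -
  have "g * (a * b) = (g * a) * b" by (rule mult.assoc[symmetric])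
  also have "\<dots> = a' * (g * b)" unfolding assms(1) by (rule mult.assoc)
  also have "\<dots> = a' * b' * g" unfolding assms(2) by (rule mult.assoc[symmetric])
  finally show ?thesis .
qed

lemma skewer_intertwine:
  assumes "\<And>l. p < l \<Longrightarrow> l < p + k \<Longrightarrow> g * r l = r (Suc l) * g"
  shows "g * skewer p k = skewer (Suc p) k * g"
  using assms
proof (induction p k rule: skewer.induct)
  case (3 p n)
  have A: "g * skewer p (Suc n) = skewer (Suc p) (Suc n) * g" using 3 by simp
  have "g * r (p + Suc n) = r (Suc p + Suc n) * g" using 3 by simp
  then have B: "g * ((1 / of_nat (Suc n)) \<odot> 1 - r (p + Suc n))
      = ((1 / of_nat (Suc n)) \<odot> 1 - r (Suc p + Suc n)) * g"
    by (simp only: right_diff_distrib left_diff_distrib sc_simps mult_1_left mult_1_right)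
  show ?case
    unfolding skewer.simps sc_mult_left sc_mult_right
      intertwine_mult[OF intertwine_mult[OF A B] A] ..
qed auto

lemma Tl_intertwine:
  assumes "\<And>k z. p < k \<Longrightarrow> k \<le> p + length us \<Longrightarrow> g * T k z = T (Suc k) z * g"
  shows "g * Tl p us = Tl (Suc p) us * g"
  using assms
proof (induction us arbitrary: p)
  case (Cons u us)
  have "g * T (Suc p) u = T (Suc (Suc p)) u * g" "g * Tl (Suc p) us = Tl (Suc (Suc p)) us * g"
    using Cons by simp_all
  then show ?case unfolding Tl.simps by (rule intertwine_mult)
qed simp

text \<open>The innermost factor and its mirror image are removed by \<open>E_r_conj\<close>, which
  lowers the traced position by one; the outer factors lie below that position and pass through the
  trace.\<close>

lemma ptr_cycle:
  "x \<in> N (q + j) \<Longrightarrow> ptr (Suc q) j (cycle q j * x * cycle_inv q j) = ptr q j x"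
proof (induction j arbitrary: x)
  case (Suc j)
  let ?r = "r (q + Suc j)"
  have g: "cycle q j \<in> N (Suc q + j)" "cycle_inv q j \<in> N (Suc q + j)"
    using cycle_N[of q j] by auto
  have "cycle q (Suc j) * x * cycle_inv q (Suc j) = cycle q j * (?r * x * ?r * cycle_inv q j)"
    by (simp add: mult.assoc)
  then have "ptr (Suc q) (Suc j) (cycle q (Suc j) * x * cycle_inv q (Suc j))
      = ptr (Suc q) j (E (Suc (Suc q + j)) (cycle q j * (?r * x * ?r * cycle_inv q j)))"
    by simp
  also have "\<dots> = ptr (Suc q) j (cycle q j * E (Suc (q + Suc j)) (?r * x * ?r) * cycle_inv q j)"
    using E_left[OF g(1), of "?r * x * ?r * cycle_inv q j"] E_right[OF g(2), of "?r * x * ?r"]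
    by (simp only: add_Suc_right add_Suc mult.assoc[of "cycle q j"])
  also have "E (Suc (q + Suc j)) (?r * x * ?r) = E (q + Suc j) x"
    using Suc.prems by (intro E_r_conj) auto
  also have "ptr (Suc q) j (cycle q j * E (q + Suc j) x * cycle_inv q j) = ptr q j (E (q + Suc j) x)"
    using Suc.prems E_N[of x "q + j"] by (intro Suc.IH) auto
  finally show ?case by simp
qed simp

section \<open>Products of transfer matrices as single traces\<close>

definition mono_op :: "nat \<Rightarrow> complex list \<Rightarrow> 'e"
  where "mono_op q ws = skewer q (length ws) * Tl q ws"

lemma Tl_N: "p + length us \<le> n \<Longrightarrow> Tl p us \<in> N n"
proof (induction us arbitrary: p)
  case (Cons u us)
  then show ?case using T_N[of "Suc p"] N_mono[of "Suc p" n] by (auto intro!: N_mult)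
qed (simp add: N_one)

lemma mono_op_N: "q + length ws \<le> n \<Longrightarrow> mono_op q ws \<in> N n"
  unfolding mono_op_def by (intro N_mult skewer_N Tl_N)

text \<open>The cycle carries the block one position up without changing its trace. So the partial
  trace over a block placed after \<open>q\<close> positions is the transfer matrix itself and lies
  in \<open>N 0\<close>, and a product of two transfer matrices becomes one trace over adjacent
  blocks.\<close>

lemma ptr_mono_op: "ptr q (length ws) (mono_op q ws) = tr (length ws) (mono_op 0 ws)"
proof (induction q)
  case (Suc q)
  let ?g = "cycle q (length ws)" and ?g' = "cycle_inv q (length ws)"
  have "?g * mono_op q ws = mono_op (Suc q) ws * ?g"
    unfolding mono_op_def
    by (intro intertwine_mult skewer_intertwine Tl_intertwine cycle_r cycle_T) auto
  then have "?g * mono_op q ws * ?g' = mono_op (Suc q) ws"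
    by (simp add: mult.assoc cycle_inverse)
  then show ?case
    using ptr_cycle[of "mono_op q ws" q "length ws"] mono_op_N[of q ws] Suc by simp
qed simp

lemma tr_mono_op_mult:
  "tr (length us) (mono_op 0 us) * tr (length ws) (mono_op 0 ws)
    = tr (length us + length ws)
        (skewer 0 (length us) * skewer (length us) (length ws) * Tl 0 (us @ ws))"
proof -
  let ?i = "length us" and ?j = "length ws"
  have c: "Tl 0 us * skewer ?i ?j = skewer ?i ?j * Tl 0 us"
    using N_r_comm[OF Tl_N[of 0 us ?i]] by (intro skewer_comm) simp
  have "skewer 0 ?i * skewer ?i ?j * Tl 0 (us @ ws) = skewer 0 ?i * (skewer ?i ?j * Tl 0 us) * Tl ?i ws"
    unfolding Tl_append by (simp add: mult.assoc)
  also have "\<dots> = mono_op 0 us * mono_op ?i ws"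
    unfolding c[symmetric] mono_op_def by (simp only: mult.assoc)
  finally have *: "skewer 0 ?i * skewer ?i ?j * Tl 0 (us @ ws) = mono_op 0 us * mono_op ?i ws" .
  have "tr (?i + ?j) (mono_op 0 us * mono_op ?i ws) = tr ?i (mono_op 0 us * ptr ?i ?j (mono_op ?i ws))"
    using ptr_ptr[of 0 ?i ?j] by (simp add: ptr_left mono_op_N)
  also have "\<dots> = tr ?i (mono_op 0 us) * tr ?j (mono_op 0 ws)"
    unfolding ptr_mono_op[of ?i] by (rule ptr_right) (simp add: ptr_N mono_op_N)
  finally show ?thesis unfolding * by simp
qed

definition string :: "complex list \<Rightarrow> bool"
  where "string us \<longleftrightarrow> (\<forall>i. Suc i < length us \<longrightarrow> us ! i - us ! Suc i = h)"

text \<open>This is \<open>rtt\<close> with the two arguments exchanged: their difference is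
  \<open>h\<close>, so its coefficient is 1.\<close>

lemma T_pair_skew:
  assumes "1 \<le> k" "u \<in> \<Omega>" "v \<in> \<Omega>" "u - v = h"
  shows "T k u * T (Suc k) v * (r k + 1) = (r k + 1) * (T k v * T (Suc k) u)"
proof -
  have "h / (u - v) = 1" "v \<noteq> u" using assms h_nz by auto
  then show ?thesis using rtt[of k v u] assms by (simp add: mult.assoc)
qed

lemma Tl_skew:
  assumes "set us \<subseteq> \<Omega>" "Suc i < length us" "us ! i - us ! Suc i = h"
  shows "\<exists>y. Tl p us * (r (p + Suc i) + 1) = (r (p + Suc i) + 1) * y"
  using assms
proof (induction us arbitrary: p i)
  case (Cons u us)
  show ?case
  proof (cases i)
    case 0
    with Cons.prems obtain v vs where us: "us = v # vs" by (cases us) auto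
    have p: "T (Suc p) u * T (Suc (Suc p)) v * (r (Suc p) + 1)
        = (r (Suc p) + 1) * (T (Suc p) v * T (Suc (Suc p)) u)"
      using Cons.prems us 0 by (intro T_pair_skew) auto
    have "r (Suc p) * Tl (Suc (Suc p)) vs = Tl (Suc (Suc p)) vs * r (Suc p)"
      by (rule Tl_comm) (simp add: T_r_comm)
    then have c: "Tl (Suc (Suc p)) vs * (r (Suc p) + 1) = (r (Suc p) + 1) * Tl (Suc (Suc p)) vs"
      by (simp add: distrib_left distrib_right)
    have "Tl p (u # us) * (r (Suc p) + 1)
        = T (Suc p) u * T (Suc (Suc p)) v * (Tl (Suc (Suc p)) vs * (r (Suc p) + 1))"
      unfolding us by (simp add: mult.assoc)
    also have "\<dots> = (T (Suc p) u * T (Suc (Suc p)) v * (r (Suc p) + 1)) * Tl (Suc (Suc p)) vs"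
      unfolding c by (simp only: mult.assoc)
    also have "\<dots> = (r (Suc p) + 1) * (T (Suc p) v * T (Suc (Suc p)) u * Tl (Suc (Suc p)) vs)"
      unfolding p by (simp only: mult.assoc)
    finally show ?thesis unfolding 0 add_Suc_right add_0_right by blast
  next
    case (Suc j)
    obtain y where y: "Tl (Suc p) us * (r (Suc p + Suc j) + 1) = (r (Suc p + Suc j) + 1) * y"
      using Cons.IH[of j "Suc p"] Cons.prems Suc by auto
    have "T (Suc p) u * r (Suc p + Suc j) = r (Suc p + Suc j) * T (Suc p) u"
      by (intro T_r_comm) auto
    then have c: "T (Suc p) u * (r (Suc p + Suc j) + 1) = (r (Suc p + Suc j) + 1) * T (Suc p) u"
      by (simp only: distrib_left distrib_right mult_1_left mult_1_right)
    have "Tl p (u # us) * (r (Suc p + Suc j) + 1) = (T (Suc p) u * (r (Suc p + Suc j) + 1)) * y"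
      by (simp only: Tl.simps mult.assoc y)
    also have "\<dots> = (r (Suc p + Suc j) + 1) * (T (Suc p) u * y)"
      unfolding c by (simp only: mult.assoc)
    finally show ?thesis using Suc by (auto simp del: Tl.simps)
  qed
qed simp

lemma cyc_row: "p + length us < n \<Longrightarrow> cyc n (row p us w)"
  by (induction us arbitrary: p) (auto intro!: cyc_one cyc_mult cyc_add cyc_sc cyc_r)

lemma cyc_blk: "p + length us + length ws \<le> n \<Longrightarrow> cyc n (blk p us ws)"
  by (induction ws arbitrary: p) (auto intro!: cyc_one cyc_mult cyc_row)

lemma skewer_skew_mult:
  assumes "p < l" "l < p + k" "y = (r l + 1) * x"
  shows "skewer p k * y = 0"
  using skewer_skew[OF assms(1,2)] unfolding assms(3) by (simp flip: mult.assoc)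

text \<open>
  With \<open>B\<close> the block R-matrix, \<open>A\<close> and \<open>A'\<close> the products of the two skew-symmetrizers in either
  order, and \<open>X\<close>, \<open>X'\<close> the corresponding products of transfer matrices, \<open>B X = X' B\<close>, \<open>A' B = A' B A\<close>,
  \<open>A B\<inverse> = A B\<inverse> A'\<close> and \<open>A X = A X A\<close>, so \<open>Tr A' X' = Tr B\<inverse> A' B A X A = Tr A B\<inverse> B A X = Tr A X\<close>.
\<close>

lemma tau_comm:
  assumes "set us \<subseteq> \<Omega>" "set ws \<subseteq> \<Omega>" "string us" "string ws"
    "\<And>u w. u \<in> set us \<Longrightarrow> w \<in> set ws \<Longrightarrow> generic u w"
  shows "tr (length us) (mono_op 0 us) * tr (length ws) (mono_op 0 ws)
    = tr (length ws) (mono_op 0 ws) * tr (length us) (mono_op 0 us)"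
proof -
  let ?i = "length us" and ?j = "length ws"
  let ?n = "?i + ?j"
  define A where "A = skewer 0 ?i * skewer ?i ?j"
  define A' where "A' = skewer 0 ?j * skewer ?j ?i"
  define X where "X = Tl 0 (us @ ws)"
  define X' where "X' = Tl 0 (ws @ us)"
  define B where "B = blk 0 us ws"
  have inv: "inv_el B" unfolding B_def using assms(5) by (rule inv_el_blk)
  then obtain Bi where Bi: "is_unit_of B Bi" unfolding inv_el_def by blast
  then have BBi: "B * Bi = 1" "Bi * B = 1" unfolding is_unit_of_def by auto
  have disj: "set us \<inter> set ws = {}" using assms(5) unfolding generic_def by fastforce
  have BX: "B * X = X' * B"
    unfolding B_def X_def X'_def using blk_T[OF assms(1,2) disj] by simp
  have A_comm: "A = skewer ?i ?j * skewer 0 ?i"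
    unfolding A_def by (intro skewer_comm skewer_comm[symmetric] r_far') auto
  have A'_comm: "A' = skewer ?j ?i * skewer 0 ?j"
    unfolding A'_def by (intro skewer_comm skewer_comm[symmetric] r_far') auto
  have A0: "A * ((r l + 1) * y) = 0" if "(0 < l \<and> l < ?i) \<or> (?i < l \<and> l < ?n)" for l y
  proof (cases "0 < l \<and> l < ?i")
    case True
    then have "skewer 0 ?i * ((r l + 1) * y) = 0" by (intro skewer_skew_mult) auto
    then show ?thesis unfolding A_comm mult.assoc by simp
  next
    case False
    then have "skewer ?i ?j * ((r l + 1) * y) = 0" using that by (intro skewer_skew_mult) auto
    then show ?thesis unfolding A_def mult.assoc by simp
  qed
  have A'0: "A' * ((r l + 1) * y) = 0" if "(0 < l \<and> l < ?j) \<or> (?j < l \<and> l < ?n)" for l y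
  proof (cases "0 < l \<and> l < ?j")
    case True
    then have "skewer 0 ?j * ((r l + 1) * y) = 0" by (intro skewer_skew_mult) auto
    then show ?thesis unfolding A'_comm mult.assoc by simp
  next
    case False
    then have "skewer ?j ?i * ((r l + 1) * y) = 0" using that by (intro skewer_skew_mult) auto
    then show ?thesis unfolding A'_def mult.assoc by simp
  qed
  have absorb: "x * A = x" if "\<And>l. (0 < l \<and> l < ?i) \<or> (?i < l \<and> l < ?n) \<Longrightarrow> x * (r l + 1) = 0" for x
  proof -
    have "x * skewer 0 ?i = x" using that by (intro skewer_absorb_right) auto
    moreover have "x * skewer ?i ?j = x" using that by (intro skewer_absorb_right) auto
    ultimately show ?thesis unfolding A_def by (simp flip: mult.assoc)
  qed
  have absorb': "x * A' = x" if "\<And>l. (0 < l \<and> l < ?j) \<or> (?j < l \<and> l < ?n) \<Longrightarrow> x * (r l + 1) = 0" for x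
  proof -
    have "x * skewer 0 ?j = x" using that by (intro skewer_absorb_right) auto
    moreover have "x * skewer ?j ?i = x" using that by (intro skewer_absorb_right) auto
    ultimately show ?thesis unfolding A'_def by (simp flip: mult.assoc)
  qed
  \<comment> \<open>\<open>B\<close> exchanges the blocks: indices inside \<open>us\<close> rise by
    \<open>length ws\<close>, and indices inside \<open>ws\<close> fall by \<open>length us\<close>.
    The index at the junction belongs to neither range.\<close>
  have push_l: "pushes B l (l + ?j)" if l: "0 < l" "l < ?i" for l
  proof -
    obtain i where i: "l = Suc i" using l by (cases l) auto
    show ?thesis
      using blk_pushes_left[of us ws i 0] assms i l unfolding B_def string_def by auto
  qed
  have push_r: "pushes B l (l - ?i)" if l: "?i < l" "l < ?n" for l
  proof -
    define j where "j = l - Suc ?i"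
    have j: "l = ?i + Suc j" "Suc j < ?j" using l unfolding j_def by auto
    show ?thesis
      using blk_pushes_right[of us ws j 0] assms j unfolding B_def string_def by auto
  qed
  have "A' * B * (r l + 1) = 0" if l: "(0 < l \<and> l < ?i) \<or> (?i < l \<and> l < ?n)" for l
  proof -
    obtain l' where "pushes B l l'" "(0 < l' \<and> l' < ?j) \<or> (?j < l' \<and> l' < ?n)"
      using l
    proof
      assume "0 < l \<and> l < ?i"
      then show ?thesis using push_l[of l] that[of "l + ?j"] by auto
    next
      assume "?i < l \<and> l < ?n"
      then have "pushes B l (l - ?i)" "0 < l - ?i \<and> l - ?i < ?j" using push_r[of l] by auto
      then show ?thesis using that by blast
    qed
    then show ?thesis using A'0[of l'] unfolding pushes_def by (auto simp: mult.assoc)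
  qed
  then have A'BA: "A' * B * A = A' * B" by (rule absorb)
  have "A * Bi * (r l + 1) = 0" if l: "(0 < l \<and> l < ?j) \<or> (?j < l \<and> l < ?n)" for l
  proof -
    obtain l' where "pushes B l' l" and l': "(0 < l' \<and> l' < ?i) \<or> (?i < l' \<and> l' < ?n)"
      using l
    proof
      assume "0 < l \<and> l < ?j"
      then show ?thesis using push_r[of "l + ?i"] that[of "l + ?i"] by auto
    next
      assume "?j < l \<and> l < ?n"
      then have "pushes B (l - ?j) l" "0 < l - ?j \<and> l - ?j < ?i" using push_l[of "l - ?j"] by auto
      then show ?thesis using that by blast
    qed
    then obtain y where "Bi * (r l + 1) = (r l' + 1) * y"
      using pushes_inverse Bi by blast
    then show ?thesis using A0[OF l'] by (simp add: mult.assoc)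
  qed
  then have ABA': "A * Bi * A' = A * Bi" by (rule absorb')
  have "A * X * (r l + 1) = 0" if l: "(0 < l \<and> l < ?i) \<or> (?i < l \<and> l < ?n)" for l
  proof -
    define i where "i = l - 1"
    have i: "l = Suc i" using l unfolding i_def by auto
    have "set (us @ ws) \<subseteq> \<Omega>" using assms by simp
    moreover have "Suc i < length (us @ ws)" using l i by auto
    \<comment> \<open>The concatenation need not have spacing \<open>h\<close> at the junction, but
      that would be \<open>l = length us\<close>, which is excluded.\<close>
    moreover have "(us @ ws) ! i - (us @ ws) ! Suc i = h"
    proof (cases "l < ?i")
      case True
      then show ?thesis using assms(3) i by (simp add: string_def nth_append)
    next
      case False
      then have "i = ?i + (i - ?i)" "Suc (i - ?i) < ?j" using l i by auto
      moreover from this have "(us @ ws) ! i = ws ! (i - ?i)" "(us @ ws) ! Suc i = ws ! Suc (i - ?i)"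
        by (simp_all add: nth_append Suc_diff_le)
      ultimately show ?thesis using assms(4) by (simp add: string_def)
    qed
    ultimately obtain y where "X * (r l + 1) = (r l + 1) * y"
      using Tl_skew[of "us @ ws" i 0] i unfolding X_def by auto
    then show ?thesis using A0[OF l] by (simp add: mult.assoc)
  qed
  then have AXA: "A * X * A = A * X" by (rule absorb)
  have AA: "A * A = A"
    by (rule absorb) (use A0[where y = 1] in simp)
  have cA: "cyc ?n A" unfolding A_def by (intro cyc_mult cyc_skewer) auto
  have cA': "cyc ?n A'" unfolding A'_def by (intro cyc_mult cyc_skewer) auto
  have cB: "cyc ?n B" unfolding B_def by (intro cyc_blk) auto
  then have cBi: "cyc ?n Bi" using Bi cyc_unit by blast
  note cN = cA[unfolded cyc_def, THEN conjunct1] cA'[unfolded cyc_def, THEN conjunct1]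
    cB[unfolded cyc_def, THEN conjunct1] cBi[unfolded cyc_def, THEN conjunct1]
  have XN: "X \<in> N ?n" unfolding X_def by (intro Tl_N) auto
  have "A' * X' = A' * (X' * B) * Bi" using BBi by (simp add: mult.assoc)
  also have "\<dots> = (A' * B) * X * Bi"
    unfolding BX[symmetric] by (simp only: mult.assoc)
  also have "\<dots> = A' * B * (A * X) * Bi"
    by (subst A'BA[symmetric]) (simp only: mult.assoc)
  also have "\<dots> = (A' * B * A * X * A) * Bi"
    by (subst AXA[symmetric]) (simp only: mult.assoc)
  finally have "tr ?n (A' * X') = tr ?n ((A' * B * A * X * A) * Bi)" by simp
  also have "\<dots> = tr ?n (Bi * (A' * B * A * X * A))"
  proof -
    have "A' * B * A * X * A \<in> N ?n" by (intro N_mult cN XN)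
    then show ?thesis using cBi unfolding cyc_def by metis
  qed
  also have "Bi * (A' * B * A * X * A) = (Bi * A' * B * A * X) * A" by (simp only: mult.assoc)
  also have "tr ?n \<dots> = tr ?n (A * (Bi * A' * B * A * X))"
  proof -
    have "Bi * A' * B * A * X \<in> N ?n" by (intro N_mult cN XN)
    then show ?thesis using cA unfolding cyc_def by metis
  qed
  also have "A * (Bi * A' * B * A * X) = (A * Bi * A') * B * A * X" by (simp only: mult.assoc)
  also have "\<dots> = A * (Bi * B) * A * X" unfolding ABA' by (simp only: mult.assoc)
  also have "\<dots> = A * X" unfolding BBi by (simp add: AA)
  finally have "tr ?n (A' * X') = tr ?n (A * X)" .
  then show ?thesis
    unfolding tr_mono_op_mult A_def A'_def X_def X'_def by (simp add: add.commute)
qed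

subsection \<open>Products of difference operators\<close>

text \<open>
  \<open>diff_op p n z\<close> is \<open>(T\<^bsub>p+1\<^esub>(z) e\<^bsup>-h\<partial>\<^esup> - 1) \<cdots> (T\<^bsub>p+n\<^esub>(z) e\<^bsup>-h\<partial>\<^esup> - 1)\<close> applied to the unit.
\<close>

fun diff_op :: "nat \<Rightarrow> nat \<Rightarrow> complex \<Rightarrow> 'e"
  where
    "diff_op p 0 z = 1"
  | "diff_op p (Suc n) z = T (Suc p) z * diff_op (Suc p) n (z - h) - diff_op (Suc p) n z"

lemma diff_op_N: "p + n \<le> m \<Longrightarrow> diff_op p n z \<in> N m"
proof (induction n arbitrary: p z)
  case (Suc n)
  then show ?case using T_N[of "Suc p"] N_mono[of "Suc p" m] by (auto intro!: N_mult N_diff)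
qed (simp add: N_one)

lemma diff_op_r_comm: "1 \<le> l \<Longrightarrow> l \<le> p \<Longrightarrow> r l * diff_op (Suc p) n z = diff_op (Suc p) n z * r l"
proof (induction n arbitrary: p z)
  case (Suc n)
  have "r l * T (Suc (Suc p)) z = T (Suc (Suc p)) z * r l"
    using Suc.prems by (intro T_r_comm[symmetric]) auto
  moreover have "r l * diff_op (Suc (Suc p)) n z = diff_op (Suc (Suc p)) n z * r l" for z
    using Suc by simp
  ultimately show ?case
    by (simp add: right_diff_distrib left_diff_distrib comm_mult)
qed simp

definition ladder :: "nat \<Rightarrow> complex \<Rightarrow> complex list"
  where "ladder n z = map (\<lambda>i. z - of_nat i * h) [0..<n]"

lemma length_ladder [simp]: "length (ladder n z) = n"
  unfolding ladder_def by simp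

lemma ladder_Suc: "ladder (Suc n) z = ladder n z @ [z - of_nat n * h]"
  unfolding ladder_def by simp

lemma string_ladder: "string (ladder n z)"
  unfolding string_def ladder_def by (auto simp: nth_append algebra_simps simp del: upt_Suc)

definition trA :: "nat \<Rightarrow> 'e \<Rightarrow> 'e"
  where "trA k x = tr k (skewer 0 k * x)"

lemma trA_diff: "trA k (x - y) = trA k x - trA k y"
  unfolding trA_def by (simp add: right_diff_distrib ptr_diff)

text \<open>The left \<open>r l\<close> is absorbed by the skew-symmetrizer directly and the right
  one after rotation, each with a sign -1.\<close>

lemma trA_r_conj:
  assumes "1 \<le> l" "l < k" "x \<in> N k"
  shows "trA k (r l * x * r l) = trA k x"
proof -
  have A: "skewer 0 k * r l = - skewer 0 k" "r l * skewer 0 k = - skewer 0 k"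
    using assms by (intro skewer_r; simp)+
  have n: "tr k (- y) = - tr k y" for y
    using ptr_sc[of 0 k "- 1" y] by simp
  have "skewer 0 k * (r l * x * r l) = (skewer 0 k * r l) * x * r l"
    by (simp only: mult.assoc)
  also have "\<dots> = - (skewer 0 k * x * r l)" unfolding A by simp
  finally have "trA k (r l * x * r l) = - tr k (skewer 0 k * x * r l)"
    unfolding trA_def using n by simp
  also have "tr k (skewer 0 k * x * r l) = tr k (r l * (skewer 0 k * x))"
    using assms by (intro tr_r_cyclic[symmetric] N_mult skewer_N) auto
  also have "r l * (skewer 0 k * x) = - (skewer 0 k * x)"
    using A by (simp flip: mult.assoc)
  finally show ?thesis unfolding trA_def using n by simp
qed

text \<open>\<open>T (Suc (Suc q))\<close> is \<open>T (Suc q)\<close> conjugated by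
  \<open>r (Suc q)\<close>, which commutes with the factors on both sides, so under the trace the
  conjugation disappears. A surviving \<open>T\<close> thus slides down to the first free
  position.\<close>

lemma trA_move:
  assumes "\<And>l. 1 \<le> l \<Longrightarrow> l \<le> q \<Longrightarrow> r l * w = w * r l" "w \<in> N k" "length us \<le> q" "q < k"
  shows "trA k (Tl 0 us * T (Suc q) v * w) = trA k (Tl 0 us * T (Suc (length us)) v * w)"
  using assms(3,4,1)
proof (induction q rule: dec_induct)
  case (step q)
  let ?r = "r (Suc q)"
  have c1: "Tl 0 us * ?r = ?r * Tl 0 us"
    using step by (intro N_r_comm[of _ q] Tl_N) auto
  have c2: "?r * w = w * ?r" using step by simp
  have "Tl 0 us * T (Suc (Suc q)) v * w = (Tl 0 us * ?r) * T (Suc q) v * (?r * w)"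
    by (simp only: T_Suc[of "Suc q"] mult.assoc Suc_le_eq zero_less_Suc One_nat_def)
  also have "\<dots> = ?r * (Tl 0 us * T (Suc q) v * w) * ?r"
    unfolding c1 c2 by (simp only: mult.assoc)
  finally have "trA k (Tl 0 us * T (Suc (Suc q)) v * w) = trA k (?r * (Tl 0 us * T (Suc q) v * w) * ?r)"
    by simp
  also have "\<dots> = trA k (Tl 0 us * T (Suc q) v * w)"
  proof (rule trA_r_conj)
    have "T (Suc q) v \<in> N k" using step T_N[of "Suc q"] N_mono[of "Suc q" k] by simp
    then show "Tl 0 us * T (Suc q) v * w \<in> N k"
      using step assms(2) by (intro N_mult Tl_N) auto
  qed (use step in auto)
  also have "\<dots> = trA k (Tl 0 us * T (Suc (length us)) v * w)"
    using step by simp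
  finally show ?case .
qed simp

text \<open>Expansion of the difference operators from the left: \<open>p\<close> counts the factors
  where \<open>T\<close> was chosen, which have shifted the argument by \<open>p * h\<close>, and
  \<open>q\<close> counts all factors treated. Choosing \<open>T\<close> raises both, choosing -1
  only \<open>q\<close>. The element \<open>y\<close> is arbitrary so that either side of a
  commutator can be expanded.\<close>

lemma trA_diff_op_comm:
  assumes "\<And>q. q \<le> k \<Longrightarrow> trA k (Tl 0 (ladder q z)) * y = y * trA k (Tl 0 (ladder q z))"
    and "p \<le> q" "q + n = k"
  shows "trA k (Tl 0 (ladder p z) * diff_op q n (z - of_nat p * h)) * y
    = y * trA k (Tl 0 (ladder p z) * diff_op q n (z - of_nat p * h))"
  using assms(2,3)
proof (induction n arbitrary: p q)
  case 0
  then show ?case using assms(1) by simp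
next
  case (Suc n)
  let ?w = "diff_op (Suc q) n (z - of_nat (Suc p) * h)"
  have z: "z - of_nat p * h - h = z - of_nat (Suc p) * h" by (simp add: algebra_simps)
  have "trA k (Tl 0 (ladder p z) * T (Suc q) (z - of_nat p * h) * ?w)
      = trA k (Tl 0 (ladder p z) * T (Suc (length (ladder p z))) (z - of_nat p * h) * ?w)"
    using Suc.prems by (intro trA_move diff_op_r_comm diff_op_N) auto
  also have "\<dots> = trA k (Tl 0 (ladder (Suc p) z) * ?w)"
    unfolding ladder_Suc Tl_append by simp
  finally have "trA k (Tl 0 (ladder p z) * diff_op q (Suc n) (z - of_nat p * h))
    = trA k (Tl 0 (ladder (Suc p) z) * ?w)
      - trA k (Tl 0 (ladder p z) * diff_op (Suc q) n (z - of_nat p * h))"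
    unfolding diff_op.simps z by (simp only: right_diff_distrib trA_diff mult.assoc)
  then show ?case
    using Suc.IH[of "Suc p" "Suc q"] Suc.IH[of p "Suc q"] Suc.prems
    by (simp only: left_diff_distrib right_diff_distrib)
qed

lemma trA_ladder:
  assumes "q \<le> k" "1 \<le> k"
  shows "\<exists>c. trA k (Tl 0 (ladder q z)) = c \<odot> tr q (mono_op 0 (ladder q z))"
\<comment> \<open>\<open>tr_skewer_reduce\<close> needs at least one remaining position, so the
  empty ladder is reduced to one position, where the trace is the scalar \<open>d\<close>.\<close>
proof (cases "q = 0")
  case True
  obtain c where "tr k (skewer 0 k * 1) = c \<odot> tr 1 (skewer 0 1 * 1)"
    using tr_skewer_reduce[of 1 k] assms N_one by blast
  also have "tr 1 (skewer 0 1 * 1) = d \<odot> 1"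
    by (simp add: E_one)
  finally have "trA k 1 = (c * d) \<odot> 1"
    unfolding trA_def by simp
  then show ?thesis using True unfolding mono_op_def ladder_def by auto
next
  case False
  then obtain c where "\<forall>x\<in>N q. tr k (skewer 0 k * x) = c \<odot> tr q (skewer 0 q * x)"
    using tr_skewer_reduce[of q k] assms by auto
  then show ?thesis
    using Tl_N[of 0 "ladder q z" q] unfolding trA_def mono_op_def by auto
qed

lemma sc_comm: "x * y = y * x \<Longrightarrow> (c \<odot> x) * (c' \<odot> y) = (c' \<odot> y) * (c \<odot> x)"
  by (simp add: sc_simps mult.commute)

theorem diff_op_traces_comm:
  assumes "1 \<le> k" "k \<le> m" "1 \<le> l" "l \<le> m"
    and z: "\<And>a. a < k \<Longrightarrow> z - of_nat a * h \<in> \<Omega>" and w: "\<And>b. b < l \<Longrightarrow> w - of_nat b * h \<in> \<Omega>"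
    and g: "\<And>a b. a < k \<Longrightarrow> b < l \<Longrightarrow> generic (z - of_nat a * h) (w - of_nat b * h)"
  shows "tr m (skewer 0 m * diff_op 0 k z) * tr m (skewer 0 m * diff_op 0 l w)
    = tr m (skewer 0 m * diff_op 0 l w) * tr m (skewer 0 m * diff_op 0 k z)"
proof -
  have 1: "trA k (Tl 0 (ladder q z)) * trA l (Tl 0 (ladder q' w))
      = trA l (Tl 0 (ladder q' w)) * trA k (Tl 0 (ladder q z))" if "q \<le> k" "q' \<le> l" for q q'
  proof -
    have "tr (length (ladder q z)) (mono_op 0 (ladder q z)) * tr (length (ladder q' w)) (mono_op 0 (ladder q' w))
      = tr (length (ladder q' w)) (mono_op 0 (ladder q' w)) * tr (length (ladder q z)) (mono_op 0 (ladder q z))"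
      using that z w g by (intro tau_comm string_ladder) (auto simp: ladder_def)
    then show ?thesis
      using trA_ladder[OF that(1) assms(1), of z] trA_ladder[OF that(2) assms(3), of w] sc_comm
      by (auto simp only: length_ladder)
  qed
  \<comment> \<open>One side of the commutator is expanded at a time; the other side still consists
    of plain ladders.\<close>
  have 2: "trA k (diff_op 0 k z) * trA l (Tl 0 (ladder q' w))
      = trA l (Tl 0 (ladder q' w)) * trA k (diff_op 0 k z)" if "q' \<le> l" for q'
    using trA_diff_op_comm[of k z "trA l (Tl 0 (ladder q' w))" 0 0 k] 1[OF _ that]
    by (simp add: ladder_def)
  have 3: "trA l (diff_op 0 l w) * trA k (diff_op 0 k z) = trA k (diff_op 0 k z) * trA l (diff_op 0 l w)"
    using trA_diff_op_comm[of l w "trA k (diff_op 0 k z)" 0 0 l] 2 by (simp add: ladder_def)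
  obtain c c' where "\<forall>x\<in>N k. tr m (skewer 0 m * x) = c \<odot> trA k x"
      "\<forall>x\<in>N l. tr m (skewer 0 m * x) = c' \<odot> trA l x"
    using tr_skewer_reduce[of k m] tr_skewer_reduce[of l m] assms unfolding trA_def by blast
  then have "tr m (skewer 0 m * diff_op 0 k z) = c \<odot> trA k (diff_op 0 k z)"
      "tr m (skewer 0 m * diff_op 0 l w) = c' \<odot> trA l (diff_op 0 l w)"
    using diff_op_N by auto
  then show ?thesis using sc_comm[OF 3] by simp
qed

end

section \<open>Skew-invertible solutions of the braid relation in index notation\<close>

text \<open>\<open>R a b c d\<close> is the entry of R in row \<open>(a, b)\<close> and column \<open>(c, d)\<close>.\<close>

locale skew_braiding =
  fixes R \<Psi> :: "'n::finite \<Rightarrow> 'n \<Rightarrow> 'n \<Rightarrow> 'n \<Rightarrow> complex"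
  assumes ybe: "(\<Sum>s\<in>UNIV. \<Sum>t\<in>UNIV. \<Sum>u\<in>UNIV. R i j s t * R t k u n * R s u l m)
      = (\<Sum>s\<in>UNIV. \<Sum>t\<in>UNIV. \<Sum>u\<in>UNIV. R j k t s * R i t l u * R u s m n)"
    and inv: "(\<Sum>s\<in>UNIV. \<Sum>t\<in>UNIV. R a b s t * R s t c d) = (if a = c \<and> b = d then 1 else 0)"
    and skew1: "(\<Sum>b\<in>UNIV. \<Sum>d\<in>UNIV. R a b c d * \<Psi> d e b f) = (if f = a \<and> e = c then 1 else 0)"
    and skew2: "(\<Sum>b\<in>UNIV. \<Sum>d\<in>UNIV. \<Psi> a b c d * R d e b f) = (if f = a \<and> e = c then 1 else 0)"
begin

definition C :: "'n \<Rightarrow> 'n \<Rightarrow> complex"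
  where "C a b = (\<Sum>x\<in>UNIV. \<Psi> a x b x)"

text \<open>The assumptions are symmetric under exchange of rows and columns; this supplies the
  transposed form of \<open>C_R\<close> in \<open>R_C_prod\<close>.\<close>

lemma transpose: "skew_braiding (\<lambda>a b c d. R c d a b) (\<lambda>a b c d. \<Psi> c d a b)"
proof
  fix a b c d e f :: 'n
  show "(\<Sum>s\<in>UNIV. \<Sum>t\<in>UNIV. R s t a b * R c d s t) = (if a = c \<and> b = d then 1 else 0)"
    using inv[of c d a b] by (auto simp: mult.commute)
  show "(\<Sum>b\<in>UNIV. \<Sum>d\<in>UNIV. R c d a b * \<Psi> b f d e) = (if f = a \<and> e = c then 1 else 0)" for a c e f
    using skew1[of c a f e] by (subst sum.swap) auto
  show "(\<Sum>b\<in>UNIV. \<Sum>d\<in>UNIV. \<Psi> c d a b * R b f d e) = (if f = a \<and> e = c then 1 else 0)" for a c e f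
    using skew2[of c a f e] by (subst sum.swap) auto
next
  fix i j k l m n :: 'n
  have "(\<Sum>s\<in>UNIV. \<Sum>t\<in>UNIV. \<Sum>u\<in>UNIV. R s t i j * R u n t k * R l m s u)
     = (\<Sum>s\<in>UNIV. \<Sum>t\<in>UNIV. \<Sum>u\<in>UNIV. R l m s t * R t n u k * R s u i j)"
    unfolding sum.cartesian_product
    by (rule sum.reindex_bij_witness[where i = "\<lambda>(s, u, t). (s, t, u)" and j = "\<lambda>(s, t, u). (s, u, t)"])
      (auto simp: mult_ac)
  also have "\<dots> = (\<Sum>s\<in>UNIV. \<Sum>t\<in>UNIV. \<Sum>u\<in>UNIV. R m n t s * R l t i u * R u s j k)"
    by (rule ybe)
  also have "\<dots> = (\<Sum>s\<in>UNIV. \<Sum>t\<in>UNIV. \<Sum>u\<in>UNIV. R t s j k * R l u i t * R m n u s)"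
    unfolding sum.cartesian_product
    by (rule sum.reindex_bij_witness[where i = "\<lambda>(s, t, u). (s, u, t)" and j = "\<lambda>(s, t, u). (s, u, t)"])
      (auto simp: mult_ac)
  finally show "(\<Sum>s\<in>UNIV. \<Sum>t\<in>UNIV. \<Sum>u\<in>UNIV. R s t i j * R u n t k * R l m s u)
      = (\<Sum>s\<in>UNIV. \<Sum>t\<in>UNIV. \<Sum>u\<in>UNIV. R t s j k * R l u i t * R m n u s)" .
qed

lemma sum_delta2:
  fixes f :: "'n \<Rightarrow> 'n \<Rightarrow> complex"
  shows "(\<Sum>x\<in>UNIV. \<Sum>y\<in>UNIV. (if x = a \<and> y = b then 1 else 0) * f x y) = f a b"
proof -
  have "(\<Sum>y\<in>UNIV. (if x = a \<and> y = b then 1 else 0) * f x y) = (if x = a then f x b else 0)" for x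
    by (cases "x = a") (simp_all add: if_distrib[where f = "\<lambda>z. z * _"] cong: if_cong)
  then show ?thesis by simp
qed

lemma trace_R_C: "(\<Sum>x\<in>UNIV. \<Sum>y\<in>UNIV. C x y * R a y c x) = (if a = c then 1 else 0)"
proof -
  have "(\<Sum>x\<in>UNIV. \<Sum>y\<in>UNIV. C x y * R a y c x)
      = (\<Sum>w\<in>UNIV. \<Sum>b\<in>UNIV. \<Sum>d\<in>UNIV. R a b c d * \<Psi> d w b w)"
    unfolding C_def sum_distrib_right sum.cartesian_product
    by (rule sum.reindex_bij_witness[where i = "\<lambda>(w, b, d). (d, b, w)" and j = "\<lambda>(d, b, w). (w, b, d)"])
      (auto simp: mult_ac)
  also have "\<dots> = (\<Sum>w\<in>UNIV. if w = a \<and> w = c then 1 else 0)"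
    unfolding skew1 ..
  also have "\<dots> = (if a = c then 1 else 0)"
    by (cases "a = c") (auto intro!: sum.neutral)
  finally show ?thesis .
qed

text \<open>Contraction of the braid relation with \<Psi> in its first tensor factor: on the
  right-hand side \<open>skew2\<close> cancels \<open>R i t l u\<close> and leaves two
  factors.\<close>

lemma ybe_skew:
  "(\<Sum>i\<in>UNIV. \<Sum>l\<in>UNIV. \<Sum>s\<in>UNIV. \<Sum>t\<in>UNIV. \<Sum>u\<in>UNIV. \<Psi> a l c i * (R i j s t * R t k u n * R s u l m))
    = (\<Sum>s\<in>UNIV. R j k c s * R a s m n)"
proof -
  have "(\<Sum>i\<in>UNIV. \<Sum>l\<in>UNIV. \<Sum>s\<in>UNIV. \<Sum>t\<in>UNIV. \<Sum>u\<in>UNIV. \<Psi> a l c i * (R i j s t * R t k u n * R s u l m))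
      = (\<Sum>i\<in>UNIV. \<Sum>l\<in>UNIV. \<Psi> a l c i * (\<Sum>s\<in>UNIV. \<Sum>t\<in>UNIV. \<Sum>u\<in>UNIV. R j k t s * R i t l u * R u s m n))"
    by (simp only: ybe flip: sum_distrib_left)
  also have "\<dots> = (\<Sum>s\<in>UNIV. \<Sum>u\<in>UNIV. \<Sum>t\<in>UNIV. (\<Sum>l\<in>UNIV. \<Sum>i\<in>UNIV. \<Psi> a l c i * R i t l u) * (R j k t s * R u s m n))"
    unfolding sum_distrib_left sum_distrib_right sum.cartesian_product
    by (rule sum.reindex_bij_witness[where i = "\<lambda>(s, u, t, l, i). (i, l, s, t, u)" and j = "\<lambda>(i, l, s, t, u). (s, u, t, l, i)"])
      (auto simp: mult_ac)
  also have "\<dots> = (\<Sum>s\<in>UNIV. R j k c s * R a s m n)"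
    unfolding skew2 sum_delta2 ..
  finally show ?thesis .
qed

text \<open>In matrix form \<open>Tr_(2) R X_1 R C_2 = Tr(C X) I\<close>, with \<open>X\<close> a
  matrix unit. \<open>ybe_skew\<close> trades the two factors \<open>R\<close> for three and one
  \<Psi>; then \<open>skew1\<close> removes the one that meets \<open>C\<close>, and the other two
  cancel because R is an involution.\<close>

lemma trace_conj:
  "(\<Sum>x\<in>UNIV. \<Sum>y\<in>UNIV. \<Sum>z\<in>UNIV. R j x c y * R a y m z * C z x) = (if j = m then C a c else 0)"
proof -
  have "(\<Sum>x\<in>UNIV. \<Sum>y\<in>UNIV. \<Sum>z\<in>UNIV. R j x c y * R a y m z * C z x)
    = (\<Sum>v\<in>UNIV. \<Sum>k\<in>UNIV. \<Sum>n\<in>UNIV. (\<Sum>s\<in>UNIV. R j k c s * R a s m n) * \<Psi> n v k v)"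
    unfolding C_def sum_distrib_left sum_distrib_right sum.cartesian_product
    by (rule sum.reindex_bij_witness[where i = "\<lambda>(v, k, n, s). (k, s, n, v)" and j = "\<lambda>(k, s, n, v). (v, k, n, s)"])
      (auto simp: mult_ac)
  also have "\<dots> = (\<Sum>v\<in>UNIV. \<Sum>i\<in>UNIV. \<Sum>l\<in>UNIV. \<Sum>s\<in>UNIV. \<Sum>u\<in>UNIV. \<Sum>t\<in>UNIV.
      (\<Sum>k\<in>UNIV. \<Sum>n\<in>UNIV. R t k u n * \<Psi> n v k v) * (\<Psi> a l c i * (R i j s t * R s u l m)))"
    unfolding ybe_skew[symmetric] sum_distrib_left sum_distrib_right sum.cartesian_product
    by (rule sum.reindex_bij_witness[where i = "\<lambda>(v, i, l, s, u, t, k, n). (v, k, n, i, l, s, t, u)"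
          and j = "\<lambda>(v, k, n, i, l, s, t, u). (v, i, l, s, u, t, k, n)"])
      (auto simp: mult_ac)
  also have "\<dots> = (\<Sum>v\<in>UNIV. \<Sum>i\<in>UNIV. \<Sum>l\<in>UNIV. \<Sum>s\<in>UNIV. \<Psi> a l c i * (R i j s v * R s v l m))"
  proof -
    have "(\<Sum>u\<in>UNIV. \<Sum>t\<in>UNIV. (if v = t \<and> v = u then 1 else 0) * f u t) = f v v"
      for v and f :: "'n \<Rightarrow> 'n \<Rightarrow> complex"
      using sum_delta2[of v v f] by (simp add: conj_commute eq_commute)
    then show ?thesis unfolding skew1 by simp
  qed
  also have "\<dots> = (\<Sum>i\<in>UNIV. \<Sum>l\<in>UNIV. \<Psi> a l c i * (\<Sum>s\<in>UNIV. \<Sum>v\<in>UNIV. R i j s v * R s v l m))"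
    unfolding sum_distrib_left sum_distrib_right sum.cartesian_product
    by (rule sum.reindex_bij_witness[where i = "\<lambda>(i, l, s, v). (v, i, l, s)" and j = "\<lambda>(v, i, l, s). (i, l, s, v)"])
      (auto simp: mult_ac)
  also have "\<dots> = (if j = m then C a c else 0)"
    unfolding inv C_def by (cases "j = m") (simp_all add: if_distrib[where f = "\<lambda>z. _ * z"] cong: if_cong)
  finally show ?thesis .
qed

text \<open>Insert a Kronecker delta in the form \<Psi> R from \<open>skew2\<close>; the two factors
  \<open>R\<close> that become adjacent are evaluated by \<open>trace_conj\<close>.\<close>

lemma C_R: "(\<Sum>x\<in>UNIV. R a x c b * C p x) = (\<Sum>g\<in>UNIV. \<Psi> p a b g * C g c)"
proof -
  have "(\<Sum>x\<in>UNIV. R a x c b * C p x)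
      = (\<Sum>x\<in>UNIV. \<Sum>z\<in>UNIV. \<Sum>y\<in>UNIV. (\<Sum>e\<in>UNIV. \<Sum>g\<in>UNIV. \<Psi> p e b g * R g y e z) * (R a x c y * C z x))"
    unfolding skew2 sum_delta2 ..
  also have "\<dots> = (\<Sum>g\<in>UNIV. \<Sum>e\<in>UNIV. \<Psi> p e b g * (\<Sum>x\<in>UNIV. \<Sum>y\<in>UNIV. \<Sum>z\<in>UNIV. R a x c y * R g y e z * C z x))"
    unfolding sum_distrib_left sum_distrib_right sum.cartesian_product
    by (rule sum.reindex_bij_witness[where i = "\<lambda>(g, e, x, y, z). (x, z, y, e, g)" and j = "\<lambda>(x, z, y, e, g). (g, e, x, y, z)"])
      (auto simp: mult_ac)
  also have "\<dots> = (\<Sum>g\<in>UNIV. \<Psi> p a b g * C g c)"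
    unfolding trace_conj by (simp add: if_distrib[where f = "\<lambda>z. _ * z"] cong: if_cong)
  finally show ?thesis .
qed

text \<open>The relation \<open>C_1 C_2 R = R C_1 C_2\<close>: \<open>C_R\<close> turns R into
  \<Psi> on one side, and its transposed version turns \<Psi> back into R on the other.\<close>

lemma R_C_prod:
  "(\<Sum>b\<in>UNIV. \<Sum>b'\<in>UNIV. C a b * C a' b' * R b b' f f') = (\<Sum>b\<in>UNIV. \<Sum>b'\<in>UNIV. R a a' b b' * (C b f * C b' f'))"
proof -
  interpret t: skew_braiding "\<lambda>a b c d. R c d a b" "\<lambda>a b c d. \<Psi> c d a b"
    by (rule transpose)
  have tC: "t.C = (\<lambda>a b. C b a)"
    unfolding t.C_def C_def by simp
  have "(\<Sum>b\<in>UNIV. \<Sum>b'\<in>UNIV. C a b * C a' b' * R b b' f f') = (\<Sum>b\<in>UNIV. C a b * (\<Sum>b'\<in>UNIV. R b b' f f' * C a' b'))"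
    unfolding sum_distrib_left by (simp add: mult_ac)
  also have "\<dots> = (\<Sum>b\<in>UNIV. C a b * (\<Sum>g\<in>UNIV. \<Psi> a' b f' g * C g f))"
    unfolding C_R ..
  also have "\<dots> = (\<Sum>g\<in>UNIV. C g f * (\<Sum>b\<in>UNIV. \<Psi> a' b f' g * C a b))"
    unfolding sum_distrib_left sum.cartesian_product
    by (rule sum.reindex_bij_witness[where i = "\<lambda>(g, b). (b, g)" and j = "\<lambda>(b, g). (g, b)"])
      (auto simp: mult_ac)
  also have "\<dots> = (\<Sum>g\<in>UNIV. C g f * (\<Sum>x\<in>UNIV. R a a' g x * C x f'))"
    using t.C_R[of a a' _ f'] unfolding tC by simp
  also have "\<dots> = (\<Sum>b\<in>UNIV. \<Sum>b'\<in>UNIV. R a a' b b' * (C b f * C b' f'))"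
    unfolding sum_distrib_left by (simp add: mult_ac)
  finally show ?thesis .
qed

end


section \<open>Matrix units\<close>

lemma sum_UNIV_pair:
  fixes f :: "'a::finite \<times> 'b::finite \<Rightarrow> 'c::comm_monoid_add"
  shows "(\<Sum>p\<in>UNIV. f p) = (\<Sum>a\<in>UNIV. \<Sum>b\<in>UNIV. f (a, b))"
  by (simp add: sum.cartesian_product)

lemma sum_if_out:
  "(\<Sum>x\<in>A. if P then f x else 0) = (if P then \<Sum>x\<in>A. f x else (0 :: 'c::comm_monoid_add))"
  by simp

context c_algebra
begin

definition emb :: "('p::finite \<Rightarrow> 'p \<Rightarrow> 'e) \<Rightarrow> ('p \<Rightarrow> 'p \<Rightarrow> complex) \<Rightarrow> 'e"
  where "emb U X = (\<Sum>p\<in>UNIV. \<Sum>q\<in>UNIV. X p q \<odot> U p q)"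

text \<open>The trace expressed inside the ring: for fixed \<open>p\<close> the sum over
  \<open>q\<close> is the diagonal entry of \<open>x\<close> at \<open>p\<close>, extended to an
  element commuting with all matrix units \<open>U\<close>.\<close>

definition tru :: "('p::finite \<Rightarrow> 'p \<Rightarrow> 'e) \<Rightarrow> 'e \<Rightarrow> 'e"
  where "tru U x = (\<Sum>p\<in>UNIV. \<Sum>q\<in>UNIV. U q p * x * U p q)"

lemma emb_mult:
  assumes "\<And>p q s t. U p q * U s t = (if q = s then U p t else 0)"
  shows "emb U X * emb U Y = emb U (\<lambda>p q. \<Sum>s\<in>UNIV. X p s * Y s q)"
proof -
  have "emb U X * emb U Y = (\<Sum>p\<in>UNIV. \<Sum>q\<in>UNIV. \<Sum>t\<in>UNIV. \<Sum>s\<in>UNIV.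
      if q = s then (X p q * Y s t) \<odot> U p t else 0)"
    unfolding emb_def unfolding sum_distrib_right unfolding sum_distrib_left unfolding sum.cartesian_product
    by (rule sum.reindex_bij_witness[where i = "\<lambda>(p, q, t, s). (p, q, s, t)" and j = "\<lambda>(p, q, s, t). (p, q, t, s)"])
      (auto simp: sc_simps assms mult.commute)
  also have "\<dots> = (\<Sum>p\<in>UNIV. \<Sum>q\<in>UNIV. \<Sum>t\<in>UNIV. (X p q * Y q t) \<odot> U p t)"
    by simp
  also have "\<dots> = emb U (\<lambda>p q. \<Sum>s\<in>UNIV. X p s * Y s q)"
    unfolding emb_def scale_sum_left
    by (rule sum.cong[OF refl], rule sum.swap)
  finally show ?thesis .
qed

text \<open>The entries of \<open>emb U A\<close> are scalars and commute with everything; between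
  two general elements this trace is not cyclic.\<close>

lemma tru_cyclic:
  assumes "\<And>p q s t. U p q * U s t = (if q = s then U p t else 0)"
  shows "tru U (emb U A * x) = tru U (x * emb U A)"
proof -
  have 1: "U q p * (U s t * y) = (if p = s then U q t * y else 0)" for p q s t y
    using assms[of q p s t] by (simp flip: mult.assoc)
  have "tru U (emb U A * x) = (\<Sum>p\<in>UNIV. \<Sum>q\<in>UNIV. \<Sum>t\<in>UNIV. \<Sum>s\<in>UNIV.
      if p = s then A p t \<odot> (U q t * x * U p q) else 0)"
    unfolding tru_def emb_def sum_distrib_right sum_distrib_left unfolding sum.cartesian_product
    by (rule sum.reindex_bij_witness[where i = "\<lambda>(p, q, t, s). (p, q, s, t)" and j = "\<lambda>(p, q, s, t). (p, q, t, s)"])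
      (auto simp: sc_simps mult.assoc 1)
  also have "\<dots> = (\<Sum>p\<in>UNIV. \<Sum>q\<in>UNIV. \<Sum>t\<in>UNIV. A p t \<odot> (U q t * x * U p q))"
    by simp
  also have "\<dots> = (\<Sum>p\<in>UNIV. \<Sum>q\<in>UNIV. \<Sum>s\<in>UNIV. A s p \<odot> (U q p * x * U s q))"
    unfolding sum.cartesian_product
    by (rule sum.reindex_bij_witness[where i = "\<lambda>(p, q, t). (t, q, p)" and j = "\<lambda>(p, q, t). (t, q, p)"]) auto
  also have "\<dots> = tru U (x * emb U A)"
    unfolding tru_def emb_def sum_distrib_right sum_distrib_left
    by (intro sum.cong refl) (simp add: sc_simps mult.assoc assms if_distrib[where f = "\<lambda>z. _ * z"]
        if_distrib[where f = "\<lambda>z. _ \<odot> z"] cong: if_cong)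
  finally show ?thesis .
qed

end

locale matrix_units = c_algebra sc + skew_braiding R \<Psi>
  for sc :: "complex \<Rightarrow> 'e::ring_1 \<Rightarrow> 'e" (infixr "\<odot>" 75)
    and R \<Psi> :: "'n::finite \<Rightarrow> 'n \<Rightarrow> 'n \<Rightarrow> 'n \<Rightarrow> complex" +
  fixes e :: "nat \<Rightarrow> 'n \<Rightarrow> 'n \<Rightarrow> 'e"
  assumes e_mult: "e p a b * e p c d = (if b = c then e p a d else 0)"
    and e_one: "(\<Sum>a\<in>UNIV. e p a a) = 1"
    and e_comm: "p \<noteq> q \<Longrightarrow> e p a b * e q c d = e q c d * e p a b"
begin

text \<open>Support in the first \<open>n\<close> positions is encoded as commutation with the later
  matrix units; closure under inverses is then immediate.\<close>

definition N :: "nat \<Rightarrow> 'e set"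
  where "N n = {x. \<forall>p>n. \<forall>a b. x * e p a b = e p a b * x}"

definition D :: "nat \<Rightarrow> 'e \<Rightarrow> 'e"
  where "D n = tru (e n)"

definition C_at :: "nat \<Rightarrow> 'e"
  where "C_at n = emb (e n) C"

definition E :: "nat \<Rightarrow> 'e \<Rightarrow> 'e"
  where "E n x = D n (C_at n * x)"

text \<open>The entry of \<open>x\<close> in row \<open>a\<close> and column \<open>b\<close> at
  position \<open>n\<close>; the sum over \<open>f\<close> makes it an element acting trivially at
  that position.\<close>

definition ent :: "nat \<Rightarrow> 'n \<Rightarrow> 'n \<Rightarrow> 'e \<Rightarrow> 'e"
  where "ent n a b x = (\<Sum>f\<in>UNIV. e n f a * x * e n b f)"

definition U2 :: "nat \<Rightarrow> 'n \<times> 'n \<Rightarrow> 'n \<times> 'n \<Rightarrow> 'e"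
  where "U2 k = (\<lambda>(a, b) (c, d). e k a c * e (Suc k) b d)"

definition U3 :: "nat \<Rightarrow> 'n \<times> 'n \<times> 'n \<Rightarrow> 'n \<times> 'n \<times> 'n \<Rightarrow> 'e"
  where "U3 k = (\<lambda>(a, b, f) (c, d, g). e k a c * e (Suc k) b d * e (Suc (Suc k)) f g)"

definition r :: "nat \<Rightarrow> 'e"
  where "r k = emb (U2 k) (\<lambda>(a, b) (c, d). R a b c d)"

text \<open>The entries of \<open>r k\<close> with respect to its second position, so that a trace
  over that position becomes a sum of entries.\<close>

definition rho :: "nat \<Rightarrow> 'n \<Rightarrow> 'n \<Rightarrow> 'e"
  where "rho k b d = (\<Sum>a\<in>UNIV. \<Sum>c\<in>UNIV. R a b c d \<odot> e k a c)"

lemma e_mult': "e p a b * (e p c d * x) = (if b = c then e p a d * x else 0)"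
  using e_mult[of p a b c d] by (simp flip: mult.assoc)

lemma U2_mult: "U2 k p q * U2 k s t = (if q = s then U2 k p t else 0)"
proof -
  obtain a b c d a' b' c' d' where [simp]: "p = (a, b)" "q = (c, d)" "s = (a', b')" "t = (c', d')"
    by (metis surj_pair)
  have "U2 k p q * U2 k s t = e k a c * (e (Suc k) b d * e k a' c') * e (Suc k) b' d'"
    unfolding U2_def by (simp add: mult.assoc)
  also have "\<dots> = (e k a c * e k a' c') * (e (Suc k) b d * e (Suc k) b' d')"
    by (subst e_comm) (simp_all add: mult.assoc)
  also have "\<dots> = (if q = s then U2 k p t else 0)"
    unfolding U2_def e_mult by simp
  finally show ?thesis .
qed

lemma U3_mult: "U3 k p q * U3 k s t = (if q = s then U3 k p t else 0)"
proof -
  obtain a b f c d g a' b' f' c' d' g' where [simp]: "p = (a, b, f)" "q = (c, d, g)"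
      "s = (a', b', f')" "t = (c', d', g')"
    by (metis surj_pair)
  have U3: "U3 k (a, b, f) (c, d, g) = U2 k (a, b) (c, d) * e (Suc (Suc k)) f g" for a b f c d g
    unfolding U2_def U3_def by simp
  have c: "e (Suc (Suc k)) f g * U2 k (a', b') (c', d') = U2 k (a', b') (c', d') * e (Suc (Suc k)) f g"
    unfolding U2_def prod.case by (intro comm_mult e_comm) auto
  have "U3 k p q * U3 k s t = U2 k (a, b) (c, d) * (e (Suc (Suc k)) f g * U2 k (a', b') (c', d')) * e (Suc (Suc k)) f' g'"
    by (simp add: U3 mult.assoc)
  also have "\<dots> = (U2 k (a, b) (c, d) * U2 k (a', b') (c', d')) * (e (Suc (Suc k)) f g * e (Suc (Suc k)) f' g')"
    unfolding c by (simp only: mult.assoc)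
  also have "\<dots> = (if q = s then U3 k p t else 0)"
    unfolding U2_mult e_mult by (simp add: U3)
  finally show ?thesis .
qed

lemma emb_one2: "emb (U2 k) (\<lambda>p q. if p = q then 1 else 0) = 1"
proof -
  have "emb (U2 k) (\<lambda>p q. if p = q then 1 else 0) = (\<Sum>p\<in>UNIV. U2 k p p)"
    unfolding emb_def by (simp add: if_distrib[where f = "\<lambda>z. z \<odot> _"] cong: if_cong)
  also have "\<dots> = (\<Sum>a\<in>UNIV. e k a a) * (\<Sum>b\<in>UNIV. e (Suc k) b b)"
    unfolding sum_UNIV_pair U2_def by (simp add: sum_product)
  finally show ?thesis by (simp add: e_one)
qed

text \<open>Written on triples of indices, with an identity on the idle position, both generators
  are scalar matrices over the same units, and the braid relation becomes the numerical identity
  \<open>ybe\<close>.\<close>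

lemma r_U3_left: "r k = emb (U3 k) (\<lambda>(a, b, f) (c, d, g). if f = g then R a b c d else 0)"
proof -
  have "emb (U3 k) (\<lambda>(a, b, f) (c, d, g). if f = g then R a b c d else 0)
      = (\<Sum>a\<in>UNIV. \<Sum>b\<in>UNIV. \<Sum>f\<in>UNIV. \<Sum>c\<in>UNIV. \<Sum>d\<in>UNIV. R a b c d \<odot> (e k a c * e (Suc k) b d * e (Suc (Suc k)) f f))"
    unfolding emb_def U3_def sum_UNIV_pair
    by (simp add: if_distrib[where f = "\<lambda>z. z \<odot> _"] cong: if_cong)
  also have "\<dots> = (\<Sum>a\<in>UNIV. \<Sum>b\<in>UNIV. \<Sum>c\<in>UNIV. \<Sum>d\<in>UNIV. R a b c d \<odot> (e k a c * e (Suc k) b d * (\<Sum>f\<in>UNIV. e (Suc (Suc k)) f f)))"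
    unfolding sum_distrib_left scale_sum_right unfolding sum.cartesian_product
    by (rule sum.reindex_bij_witness[where i = "\<lambda>(a, b, c, d, f). (a, b, f, c, d)" and j = "\<lambda>(a, b, f, c, d). (a, b, c, d, f)"]) auto
  also have "\<dots> = r k"
    unfolding e_one r_def emb_def U2_def sum_UNIV_pair by simp
  finally show ?thesis by simp
qed

lemma r_U3_right: "r (Suc k) = emb (U3 k) (\<lambda>(a, b, f) (c, d, g). if a = c then R b f d g else 0)"
proof -
  have "emb (U3 k) (\<lambda>(a, b, f) (c, d, g). if a = c then R b f d g else 0)
      = (\<Sum>b\<in>UNIV. \<Sum>f\<in>UNIV. \<Sum>d\<in>UNIV. \<Sum>g\<in>UNIV. \<Sum>a\<in>UNIV. \<Sum>c\<in>UNIV.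
          if a = c then R b f d g \<odot> (e k a a * (e (Suc k) b d * e (Suc (Suc k)) f g)) else 0)"
    unfolding emb_def U3_def sum_UNIV_pair unfolding sum.cartesian_product
    by (rule sum.reindex_bij_witness[where i = "\<lambda>(b, f, d, g, a, c). (a, b, f, c, d, g)" and j = "\<lambda>(a, b, f, c, d, g). (b, f, d, g, a, c)"])
      (auto simp: mult.assoc)
  also have "\<dots> = (\<Sum>b\<in>UNIV. \<Sum>f\<in>UNIV. \<Sum>d\<in>UNIV. \<Sum>g\<in>UNIV. R b f d g \<odot> ((\<Sum>a\<in>UNIV. e k a a) * (e (Suc k) b d * e (Suc (Suc k)) f g)))"
    unfolding sum_distrib_right scale_sum_right by simp
  also have "\<dots> = r (Suc k)"
    unfolding e_one r_def emb_def U2_def sum_UNIV_pair by simp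
  finally show ?thesis by simp
qed

lemma r_square: "r k * r k = 1"
proof -
  have "(\<Sum>s\<in>UNIV. (case p of (a, b) \<Rightarrow> \<lambda>(c, d). R a b c d) s * (case s of (a, b) \<Rightarrow> \<lambda>(c, d). R a b c d) q)
      = (if p = q then 1 else 0)" for p q
    unfolding sum_UNIV_pair by (cases p; cases q) (simp add: inv)
  then show ?thesis
    unfolding r_def emb_mult[OF U2_mult] by (simp add: emb_one2)
qed

lemma r_braiding: "r k * r (Suc k) * r k = r (Suc k) * r k * r (Suc k)"
proof -
  let ?A = "\<lambda>(a::'n, b::'n, f::'n) (c, d, g). if f = g then R a b c d else 0"
  let ?B = "\<lambda>(a::'n, b::'n, f::'n) (c, d, g). if a = c then R b f d g else 0"
  have AB: "(\<lambda>p q. \<Sum>s\<in>UNIV. ?A p s * ?B s q) = (\<lambda>(a, b, f) (c, d, g). \<Sum>t\<in>UNIV. R a b c t * R t f d g)"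
    by (intro ext) (auto simp: sum_UNIV_pair sum_if_out if_distrib[where f = "\<lambda>z. z * _"] if_distrib[where f = "\<lambda>z. _ * z"] cong: if_cong)
  have BA: "(\<lambda>p q. \<Sum>s\<in>UNIV. ?B p s * ?A s q) = (\<lambda>(a, b, f) (c, d, g). \<Sum>t\<in>UNIV. R b f t g * R a t c d)"
    by (intro ext) (auto simp: sum_UNIV_pair sum_if_out if_distrib[where f = "\<lambda>z. z * _"] if_distrib[where f = "\<lambda>z. _ * z"] cong: if_cong)
  have "(\<lambda>p q. \<Sum>s\<in>UNIV. (case p of (a, b, f) \<Rightarrow> \<lambda>(c, d, g). \<Sum>t\<in>UNIV. R a b c t * R t f d g) s * ?A s q)
    = (\<lambda>p q. \<Sum>s\<in>UNIV. (case p of (a, b, f) \<Rightarrow> \<lambda>(c, d, g). \<Sum>t\<in>UNIV. R b f t g * R a t c d) s * ?B s q)"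
    (is "?L = ?R")
  proof (intro ext)
    fix p q :: "'n \<times> 'n \<times> 'n"
    obtain i j k l m n where [simp]: "p = (i, j, k)" "q = (l, m, n)" by (metis surj_pair)
    have "?L p q = (\<Sum>s\<in>UNIV. \<Sum>u\<in>UNIV. (\<Sum>t\<in>UNIV. R i j s t * R t k u n) * R s u l m)"
      by (simp add: sum_UNIV_pair if_distrib[where f = "\<lambda>z. _ * z"] cong: if_cong)
    also have "\<dots> = (\<Sum>s\<in>UNIV. \<Sum>t\<in>UNIV. \<Sum>u\<in>UNIV. R i j s t * R t k u n * R s u l m)"
      unfolding sum_distrib_right by (rule sum.cong[OF refl], rule sum.swap)
    also have "\<dots> = (\<Sum>s\<in>UNIV. \<Sum>t\<in>UNIV. \<Sum>u\<in>UNIV. R j k t s * R i t l u * R u s m n)"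
      by (rule ybe)
    also have "\<dots> = (\<Sum>u\<in>UNIV. \<Sum>s\<in>UNIV. (\<Sum>t\<in>UNIV. R j k t s * R i t l u) * R u s m n)"
      unfolding sum_distrib_right unfolding sum.cartesian_product
      by (rule sum.reindex_bij_witness[where i = "\<lambda>(u, s, t). (s, t, u)" and j = "\<lambda>(s, t, u). (u, s, t)"]) auto
    also have "\<dots> = ?R p q"
      by (simp add: sum_UNIV_pair sum_if_out if_distrib[where f = "\<lambda>z. _ * z"] cong: if_cong)
    finally show "?L p q = ?R p q" .
  qed
  then show ?thesis
    unfolding r_U3_left[of k] r_U3_right[of k] emb_mult[OF U3_mult] AB BA by simp
qed

lemma r_rho: "r k = (\<Sum>b\<in>UNIV. \<Sum>d\<in>UNIV. e (Suc k) b d * rho k b d)"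
  unfolding r_def emb_def rho_def U2_def sum_UNIV_pair sum_distrib_left unfolding sum.cartesian_product
  by (rule sum.reindex_bij_witness[where i = "\<lambda>(b, d, a, c). (a, b, c, d)" and j = "\<lambda>(a, b, c, d). (b, d, a, c)"])
    (auto simp: sc_simps e_comm)

section \<open>Localization and partial traces\<close>

lemma e_N: "p \<le> n \<Longrightarrow> e p a b \<in> N n"
  unfolding N_def using e_comm by auto

lemma N_closed:
  shows N_1: "1 \<in> N n" and N_plus: "x \<in> N n \<Longrightarrow> y \<in> N n \<Longrightarrow> x + y \<in> N n"
    and N_times: "x \<in> N n \<Longrightarrow> y \<in> N n \<Longrightarrow> x * y \<in> N n"
    and N_scale: "x \<in> N n \<Longrightarrow> c \<odot> x \<in> N n"
    and N_0: "0 \<in> N n"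
  unfolding N_def by (auto simp: distrib_left distrib_right sc_simps comm_mult[symmetric])

lemma N_sum: "(\<And>i. i \<in> I \<Longrightarrow> f i \<in> N n) \<Longrightarrow> (\<Sum>i\<in>I. f i) \<in> N n"
  by (induction I rule: infinite_finite_induct) (auto intro: N_0 N_plus)

lemma rho_N: "rho k b d \<in> N k"
  unfolding rho_def by (intro N_sum N_scale e_N) simp

lemma r_in_N: "r k \<in> N (Suc k)"
  unfolding r_def emb_def U2_def by (auto intro!: N_sum N_scale N_times e_N)

lemma N_r_commute: "x \<in> N l \<Longrightarrow> l < k \<Longrightarrow> x * r k = r k * x"
proof -
  assume x: "x \<in> N l" "l < k"
  have "x * (e k a c * e (Suc k) b d) = e k a c * e (Suc k) b d * x" for a b c d
    using x unfolding N_def by (intro comm_mult) auto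
  then show ?thesis
    unfolding r_def emb_def U2_def sum_UNIV_pair
    by (simp add: sum_distrib_left sum_distrib_right sc_simps)
qed

lemma C_at_N: "n \<le> m \<Longrightarrow> C_at n \<in> N m"
  unfolding C_at_def emb_def by (auto intro!: N_sum N_scale e_N)

lemma D_left: "y \<in> N n \<Longrightarrow> D (Suc n) (y * x) = y * D (Suc n) x"
proof -
  assume "y \<in> N n"
  then have "e (Suc n) b a * (y * x) * e (Suc n) a b = y * (e (Suc n) b a * x * e (Suc n) a b)" for a b
    unfolding N_def by (simp flip: mult.assoc)
  then show ?thesis unfolding D_def tru_def sum_distrib_left by simp
qed

lemma D_right: "y \<in> N n \<Longrightarrow> D (Suc n) (x * y) = D (Suc n) x * y"
proof -
  assume "y \<in> N n"
  then have "e (Suc n) b a * (x * y) * e (Suc n) a b = (e (Suc n) b a * x * e (Suc n) a b) * y" for a b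
    unfolding N_def by (simp add: mult.assoc)
  then show ?thesis unfolding D_def tru_def sum_distrib_right by simp
qed

lemma D_N: "x \<in> N (Suc n) \<Longrightarrow> D (Suc n) x \<in> N n"
proof -
  assume x: "x \<in> N (Suc n)"
  have "D (Suc n) x * e p c d = e p c d * D (Suc n) x" if "n < p" for p c d
  proof (cases "p = Suc n")
    case True
    have "D p x * e p c d = (\<Sum>a\<in>UNIV. e p c a * x * e p a d)"
      unfolding D_def tru_def sum_distrib_right
      by (simp add: mult.assoc e_mult if_distrib[where f = "\<lambda>z. _ * z"] cong: if_cong)
    moreover have "e p c d * D p x = (\<Sum>a\<in>UNIV. e p c a * x * e p a d)"
      unfolding D_def tru_def sum_distrib_left
      by (simp add: mult.assoc e_mult' cong: if_cong)
    ultimately show ?thesis using True by simp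
  next
    case False
    have "e p c d * (e (Suc n) b a * x * e (Suc n) a b) = e (Suc n) b a * x * e (Suc n) a b * e p c d" for a b
    proof (intro comm_mult e_comm)
      show "e p c d * x = x * e p c d" using x that False unfolding N_def by simp
    qed (use False in auto)
    then show ?thesis unfolding D_def tru_def by (simp add: sum_distrib_left sum_distrib_right)
  qed
  then show ?thesis unfolding N_def by blast
qed

lemma E_alt: "E n x = (\<Sum>a\<in>UNIV. \<Sum>b\<in>UNIV. C a b \<odot> ent n b a x)"
proof -
  have "E n x = (\<Sum>a\<in>UNIV. \<Sum>b\<in>UNIV. \<Sum>f\<in>UNIV. \<Sum>g\<in>UNIV. if a = g then C a b \<odot> (e n f b * x * e n a f) else 0)"
    unfolding E_def D_def tru_def C_at_def emb_def sum_distrib_right sum_distrib_left unfolding sum.cartesian_product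
    by (rule sum.reindex_bij_witness[where i = "\<lambda>(a, b, f, g). (a, f, g, b)" and j = "\<lambda>(a, f, g, b). (a, b, f, g)"])
      (auto simp: sc_simps mult.assoc e_mult')
  then show ?thesis
    by (simp add: ent_def scale_sum_right)
qed

lemma ent_expansion:
  assumes "\<And>a b. y a b \<in> N k"
  shows "ent (Suc k) a b (\<Sum>c\<in>UNIV. \<Sum>d\<in>UNIV. e (Suc k) c d * y c d) = y a b"
proof -
  have c: "y c d * e (Suc k) f g = e (Suc k) f g * y c d" for c d f g
    using assms[of c d] unfolding N_def by simp
  have "ent (Suc k) a b (\<Sum>c\<in>UNIV. \<Sum>d\<in>UNIV. e (Suc k) c d * y c d)
      = (\<Sum>f\<in>UNIV. \<Sum>c\<in>UNIV. \<Sum>d\<in>UNIV. if a = c then (if d = b then e (Suc k) f f * y c d else 0) else 0)"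
    unfolding ent_def sum_distrib_left sum_distrib_right
    by (intro sum.cong refl) (simp add: mult.assoc e_mult' c)
  also have "\<dots> = (\<Sum>f\<in>UNIV. e (Suc k) f f * y a b)"
    by (simp add: sum_if_out)
  finally show ?thesis
    by (simp add: e_one flip: sum_distrib_right)
qed

lemma E_expansion:
  assumes "\<And>a b. y a b \<in> N k"
  shows "E (Suc k) (\<Sum>c\<in>UNIV. \<Sum>d\<in>UNIV. e (Suc k) c d * y c d) = (\<Sum>a\<in>UNIV. \<Sum>b\<in>UNIV. C a b \<odot> y b a)"
  unfolding E_alt ent_expansion[OF assms] ..

lemma E_of_r: "E (Suc k) (r k) = 1"
proof -
  have "E (Suc k) (r k) = (\<Sum>a\<in>UNIV. \<Sum>b\<in>UNIV. C a b \<odot> rho k b a)"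
    unfolding r_rho by (rule E_expansion) (rule rho_N)
  also have "\<dots> = (\<Sum>f\<in>UNIV. \<Sum>g\<in>UNIV. (\<Sum>a\<in>UNIV. \<Sum>b\<in>UNIV. C a b * R f b g a) \<odot> e k f g)"
    unfolding rho_def scale_sum_left scale_sum_right unfolding sum.cartesian_product
    by (rule sum.reindex_bij_witness[where i = "\<lambda>(f, g, a, b). (a, b, f, g)" and j = "\<lambda>(a, b, f, g). (f, g, a, b)"]) auto
  also have "\<dots> = (\<Sum>f\<in>UNIV. e k f f)"
    unfolding trace_R_C by (simp add: if_distrib[where f = "\<lambda>z. z \<odot> _"] cong: if_cong)
  finally show ?thesis by (simp add: e_one)
qed

text \<open>Both \<open>r k\<close> are split into entries at the traced position. The matrix
  product there leaves \<open>rho * y * rho\<close>, whose contraction with \<open>C\<close> is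
  \<open>trace_conj\<close>.\<close>

lemma E_of_conj:
  assumes y: "y \<in> N k"
  shows "E (Suc k) (r k * y * r k) = E k y"
proof -
  have c: "x * e (Suc k) f g = e (Suc k) f g * x" if "x \<in> N k" for x f g
    using that unfolding N_def by simp
  have F: "e (Suc k) b d * rho k b d * y * (e (Suc k) f g * rho k f g)
      = (if d = f then e (Suc k) b g * (rho k b d * y * rho k f g) else 0)" for b d f g
  proof -
    have yN: "rho k b d * y \<in> N k" using y rho_N N_times by blast
    have "e (Suc k) b d * rho k b d * y * (e (Suc k) f g * rho k f g)
        = e (Suc k) b d * (rho k b d * y * e (Suc k) f g) * rho k f g"
      by (simp only: mult.assoc)
    also have "\<dots> = (e (Suc k) b d * e (Suc k) f g) * (rho k b d * y * rho k f g)"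
      unfolding c[OF yN] by (simp only: mult.assoc)
    finally show ?thesis unfolding e_mult by simp
  qed
  have "r k * y * r k = (\<Sum>b\<in>UNIV. \<Sum>g\<in>UNIV. \<Sum>d\<in>UNIV. \<Sum>f\<in>UNIV.
      if d = f then e (Suc k) b g * (rho k b d * y * rho k f g) else 0)"
    unfolding r_rho unfolding sum_distrib_right unfolding sum_distrib_left unfolding sum.cartesian_product
    by (rule sum.reindex_bij_witness[where i = "\<lambda>(b, g, d, f). (b, d, f, g)" and j = "\<lambda>(b, d, f, g). (b, g, d, f)"])
      (auto simp: F)
  also have "\<dots> = (\<Sum>b\<in>UNIV. \<Sum>g\<in>UNIV. e (Suc k) b g * (\<Sum>d\<in>UNIV. rho k b d * y * rho k d g))"
    by (simp add: sum_distrib_left)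
  finally have "E (Suc k) (r k * y * r k) = (\<Sum>a\<in>UNIV. \<Sum>b\<in>UNIV. C a b \<odot> (\<Sum>d\<in>UNIV. rho k b d * y * rho k d a))"
    using y rho_N by (simp only:) (intro E_expansion N_sum N_times)
  also have "\<dots> = (\<Sum>f\<in>UNIV. \<Sum>g\<in>UNIV. \<Sum>h\<in>UNIV. \<Sum>i\<in>UNIV.
      (\<Sum>b\<in>UNIV. \<Sum>d\<in>UNIV. \<Sum>a\<in>UNIV. R f b g d * R h d i a * C a b) \<odot> (e k f g * y * e k h i))"
    unfolding rho_def sum_distrib_left sum_distrib_right scale_sum_left scale_sum_right unfolding sum.cartesian_product
    by (rule sum.reindex_bij_witness[where i = "\<lambda>(f, g, h, i, b, d, a). (a, b, d, h, i, f, g)"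
          and j = "\<lambda>(a, b, d, h, i, f, g). (f, g, h, i, b, d, a)"])
      (auto simp: sc_simps mult_ac)
  also have "\<dots> = (\<Sum>f\<in>UNIV. \<Sum>g\<in>UNIV. \<Sum>h\<in>UNIV. C h g \<odot> (e k f g * y * e k h f))"
    unfolding trace_conj by (simp add: if_distrib[where f = "\<lambda>z. z \<odot> _"] cong: if_cong)
  also have "\<dots> = E k y"
    unfolding E_alt ent_def scale_sum_right unfolding sum.cartesian_product
    by (rule sum.reindex_bij_witness[where i = "\<lambda>(h, g, f). (f, g, h)" and j = "\<lambda>(f, g, h). (h, g, f)"]) auto
  finally show ?thesis .
qed

lemma D_D: "D k (D (Suc k) x) = tru (U2 k) x"
  unfolding D_def tru_def U2_def sum_UNIV_pair sum_distrib_left sum_distrib_right unfolding sum.cartesian_product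
  by (rule sum.reindex_bij_witness[where i = "\<lambda>(a, b, c, d). (a, c, b, d)" and j = "\<lambda>(a, c, b, d). (a, b, c, d)"])
    (auto simp: mult.assoc e_comm)

lemma E_E: "E k (E (Suc k) x) = tru (U2 k) (C_at k * C_at (Suc k) * x)"
  unfolding E_def D_left[OF C_at_N[OF order_refl], symmetric] D_D by (simp add: mult.assoc)

lemma C_prod_r: "C_at k * C_at (Suc k) * r k = r k * (C_at k * C_at (Suc k))"
proof -
  have C_prod: "C_at k * C_at (Suc k) = emb (U2 k) (\<lambda>(a, b) (c, d). C a c * C b d)"
    unfolding C_at_def emb_def U2_def sum_UNIV_pair unfolding sum_distrib_right unfolding sum_distrib_left unfolding sum.cartesian_product
    by (rule sum.reindex_bij_witness[where i = "\<lambda>(a, b, c, d). (a, c, b, d)" and j = "\<lambda>(a, c, b, d). (a, b, c, d)"])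
      (auto simp: sc_simps mult.commute)
  show ?thesis
    unfolding C_prod r_def emb_mult[OF U2_mult]
    by (rule arg_cong[where f = "emb (U2 k)"], intro ext) (auto simp: sum_UNIV_pair R_C_prod)
qed

text \<open>The last two traces form one trace over a pair of positions. It is cyclic against the
  scalar matrix \<open>r k\<close>, and \<open>r k\<close> commutes with the two copies of
  \<open>C\<close>.\<close>

lemma E_of_cyclic: "E k (E (Suc k) (r k * x)) = E k (E (Suc k) (x * r k))"
proof -
  have "E k (E (Suc k) (r k * x)) = tru (U2 k) (r k * (C_at k * C_at (Suc k) * x))"
    unfolding E_E mult.assoc[symmetric] C_prod_r by (simp only: mult.assoc)
  also have "\<dots> = tru (U2 k) (C_at k * C_at (Suc k) * x * r k)"
    unfolding r_def by (rule tru_cyclic) (rule U2_mult)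
  finally show ?thesis unfolding E_E by (simp only: mult.assoc)
qed

lemma E_of_one: "E (Suc n) 1 = (\<Sum>a\<in>UNIV. C a a) \<odot> 1"
proof -
  have "(\<Sum>c\<in>UNIV. \<Sum>d\<in>UNIV. e (Suc n) c d * (if c = d then 1 else 0)) = 1"
    by (simp add: e_one if_distrib[where f = "\<lambda>z. _ * z"] cong: if_cong)
  then show ?thesis
    using E_expansion[of "\<lambda>c d. if c = d then 1 else 0" n] N_1 N_0
    by (simp add: scale_sum_left if_distrib[where f = "\<lambda>z. _ \<odot> z"] cong: if_cong)
qed

sublocale r_tower sc r N E "\<Sum>a\<in>UNIV. C a a"
proof
  fix k l :: nat
  assume "k + 2 \<le> l"
  then show "r k * r l = r l * r k"
    using r_in_N[of k] by (intro N_r_commute) auto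
next
  fix x y n
  assume *: "x \<in> N n" "is_unit_of x y"
  have "y * e p a b = e p a b * y" if "p > n" for p a b
  proof -
    have "y * e p a b = y * (e p a b * x) * y" using *(2) unfolding is_unit_of_def by (simp add: mult.assoc)
    also have "e p a b * x = x * e p a b" using *(1) that unfolding N_def by simp
    also have "y * (x * e p a b) * y = e p a b * y" using *(2) unfolding is_unit_of_def by (simp flip: mult.assoc)
    finally show ?thesis .
  qed
  then show "y \<in> N n" unfolding N_def by blast
next
  fix x y n
  show "E n (x + y) = E n x + E n y"
    unfolding E_def D_def tru_def by (simp add: distrib_left distrib_right sum.distrib)
  show "E n (c \<odot> x) = c \<odot> E n x" for c
    unfolding E_def D_def tru_def by (simp add: sc_simps scale_sum_right)
  show "E (Suc n) x \<in> N n" if "x \<in> N (Suc n)"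
    unfolding E_def using that C_at_N by (intro D_N N_times) auto
  assume y: "y \<in> N n"
  then have "C_at (Suc n) * y = y * C_at (Suc n)"
    unfolding N_def C_at_def emb_def by (simp add: sum_distrib_left sum_distrib_right sc_simps)
  then show "E (Suc n) (y * x) = y * E (Suc n) x"
    unfolding E_def D_left[OF y, symmetric] by (simp flip: mult.assoc)
  show "E (Suc n) (x * y) = E (Suc n) x * y"
    unfolding E_def D_right[OF y, symmetric] by (simp flip: mult.assoc)
qed (use N_closed r_square r_braiding r_in_N N_r_commute E_of_one E_of_r E_of_conj E_of_cyclic in
    \<open>auto simp: N_def\<close>)

end

section \<open>From tensors to the tower\<close>

declare One_nat_def [simp del]

lemma fa_const_add: "fa_const (a + b) = fa_const a + fa_const b"
  unfolding fa_const_def by (simp add: single_add)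

lemma fa_const_mult: "fa_const (a * b) = fa_const a * fa_const b"
  unfolding fa_const_def by (simp add: mult_single)

lemma fa_const_0: "fa_const 0 = 0"
  unfolding fa_const_def by simp

lemma fa_const_1: "fa_const 1 = 1"
  unfolding fa_const_def by simp

lemma fa_const_sum: "fa_const (\<Sum>i\<in>I. f i) = (\<Sum>i\<in>I. fa_const (f i))"
  by (induction I rule: infinite_finite_induct) (simp_all add: fa_const_0 fa_const_add)

lemma finite_multi_idx: "finite S \<Longrightarrow> finite (multi_idx S :: (nat \<Rightarrow> 'n::finite) set)"
  unfolding multi_idx_def by (intro finite_PiE) auto

lemma multi_idx_upd: "j \<in> multi_idx S \<Longrightarrow> a \<in> S \<Longrightarrow> j(a := x) \<in> multi_idx S"
  unfolding multi_idx_def by (auto simp: PiE_def extensional_def)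

lemma multi_idx_eqI:
  "i \<in> multi_idx S \<Longrightarrow> j \<in> multi_idx S \<Longrightarrow> (\<And>c. c \<in> S \<Longrightarrow> i c = j c) \<Longrightarrow> i = j"
  unfolding multi_idx_def by (rule PiE_ext)

lemma ball_Suc: "(\<forall>p\<in>{1..Suc n}. P p) \<longleftrightarrow> (\<forall>p\<in>{1..n}. P p) \<and> P (Suc n)"
  by (auto simp: atLeastAtMostSuc_conv)

lemma sum_multi_idx_agree1:
  fixes f :: "(nat \<Rightarrow> 'n::finite) \<Rightarrow> 'a::comm_monoid_add"
  assumes "finite S" "a \<in> S" "j \<in> multi_idx S"
  shows "(\<Sum>i\<in>multi_idx S. if \<forall>c\<in>S - {a}. i c = j c then f i else 0) = (\<Sum>x\<in>UNIV. f (j(a := x)))"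
proof -
  have "(\<Sum>i\<in>multi_idx S. if \<forall>c\<in>S - {a}. i c = j c then f i else 0)
      = (\<Sum>i\<in>{i \<in> multi_idx S. \<forall>c\<in>S - {a}. i c = j c}. f i)"
    by (rule sum.inter_filter[OF finite_multi_idx[OF assms(1)], symmetric])
  also have "\<dots> = (\<Sum>x\<in>UNIV. f (j(a := x)))"
  proof (rule sum.reindex_bij_witness[where j = "\<lambda>i. i a" and i = "\<lambda>x. j(a := x)"])
    fix i assume "i \<in> {i \<in> multi_idx S. \<forall>c\<in>S - {a}. i c = j c}"
    then show "j(a := i a) = i"
      using assms by (intro multi_idx_eqI[of _ S]) (auto intro: multi_idx_upd)
    then show "f (j(a := i a)) = f i" by simp
  qed (use assms in \<open>auto intro: multi_idx_upd\<close>)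
  finally show ?thesis .
qed

lemma sum_multi_idx_agree2:
  fixes f :: "(nat \<Rightarrow> 'n::finite) \<Rightarrow> 'a::comm_monoid_add"
  assumes "finite S" "a \<in> S" "b \<in> S" "a \<noteq> b" "j \<in> multi_idx S"
  shows "(\<Sum>i\<in>multi_idx S. if \<forall>c\<in>S - {a, b}. i c = j c then f i else 0)
    = (\<Sum>p\<in>UNIV. f (j(a := fst p, b := snd p)))"
proof -
  have "(\<Sum>i\<in>multi_idx S. if \<forall>c\<in>S - {a, b}. i c = j c then f i else 0)
      = (\<Sum>i\<in>{i \<in> multi_idx S. \<forall>c\<in>S - {a, b}. i c = j c}. f i)"
    by (rule sum.inter_filter[OF finite_multi_idx[OF assms(1)], symmetric])
  also have "\<dots> = (\<Sum>p\<in>UNIV. f (j(a := fst p, b := snd p)))"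
  proof (rule sum.reindex_bij_witness[where j = "\<lambda>i. (i a, i b)" and i = "\<lambda>p. j(a := fst p, b := snd p)"])
    fix i assume "i \<in> {i \<in> multi_idx S. \<forall>c\<in>S - {a, b}. i c = j c}"
    then show "j(a := fst (i a, i b), b := snd (i a, i b)) = i"
      using assms by (intro multi_idx_eqI[of _ S]) (auto intro: multi_idx_upd)
    then show "f (j(a := fst (i a, i b), b := snd (i a, i b))) = f i" by simp
  qed (use assms in \<open>auto intro: multi_idx_upd\<close>)
  finally show ?thesis .
qed

lemma lift_tensor_mult: "lift_tensor (tensor_mult S X Y) = tensor_mult S (lift_tensor X) (lift_tensor Y)"
  unfolding lift_tensor_def tensor_mult_def by (simp add: fa_const_sum fa_const_mult)

lemma lift_tensor_one: "lift_tensor (tensor_one S) = tensor_one S"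
  unfolding lift_tensor_def tensor_one_def by (intro ext) (simp add: fa_const_0 fa_const_1)

lemma lift_tensor_prod_list: "lift_tensor (tensor_prod_list S Xs) = tensor_prod_list S (map lift_tensor Xs)"
  unfolding tensor_prod_list_def by (induction Xs) (simp_all add: lift_tensor_one lift_tensor_mult)

lemma matrix_inv_involution:
  fixes R :: "complex ^ 'p::finite ^ 'p"
  assumes "R ** R = mat 1"
  shows "matrix_inv R = R"
proof -
  have "R ** matrix_inv R = mat 1 \<and> matrix_inv R ** R = mat 1"
    unfolding matrix_inv_def by (rule someI[of _ R]) (simp add: assms)
  then have "matrix_inv R ** R = mat 1" ..
  then have "matrix_inv R ** (R ** R) = R" by (simp add: matrix_mul_assoc)
  then show ?thesis using assms by simp
qed

text \<open>Since the image of \<Phi> commutes with the matrix units, matrices with entries in the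
  free algebra multiply correctly inside the ring.\<close>

locale M_rep = matrix_units sc "\<lambda>a b c d. R $ (a, b) $ (c, d)" "\<lambda>a b c d. \<Psi> $ (a, b) $ (c, d)" e
  for sc :: "complex \<Rightarrow> 'e::ring_1 \<Rightarrow> 'e" (infixr "\<odot>" 75)
    and R \<Psi> :: "complex ^ ('n::finite \<times> 'n) ^ ('n \<times> 'n)" and e :: "nat \<Rightarrow> 'n \<Rightarrow> 'n \<Rightarrow> 'e" +
  fixes \<Phi> :: "'g free_alg \<Rightarrow> 'e"
  assumes \<Phi>_add: "\<Phi> (x + y) = \<Phi> x + \<Phi> y"
    and \<Phi>_mult: "\<Phi> (x * y) = \<Phi> x * \<Phi> y"
    and \<Phi>_const: "\<Phi> (fa_const c) = c \<odot> 1"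
    and \<Phi>_e: "\<Phi> x * e p a b = e p a b * \<Phi> x"
begin

lemma \<Phi>_0: "\<Phi> 0 = 0"
  using \<Phi>_add[of 0 0] by simp

lemma \<Phi>_1: "\<Phi> 1 = 1"
  using \<Phi>_const[of 1] by (simp add: fa_const_1)

lemma \<Phi>_diff: "\<Phi> (x - y) = \<Phi> x - \<Phi> y"
  using \<Phi>_add[of "x - y" y] by simp

lemma \<Phi>_sum: "\<Phi> (\<Sum>i\<in>I. f i) = (\<Sum>i\<in>I. \<Phi> (f i))"
  by (induction I rule: infinite_finite_induct) (simp_all add: \<Phi>_0 \<Phi>_add)

lemma \<Phi>_N: "\<Phi> x \<in> N n"
  unfolding N_def using \<Phi>_e by auto

section \<open>The homomorphism \<open>tmap\<close> from tensors to the ring\<close>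

fun Eu :: "nat \<Rightarrow> (nat \<Rightarrow> 'n) \<Rightarrow> (nat \<Rightarrow> 'n) \<Rightarrow> 'e"
  where
    "Eu 0 i j = 1"
  | "Eu (Suc n) i j = Eu n i j * e (Suc n) (i (Suc n)) (j (Suc n))"

definition tmap :: "nat \<Rightarrow> ('n, 'g free_alg) tensor \<Rightarrow> 'e"
  where "tmap n X = (\<Sum>i\<in>multi_idx {1..n}. \<Sum>j\<in>multi_idx {1..n}. \<Phi> (X i j) * Eu n i j)"

lemma Eu_N: "n \<le> m \<Longrightarrow> Eu n i j \<in> N m"
  by (induction n) (auto intro: N_1 N_times e_N)

lemma Eu_\<Phi>: "Eu n i j * \<Phi> x = \<Phi> x * Eu n i j"
proof (induction n)
  case (Suc n)
  show ?case unfolding Eu.simps by (rule comm_mult[symmetric]) (simp_all add: Suc \<Phi>_e)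
qed simp

lemma e_Eu_comm: "n < p \<Longrightarrow> e p a b * Eu n i j = Eu n i j * e p a b"
  using Eu_N[of n n i j] unfolding N_def by simp

lemma Eu_cong: "(\<And>p. 1 \<le> p \<Longrightarrow> p \<le> n \<Longrightarrow> i p = i' p \<and> j p = j' p) \<Longrightarrow> Eu n i j = Eu n i' j'"
  by (induction n) simp_all

lemma Eu_mult: "Eu n i j * Eu n k l = (if \<forall>p\<in>{1..n}. j p = k p then Eu n i l else 0)"
proof (induction n)
  case (Suc n)
  have "Eu (Suc n) i j * Eu (Suc n) k l
      = Eu n i j * (e (Suc n) (i (Suc n)) (j (Suc n)) * Eu n k l) * e (Suc n) (k (Suc n)) (l (Suc n))"
    by (simp add: mult.assoc)
  also have "\<dots> = (Eu n i j * Eu n k l) * (e (Suc n) (i (Suc n)) (j (Suc n)) * e (Suc n) (k (Suc n)) (l (Suc n)))"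
    by (subst e_Eu_comm) (simp_all add: mult.assoc)
  also have "\<dots> = (if \<forall>p\<in>{1..Suc n}. j p = k p then Eu (Suc n) i l else 0)"
    unfolding Suc e_mult ball_Suc by simp
  finally show ?case .
qed simp

lemma sum_Eu: "(\<Sum>i\<in>multi_idx {1..n}. Eu n i i) = 1"
proof (induction n)
  case 0
  show ?case by (simp add: multi_idx_def)
next
  case (Suc n)
  have "(\<Sum>i\<in>multi_idx {1..Suc n}. Eu (Suc n) i i)
      = (\<Sum>p\<in>multi_idx {1..n} \<times> (UNIV :: 'n set). Eu n (fst p) (fst p) * e (Suc n) (snd p) (snd p))"
  proof (rule sum.reindex_bij_witness[where j = "\<lambda>i. (restrict i {1..n}, i (Suc n))"
        and i = "\<lambda>p. (fst p)(Suc n := snd p)"])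
    fix i :: "nat \<Rightarrow> 'n" assume i: "i \<in> multi_idx {1..Suc n}"
    then show "(fst (restrict i {1..n}, i (Suc n)))(Suc n := snd (restrict i {1..n}, i (Suc n))) = i"
      unfolding multi_idx_def by (intro ext) (auto simp: restrict_def PiE_def extensional_def le_Suc_eq)
    show "(restrict i {1..n}, i (Suc n)) \<in> multi_idx {1..n} \<times> UNIV"
      unfolding multi_idx_def by auto
    show "Eu n (fst (restrict i {1..n}, i (Suc n))) (fst (restrict i {1..n}, i (Suc n)))
        * e (Suc n) (snd (restrict i {1..n}, i (Suc n))) (snd (restrict i {1..n}, i (Suc n))) = Eu (Suc n) i i"
      using Eu_cong[of n "restrict i {1..n}" i "restrict i {1..n}" i] by simp
  next
    fix p :: "(nat \<Rightarrow> 'n) \<times> 'n" assume p: "p \<in> multi_idx {1..n} \<times> UNIV"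
    then show "(fst p)(Suc n := snd p) \<in> multi_idx {1..Suc n}"
      unfolding multi_idx_def by (auto simp: PiE_def extensional_def)
    show "(restrict ((fst p)(Suc n := snd p)) {1..n}, ((fst p)(Suc n := snd p)) (Suc n)) = p"
      using p unfolding multi_idx_def by (cases p) (auto simp: restrict_def PiE_def extensional_def)
  qed
  also have "\<dots> = (\<Sum>i\<in>multi_idx {1..n}. Eu n i i) * (\<Sum>a\<in>UNIV. e (Suc n) a a)"
    by (simp add: sum_product sum.cartesian_product case_prod_beta)
  finally show ?case unfolding Suc e_one by simp
qed

lemma tmap_mult: "tmap n (tensor_mult {1..n} X Y) = tmap n X * tmap n Y"
proof -
  let ?I = "multi_idx {1..n} :: (nat \<Rightarrow> 'n) set"
  have fin: "finite ?I" by (rule finite_multi_idx) simp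
  have eq: "(\<forall>p\<in>{1..n}. j p = k p) \<longleftrightarrow> j = k" if "j \<in> ?I" "k \<in> ?I" for j k
    using multi_idx_eqI[OF that] by auto
  have step: "\<Phi> a * Eu n i j * (\<Phi> b * Eu n k l) = (if j = k then \<Phi> (a * b) * Eu n i l else 0)"
    if "j \<in> ?I" "k \<in> ?I" for a b i j k l
  proof -
    have "\<Phi> a * Eu n i j * (\<Phi> b * Eu n k l) = \<Phi> a * (Eu n i j * \<Phi> b) * Eu n k l"
      by (simp only: mult.assoc)
    also have "\<dots> = \<Phi> a * \<Phi> b * (Eu n i j * Eu n k l)"
      unfolding Eu_\<Phi> by (simp only: mult.assoc)
    finally show ?thesis unfolding Eu_mult eq[OF that] \<Phi>_mult by simp
  qed
  have "tmap n X * tmap n Y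
      = (\<Sum>i\<in>?I. \<Sum>j\<in>?I. \<Sum>k\<in>?I. \<Sum>l\<in>?I. \<Phi> (X i j) * Eu n i j * (\<Phi> (Y k l) * Eu n k l))"
    unfolding tmap_def unfolding sum_distrib_right unfolding sum_distrib_left ..
  also have "\<dots> = (\<Sum>i\<in>?I. \<Sum>j\<in>?I. \<Sum>k\<in>?I. \<Sum>l\<in>?I. if j = k then \<Phi> (X i j * Y k l) * Eu n i l else 0)"
    by (intro sum.cong refl step)
  also have "\<dots> = (\<Sum>i\<in>?I. \<Sum>j\<in>?I. \<Sum>l\<in>?I. \<Phi> (X i j * Y j l) * Eu n i l)"
    using fin by (simp add: sum_if_out)
  also have "\<dots> = (\<Sum>i\<in>?I. \<Sum>l\<in>?I. \<Sum>j\<in>?I. \<Phi> (X i j * Y j l) * Eu n i l)"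
    by (rule sum.cong[OF refl], rule sum.swap)
  also have "\<dots> = tmap n (tensor_mult {1..n} X Y)"
    unfolding tmap_def tensor_mult_def by (simp add: \<Phi>_sum sum_distrib_right)
  finally show ?thesis by simp
qed

lemma tmap_one: "tmap n (tensor_one {1..n}) = 1"
proof -
  let ?I = "multi_idx {1..n} :: (nat \<Rightarrow> 'n) set"
  have fin: "finite ?I" by (rule finite_multi_idx) simp
  have "tmap n (tensor_one {1..n}) = (\<Sum>i\<in>?I. \<Sum>j\<in>?I. if i = j then Eu n i j else 0)"
    unfolding tmap_def tensor_one_def
    by (intro sum.cong refl) (auto simp: \<Phi>_0 \<Phi>_1 dest: multi_idx_eqI)
  also have "\<dots> = 1" using fin by (simp add: sum_Eu)
  finally show ?thesis .
qed

lemma tmap_prod_list: "tmap n (tensor_prod_list {1..n} Xs) = prod_list (map (tmap n) Xs)"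
  unfolding tensor_prod_list_def by (induction Xs) (simp_all add: tmap_one tmap_mult)

lemma e_Eu:
  "1 \<le> a \<Longrightarrow> a \<le> n \<Longrightarrow> e a x y * Eu n i j = (if y = i a then Eu n (i(a := x)) j else 0)"
proof (induction n)
  case (Suc n)
  show ?case
  proof (cases "a = Suc n")
    case True
    have "e a x y * Eu (Suc n) i j = Eu n i j * (e a x y * e a (i a) (j a))"
      using True e_Eu_comm[of n a x y i j] by (simp flip: mult.assoc)
    also have "\<dots> = (if y = i a then Eu n i j * e a x (j a) else 0)"
      by (simp add: e_mult)
    also have "Eu n i j = Eu n (i(a := x)) j"
      using True by (intro Eu_cong) auto
    finally show ?thesis using True by (simp add: fun_upd_same del: fun_upd_apply)
  next
    case False
    then have "e a x y * Eu n i j = (if y = i a then Eu n (i(a := x)) j else 0)"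
      using Suc by simp
    then show ?thesis using False by (simp add: fun_upd_other del: fun_upd_apply flip: mult.assoc)
  qed
qed simp

text \<open>Multiplication of \<open>e a x y\<close> by the partition of unity
  \<open>sum_Eu\<close>.\<close>

lemma e_expansion:
  assumes "1 \<le> a" "a \<le> n"
  shows "e a x y = (\<Sum>i\<in>multi_idx {1..n}. if y = i a then Eu n (i(a := x)) i else 0)"
proof -
  have "e a x y = e a x y * (\<Sum>i\<in>multi_idx {1..n}. Eu n i i)" by (simp add: sum_Eu)
  then show ?thesis unfolding sum_distrib_left e_Eu[OF assms] .
qed

lemma e_expansion2:
  assumes "1 \<le> a" "a \<le> n" "1 \<le> b" "b \<le> n" "a \<noteq> b"
  shows "e a x y * e b x' y'
    = (\<Sum>i\<in>multi_idx {1..n}. if y = i a \<and> y' = i b then Eu n (i(a := x, b := x')) i else 0)"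
proof -
  have "e a x y * e b x' y' = e a x y * (\<Sum>i\<in>multi_idx {1..n}. if y' = i b then Eu n (i(b := x')) i else 0)"
    using e_expansion[OF assms(3,4)] by simp
  also have "\<dots> = (\<Sum>i\<in>multi_idx {1..n}. if y' = i b then e a x y * Eu n (i(b := x')) i else 0)"
    unfolding sum_distrib_left by (intro sum.cong refl) simp
  also have "\<dots> = (\<Sum>i\<in>multi_idx {1..n}. if y = i a \<and> y' = i b then Eu n (i(a := x, b := x')) i else 0)"
    unfolding e_Eu[OF assms(1,2)] using assms(5) by (intro sum.cong refl) (auto simp: fun_upd_twist)
  finally show ?thesis .
qed

definition at1 :: "nat \<Rightarrow> 'g free_alg ^ 'n ^ 'n \<Rightarrow> 'e"
  where "at1 a X = (\<Sum>x\<in>UNIV. \<Sum>y\<in>UNIV. \<Phi> (X $ x $ y) * e a x y)"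

lemma tmap_place1:
  assumes "1 \<le> a" "a \<le> n"
  shows "tmap n (place1 {1..n} a X) = at1 a X"
proof -
  let ?I = "multi_idx {1..n} :: (nat \<Rightarrow> 'n) set"
  have "tmap n (place1 {1..n} a X) = (\<Sum>j\<in>?I. \<Sum>i\<in>?I.
      if \<forall>c\<in>{1..n} - {a}. i c = j c then \<Phi> (X $ i a $ j a) * Eu n i j else 0)"
    unfolding tmap_def place1_def by (subst sum.swap) (intro sum.cong refl, simp add: \<Phi>_0)
  also have "\<dots> = (\<Sum>j\<in>?I. \<Sum>x\<in>UNIV. \<Phi> (X $ x $ j a) * Eu n (j(a := x)) j)"
    using assms by (intro sum.cong refl, subst sum_multi_idx_agree1) auto
  also have "\<dots> = (\<Sum>x\<in>UNIV. \<Sum>j\<in>?I. \<Phi> (X $ x $ j a) * Eu n (j(a := x)) j)"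
    by (rule sum.swap)
  also have "\<dots> = (\<Sum>x\<in>UNIV. \<Sum>j\<in>?I. \<Sum>y\<in>UNIV. \<Phi> (X $ x $ y) * (if y = j a then Eu n (j(a := x)) j else 0))"
    by (simp add: if_distrib[where f = "\<lambda>z. _ * z"] cong: if_cong)
  also have "\<dots> = (\<Sum>x\<in>UNIV. \<Sum>y\<in>UNIV. \<Sum>j\<in>?I. \<Phi> (X $ x $ y) * (if y = j a then Eu n (j(a := x)) j else 0))"
    by (rule sum.cong[OF refl], rule sum.swap)
  also have "\<dots> = at1 a X"
    unfolding at1_def e_expansion[OF assms] sum_distrib_left ..
  finally show ?thesis .
qed

lemma tmap_place2:
  assumes "1 \<le> k" "Suc k \<le> n"
  shows "tmap n (lift_tensor (place2 {1..n} k (k + 1) R)) = r k"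
proof -
  let ?I = "multi_idx {1..n} :: (nat \<Rightarrow> 'n) set" and ?b = "Suc k"
  have "tmap n (lift_tensor (place2 {1..n} k (k + 1) R)) = (\<Sum>j\<in>?I. \<Sum>i\<in>?I.
      if \<forall>c\<in>{1..n} - {k, ?b}. i c = j c then R $ (i k, i ?b) $ (j k, j ?b) \<odot> Eu n i j else 0)"
    unfolding tmap_def place2_def lift_tensor_def Suc_eq_plus1[symmetric]
    by (subst sum.swap) (intro sum.cong refl, simp add: fa_const_0 \<Phi>_0 \<Phi>_const sc_simps)
  also have "\<dots> = (\<Sum>j\<in>?I. \<Sum>p\<in>UNIV. R $ p $ (j k, j ?b) \<odot> Eu n (j(k := fst p, ?b := snd p)) j)"
    using assms by (intro sum.cong refl, subst sum_multi_idx_agree2) auto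
  also have "\<dots> = (\<Sum>p\<in>UNIV. \<Sum>j\<in>?I. R $ p $ (j k, j ?b) \<odot> Eu n (j(k := fst p, ?b := snd p)) j)"
    by (rule sum.swap)
  also have "\<dots> = (\<Sum>p\<in>UNIV. \<Sum>j\<in>?I. \<Sum>q\<in>UNIV. R $ p $ q \<odot>
      (if q = (j k, j ?b) then Eu n (j(k := fst p, ?b := snd p)) j else 0))"
    by (simp add: if_distrib[where f = "\<lambda>z. _ \<odot> z"] cong: if_cong)
  also have "\<dots> = (\<Sum>p\<in>UNIV. \<Sum>q\<in>UNIV. \<Sum>j\<in>?I. R $ p $ q \<odot>
      (if q = (j k, j ?b) then Eu n (j(k := fst p, ?b := snd p)) j else 0))"
    by (rule sum.cong[OF refl], rule sum.swap)
  also have "\<dots> = (\<Sum>p\<in>UNIV. \<Sum>q\<in>UNIV. R $ p $ q \<odot> (e k (fst p) (fst q) * e ?b (snd p) (snd q)))"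
  proof -
    have "e k (fst p) (fst q) * e ?b (snd p) (snd q)
        = (\<Sum>j\<in>?I. if q = (j k, j ?b) then Eu n (j(k := fst p, ?b := snd p)) j else 0)" for p q
      using assms by (subst e_expansion2[of k n ?b]) (auto simp: prod_eq_iff intro!: sum.cong)
    then show ?thesis by (simp add: scale_sum_right)
  qed
  also have "\<dots> = r k"
    unfolding r_def emb_def U2_def by (simp add: case_prod_beta)
  finally show ?thesis .
qed

lemma R_inverse: "matrix_inv R = R"
proof (rule matrix_inv_involution)
  show "R ** R = mat 1"
    unfolding matrix_matrix_mult_def mat_def vec_eq_iff sum_UNIV_pair
    using inv by (auto simp: split_paired_all)
qed

fun over :: "'e \<Rightarrow> nat \<Rightarrow> 'e"
  where
    "over x 0 = x"
  | "over x (Suc 0) = x"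
  | "over x (Suc (Suc n)) = r (Suc n) * over x (Suc n) * r (Suc n)"

lemma over_Suc: "1 \<le> k \<Longrightarrow> over x (Suc k) = r k * over x k * r k"
  by (cases k) simp_all

lemma tmap_overlined:
  "1 \<le> n \<Longrightarrow> k \<le> n \<Longrightarrow> tmap n (overlined {1..n} R X k) = over (at1 1 X) k"
proof (induction k rule: induct_nat_012)
  case (ge2 k)
  have "tmap n (lift_tensor (place2 {1..n} (Suc k) (Suc k + 1) R)) = r (Suc k)"
    using ge2.prems by (intro tmap_place2) auto
  then show ?case
    using ge2 by (simp add: tmap_prod_list R_inverse mult.assoc)
qed (simp_all add: tmap_place1)

lemma tmap_lift_sc: "tmap n (lift_tensor (\<lambda>i j. c * X i j)) = c \<odot> tmap n (lift_tensor X)"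
  unfolding tmap_def lift_tensor_def by (simp add: fa_const_mult \<Phi>_mult \<Phi>_const sc_simps scale_sum_right mult.commute)

lemma tmap_lift_diff:
  "tmap n (lift_tensor (\<lambda>i j. X i j - Y i j)) = tmap n (lift_tensor X) - tmap n (lift_tensor Y)"
proof -
  have "fa_const (a - b) = (fa_const a - fa_const b :: 'g free_alg)" for a b
    by (simp add: eq_diff_eq flip: fa_const_add)
  then show ?thesis
    unfolding tmap_def lift_tensor_def by (simp add: \<Phi>_diff left_diff_distrib sum_subtractf)
qed

lemma tmap_skew_sym: "k \<le> n \<Longrightarrow> tmap n (lift_tensor (skew_sym {1..n} R k)) = skewer 0 k"
proof (induction k rule: induct_nat_012)
  case (ge2 k)
  let ?X = "skew_sym {1..n} R (Suc k)"
  let ?B = "\<lambda>i j. 1 / of_nat (Suc k) * tensor_one {1..n} i j - place2 {1..n} (Suc k) (Suc k + 1) R i j"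
  have B: "tmap n (lift_tensor ?B) = (1 / of_nat (Suc k)) \<odot> 1 - r (Suc k)"
    using ge2.prems tmap_place2[of "Suc k" n]
    by (simp only: tmap_lift_diff tmap_lift_sc lift_tensor_one tmap_one)
  have "skew_sym {1..n} R (Suc (Suc k))
      = (\<lambda>i j. of_nat (Suc k) / of_nat (Suc (Suc k)) * tensor_prod_list {1..n} [?X, ?B, ?X] i j)"
    by (simp add: Let_def)
  then have "tmap n (lift_tensor (skew_sym {1..n} R (Suc (Suc k))))
      = (of_nat (Suc k) / of_nat (Suc (Suc k))) \<odot> tmap n (lift_tensor (tensor_prod_list {1..n} [?X, ?B, ?X]))"
    by (simp only: tmap_lift_sc)
  also have "tmap n (lift_tensor (tensor_prod_list {1..n} [?X, ?B, ?X]))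
      = skewer 0 (Suc k) * (((1 / of_nat (Suc k)) \<odot> 1 - r (Suc k)) * skewer 0 (Suc k))"
    using ge2 B by (simp only: lift_tensor_prod_list tmap_prod_list list.map prod_list.Cons prod_list.Nil mult_1_right)
  finally show ?case by (simp add: mult.assoc)
qed (simp_all add: lift_tensor_one tmap_one)

section \<open>Comparison of the traces\<close>

fun plain_tr :: "nat \<Rightarrow> 'e \<Rightarrow> 'e"
  where
    "plain_tr 0 x = x"
  | "plain_tr (Suc n) x = plain_tr n (D (Suc n) x)"

fun C_prod :: "nat \<Rightarrow> 'e"
  where
    "C_prod 0 = 1"
  | "C_prod (Suc n) = C_prod n * C_at (Suc n)"

lemma C_prod_N: "n \<le> m \<Longrightarrow> C_prod n \<in> N m"
  by (induction n) (auto intro: N_1 N_times C_at_N)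

text \<open>The definition of the R-trace puts all copies of \<open>C\<close> in front at once,
  whereas \<open>tr\<close> inserts each one when its position is traced; \<open>D_left\<close> lets
  the lower copies wait outside.\<close>

lemma tr_plain_tr: "tr n x = plain_tr n (C_prod n * x)"
proof (induction n arbitrary: x)
  case (Suc n)
  have "tr (Suc n) x = plain_tr n (C_prod n * D (Suc n) (C_at (Suc n) * x))"
    unfolding ptr.simps add_0 Suc E_def ..
  then show ?case
    using D_left[OF C_prod_N[OF order_refl[of n]], of "C_at (Suc n) * x"] by (simp add: mult.assoc)
qed simp

lemma D_zero: "D n 0 = 0"
  unfolding D_def tru_def by simp

lemma plain_tr_add: "plain_tr n (x + y) = plain_tr n x + plain_tr n y"
proof (induction n arbitrary: x y)
  case (Suc n)
  have "D (Suc n) (x + y) = D (Suc n) x + D (Suc n) y"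
    unfolding D_def tru_def by (simp add: distrib_left distrib_right sum.distrib)
  then show ?case using Suc by simp
qed simp

lemma plain_tr_0: "plain_tr n 0 = 0"
  by (induction n) (simp_all add: D_zero)

lemma plain_tr_sum: "plain_tr n (\<Sum>i\<in>I. f i) = (\<Sum>i\<in>I. plain_tr n (f i))"
  by (induction I rule: infinite_finite_induct) (simp_all add: plain_tr_0 plain_tr_add)

lemma plain_tr_Eu: "plain_tr n (\<Phi> a * Eu n i j) = (if \<forall>p\<in>{1..n}. i p = j p then \<Phi> a else 0)"
proof (induction n)
  case (Suc n)
  have De: "D (Suc n) (e (Suc n) a b) = (if a = b then 1 else 0)" for a b
  proof -
    have "D (Suc n) (e (Suc n) a b) = (\<Sum>p\<in>UNIV. \<Sum>q\<in>UNIV. if p = a then (if b = p then e (Suc n) q q else 0) else 0)"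
      unfolding D_def tru_def by (intro sum.cong refl) (simp add: e_mult)
    also have "\<dots> = (if a = b then 1 else 0)"
      by (auto simp: sum_if_out e_one)
    finally show ?thesis .
  qed
  have "\<Phi> a * Eu n i j \<in> N n" by (intro N_times \<Phi>_N Eu_N) simp
  then have "D (Suc n) (\<Phi> a * Eu (Suc n) i j)
      = \<Phi> a * Eu n i j * (if i (Suc n) = j (Suc n) then 1 else 0)"
    using D_left[of "\<Phi> a * Eu n i j" n] by (simp add: De mult.assoc)
  then show ?case using Suc by (auto simp: plain_tr_0 ball_Suc simp del: One_nat_def)
qed simp

lemma plain_tr_tmap: "plain_tr n (tmap n X) = \<Phi> (full_trace {1..n} X)"
proof -
  let ?I = "multi_idx {1..n} :: (nat \<Rightarrow> 'n) set"
  have fin: "finite ?I" by (rule finite_multi_idx) simp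
  have "plain_tr n (tmap n X) = (\<Sum>i\<in>?I. \<Sum>j\<in>?I. if i = j then \<Phi> (X i j) else 0)"
    unfolding tmap_def plain_tr_sum plain_tr_Eu
    by (intro sum.cong refl) (auto dest: multi_idx_eqI)
  then show ?thesis using fin unfolding full_trace_def by (simp add: \<Phi>_sum)
qed

lemma tmap_C_prod:
  assumes "k \<le> n"
  shows "tmap n (lift_tensor (tensor_prod_list {1..n} (map (\<lambda>a. place1 {1..n} a (C_matrix \<Psi>)) [1..<k + 1]))) = C_prod k"
proof -
  have C: "tmap n (lift_tensor (place1 {1..n} a (C_matrix \<Psi>))) = C_at a" if "1 \<le> a" "a \<le> n" for a
  proof -
    have "lift_tensor (place1 {1..n} a (C_matrix \<Psi>)) = place1 {1..n} a (\<chi> x y. (fa_const (C_matrix \<Psi> $ x $ y) :: 'g free_alg))"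
      unfolding lift_tensor_def place1_def by (intro ext) (simp add: fa_const_0)
    then have "tmap n (lift_tensor (place1 {1..n} a (C_matrix \<Psi>))) = at1 a (\<chi> x y. fa_const (C_matrix \<Psi> $ x $ y))"
      using tmap_place1[OF that] by simp
    also have "\<dots> = C_at a"
      unfolding at1_def C_at_def emb_def C_def C_matrix_def by (simp add: \<Phi>_const sc_simps)
    finally show ?thesis .
  qed
  have "prod_list (map C_at [1..<k + 1]) = C_prod k"
    by (induction k) (simp_all flip: Suc_eq_plus1)
  moreover have "map (\<lambda>a. tmap n (lift_tensor (place1 {1..n} a (C_matrix \<Psi>)))) [1..<k + 1] = map C_at [1..<k + 1]"
    using assms by (intro map_cong refl C) auto
  ultimately show ?thesis
    unfolding lift_tensor_prod_list tmap_prod_list by (simp only: map_map o_def)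
qed

lemma \<Phi>_R_trace: "\<Phi> (R_trace n \<Psi> X) = tr n (tmap n X)"
  unfolding R_trace_def Let_def plain_tr_tmap[symmetric] tmap_mult tmap_C_prod[OF order_refl] tr_plain_tr ..

end

section \<open>Rational functions\<close>

text \<open>
  The second argument of \<open>rat_deriv P\<close> is the derivative of the first one away from the finite
  set \<open>P\<close> of poles (at the poles both take junk values, because \<open>1 / 0 = 0\<close>).
\<close>

inductive rat_deriv :: "complex set \<Rightarrow> (complex \<Rightarrow> complex) \<Rightarrow> (complex \<Rightarrow> complex) \<Rightarrow> bool"
  for P
  where
    rat_const: "rat_deriv P (\<lambda>z. c) (\<lambda>z. 0)"
  | rat_pole: "a \<in> P \<Longrightarrow> rat_deriv P (\<lambda>z. 1 / (z - a)) (\<lambda>z. - 1 * (1 / (z - a) * (1 / (z - a))))"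
  | rat_add: "rat_deriv P f f' \<Longrightarrow> rat_deriv P g g' \<Longrightarrow> rat_deriv P (\<lambda>z. f z + g z) (\<lambda>z. f' z + g' z)"
  | rat_mult: "rat_deriv P f f' \<Longrightarrow> rat_deriv P g g'
      \<Longrightarrow> rat_deriv P (\<lambda>z. f z * g z) (\<lambda>z. f' z * g z + f z * g' z)"

text \<open>The class of remainder terms. It is closed under the shift of \<open>z\<close> by
  \<open>h\<close>, and for fixed \<open>z\<close> off \<open>P\<close> its members are continuous
  at \<open>h = 0\<close>, because the poles \<open>a + j h\<close> tend to
  \<open>a\<close>.\<close>

inductive_set rat2 :: "complex set \<Rightarrow> (complex \<times> complex \<Rightarrow> complex) set" for P
  where
    rat2_const: "(\<lambda>t. c) \<in> rat2 P"
  | rat2_h: "snd \<in> rat2 P"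
  | rat2_pole: "a \<in> P \<Longrightarrow> (\<lambda>(z, h). 1 / (z - of_nat j * h - a)) \<in> rat2 P"
  | rat2_add: "f \<in> rat2 P \<Longrightarrow> g \<in> rat2 P \<Longrightarrow> (\<lambda>t. f t + g t) \<in> rat2 P"
  | rat2_mult: "f \<in> rat2 P \<Longrightarrow> g \<in> rat2 P \<Longrightarrow> (\<lambda>t. f t * g t) \<in> rat2 P"

text \<open>The convention \<open>1 / 0 = 0\<close> destroys the identities at poles, so each of
  them is claimed only when finitely many shifted arguments stay off \<open>P\<close>. For finite
  \<open>P\<close> and \<open>z\<close> off \<open>P\<close> this holds for all small
  \<open>h\<close>.\<close>

definition avoids :: "complex set \<Rightarrow> nat \<Rightarrow> complex \<Rightarrow> complex \<Rightarrow> bool"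
  where "avoids P n z h \<longleftrightarrow> (\<forall>l\<le>n. z - of_nat l * h \<notin> P)"

lemma avoidsD: "avoids P n z h \<Longrightarrow> l \<le> n \<Longrightarrow> z - of_nat l * h \<notin> P"
  unfolding avoids_def by blast

lemma avoids_0: "avoids P n z h \<Longrightarrow> z \<notin> P"
  using avoidsD[of P n z h 0] by simp

lemma avoids_1: "avoids P (Suc n) z h \<Longrightarrow> z - h \<notin> P"
  using avoidsD[of P "Suc n" z h 1] by simp

lemma avoids_mono: "avoids P n z h \<Longrightarrow> m \<le> n \<Longrightarrow> avoids P m z h"
  unfolding avoids_def by auto

lemma avoids_shift: "avoids P (Suc n) z h \<Longrightarrow> avoids P n (z - h) h"
  unfolding avoids_def
proof (intro allI impI)
  fix l assume *: "\<forall>l\<le>Suc n. z - of_nat l * h \<notin> P" "l \<le> n"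
  then have "z - of_nat (Suc l) * h \<notin> P" by blast
  then show "z - h - of_nat l * h \<notin> P" by (simp add: algebra_simps)
qed

lemma rat_deriv_has_derivative:
  "rat_deriv P f f' \<Longrightarrow> z \<notin> P \<Longrightarrow> (f has_field_derivative f' z) (at z)"
proof (induction rule: rat_deriv.induct)
  case (rat_pole a)
  then have "z - a \<noteq> 0" by auto
  then show ?case by (auto intro!: derivative_eq_intros simp: divide_simps)
next
  case (rat_mult f f' g g')
  then have "(f has_field_derivative f' z) (at z)" "(g has_field_derivative g' z) (at z)" by auto
  from DERIV_mult[OF this] show ?case by (simp add: algebra_simps)
qed (auto intro!: derivative_eq_intros)

lemma rat_deriv_deriv: "rat_deriv P f f' \<Longrightarrow> \<exists>f''. rat_deriv P f' f''"
proof (induction rule: rat_deriv.induct)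
  case (rat_const c)
  show ?case by (rule exI, rule rat_deriv.rat_const)
next
  case (rat_pole a)
  note p = rat_deriv.rat_pole[OF rat_pole]
  show ?case by (rule exI, rule rat_deriv.rat_mult[OF rat_deriv.rat_const rat_deriv.rat_mult[OF p p]])
next
  case (rat_add f f' g g')
  then obtain f'' g'' where "rat_deriv P f' f''" "rat_deriv P g' g''" by blast
  then show ?case by (intro exI, rule rat_deriv.rat_add)
next
  case (rat_mult f f' g g')
  then obtain f'' g'' where "rat_deriv P f' f''" "rat_deriv P g' g''" by blast
  then show ?case using rat_mult by (intro exI, rule_tac rat_deriv.rat_add; rule_tac rat_deriv.rat_mult)
qed

lemma rat_deriv_rat2: "rat_deriv P f f' \<Longrightarrow> (\<lambda>t. f (fst t)) \<in> rat2 P"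
proof (induction rule: rat_deriv.induct)
  case (rat_pole a)
  then show ?case using rat2_pole[of a P 0] by (simp add: case_prod_beta')
qed (auto intro: rat2.intros)

lemma rat2_shift: "f \<in> rat2 P \<Longrightarrow> (\<lambda>t. f (fst t - snd t, snd t)) \<in> rat2 P"
proof (induction rule: rat2.induct)
  case (rat2_pole a j)
  have "(\<lambda>(z, h). 1 / (z - of_nat (Suc j) * h - a)) \<in> rat2 P"
    by (intro rat2.rat2_pole rat2_pole)
  moreover have "(\<lambda>(z, h). 1 / (z - of_nat (Suc j) * h - a))
      = (\<lambda>t. (\<lambda>(z, h). 1 / (z - of_nat j * h - a)) (fst t - snd t, snd t))"
    by (auto simp: fun_eq_iff algebra_simps)
  ultimately show ?case by simp
qed (auto intro: rat2.intros)

text \<open>A discrete Leibniz rule reduces this to a single pole, where the quotient is a product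
  of two poles; \<open>n\<close> records how many shifts have to avoid \<open>P\<close>.\<close>

lemma rat2_difference:
  "f \<in> rat2 P \<Longrightarrow> \<exists>q\<in>rat2 P. \<exists>n. \<forall>z h. avoids P n z h \<longrightarrow> f (z - h, h) - f (z, h) = h * q (z, h)"
proof (induction rule: rat2.induct)
  case (rat2_pole a j)
  let ?q = "\<lambda>t. (\<lambda>(z, h). 1 / (z - of_nat j * h - a)) t * (\<lambda>(z, h). 1 / (z - of_nat (Suc j) * h - a)) t"
  have A: "?q \<in> rat2 P" by (intro rat2.intros rat2_pole)
  have B: "1 / (z - h - of_nat j * h - a) - 1 / (z - of_nat j * h - a) = h * ?q (z, h)"
    if "avoids P (Suc j) z h" for z h
  proof -
    have "z - of_nat j * h - a \<noteq> 0" "z - of_nat (Suc j) * h - a \<noteq> 0"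
      using avoidsD[OF that, of j] avoidsD[OF that, of "Suc j"] rat2_pole by auto
    moreover have "1 / (y - h) - 1 / y = h * (1 / y * (1 / (y - h)))" if "y \<noteq> 0" "y - h \<noteq> 0" for y
      using that by (simp add: divide_simps)
    moreover have "z - h - of_nat j * h - a = z - of_nat j * h - a - h"
        "z - of_nat (Suc j) * h - a = z - of_nat j * h - a - h"
      by (simp_all add: algebra_simps)
    ultimately show ?thesis by (simp only: prod.case)
  qed
  show ?case unfolding prod.case by (intro bexI[OF _ A] exI[of _ "Suc j"] allI impI) (rule B)
next
  case (rat2_add f g)
  then obtain q1 n1 q2 n2 where *: "q1 \<in> rat2 P" "\<And>z h. avoids P n1 z h \<Longrightarrow> f (z - h, h) - f (z, h) = h * q1 (z, h)"
    "q2 \<in> rat2 P" "\<And>z h. avoids P n2 z h \<Longrightarrow> g (z - h, h) - g (z, h) = h * q2 (z, h)" by metis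
  have B: "f (z - h, h) + g (z - h, h) - (f (z, h) + g (z, h)) = h * (q1 (z, h) + q2 (z, h))"
    if "avoids P (max n1 n2) z h" for z h
    using *(2,4)[OF avoids_mono[OF that]] by (simp add: algebra_simps)
  show ?case
    by (intro bexI[OF _ rat2.rat2_add[OF *(1,3)]] exI[of _ "max n1 n2"] allI impI) (rule B)
next
  case (rat2_mult f g)
  then obtain q1 n1 q2 n2 where *: "q1 \<in> rat2 P" "\<And>z h. avoids P n1 z h \<Longrightarrow> f (z - h, h) - f (z, h) = h * q1 (z, h)"
    "q2 \<in> rat2 P" "\<And>z h. avoids P n2 z h \<Longrightarrow> g (z - h, h) - g (z, h) = h * q2 (z, h)" by metis
  have A: "(\<lambda>t. q1 t * g (fst t - snd t, snd t) + f t * q2 t) \<in> rat2 P"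
    using * rat2_mult by (intro rat2.intros rat2_shift) auto
  have B: "f (z - h, h) * g (z - h, h) - f (z, h) * g (z, h)
      = h * (q1 (z, h) * g (z - h, h) + f (z, h) * q2 (z, h))"
    if "avoids P (max n1 n2) z h" for z h
  proof -
    have e: "f (z - h, h) = f (z, h) + h * q1 (z, h)" "g (z - h, h) = g (z, h) + h * q2 (z, h)"
      using *(2,4)[OF avoids_mono[OF that]] by (simp_all add: algebra_simps)
    show ?thesis unfolding e by (simp add: algebra_simps)
  qed
  show ?case
    by (intro bexI[OF _ A] exI[of _ "max n1 n2"] allI impI) (simp only: B fst_conv snd_conv)
next
  case (rat2_const c)
  then show ?case using rat2.rat2_const[of 0] by fastforce
next
  case rat2_h
  then show ?case using rat2.rat2_const[of 0] by fastforce
qed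

text \<open>An exact second-order formula instead of an estimate: its remainder belongs to
  \<open>rat2\<close> again, so it can be shifted and multiplied in the later induction.\<close>

lemma rat_deriv_taylor:
  "rat_deriv P f f' \<Longrightarrow>
    \<exists>q\<in>rat2 P. \<forall>z h. z \<notin> P \<longrightarrow> z - h \<notin> P \<longrightarrow> f (z - h) = f z - h * f' z + h ^ 2 * q (z, h)"
proof (induction rule: rat_deriv.induct)
  case (rat_const c)
  then show ?case using rat2.rat2_const[of 0] by fastforce
next
  case (rat_pole a)
  let ?p = "\<lambda>j. (\<lambda>(z, h). 1 / (z - of_nat j * h - a))"
  have A: "(\<lambda>t. ?p 0 t * ?p 0 t * ?p 1 t) \<in> rat2 P" using rat_pole by (intro rat2.intros)
  have B: "1 / (z - h - a) = 1 / (z - a) - h * (- 1 * (1 / (z - a) * (1 / (z - a))))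
      + h ^ 2 * (?p 0 (z, h) * ?p 0 (z, h) * ?p 1 (z, h))" if "z \<notin> P" "z - h \<notin> P" for z h
  proof -
    have "z - a \<noteq> 0" "z - a - h \<noteq> 0" using that rat_pole by (auto simp: algebra_simps)
    moreover have "1 / (y - h) = 1 / y - h * (- 1 * (1 / y * (1 / y))) + h ^ 2 * (1 / y * (1 / y) * (1 / (y - h)))"
      if "y \<noteq> 0" "y - h \<noteq> 0" for y
      using that by (simp add: divide_simps) (simp add: algebra_simps power2_eq_square)
    ultimately have "1 / (z - a - h) = 1 / (z - a) - h * (- 1 * (1 / (z - a) * (1 / (z - a))))
      + h ^ 2 * (1 / (z - a) * (1 / (z - a)) * (1 / (z - a - h)))" by blast
    moreover have m: "z - a - h = z - h - a" by simp
    ultimately show ?thesis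
      unfolding m by (simp only: of_nat_0 of_nat_1 mult_zero_left mult_1_left diff_zero prod.case)
  qed
  show ?case by (rule bexI[OF _ A]) (intro allI impI B)
next
  case (rat_add f f' g g')
  then obtain q1 q2 where *: "q1 \<in> rat2 P" "\<And>z h. z \<notin> P \<Longrightarrow> z - h \<notin> P \<Longrightarrow> f (z - h) = f z - h * f' z + h ^ 2 * q1 (z, h)"
    "q2 \<in> rat2 P" "\<And>z h. z \<notin> P \<Longrightarrow> z - h \<notin> P \<Longrightarrow> g (z - h) = g z - h * g' z + h ^ 2 * q2 (z, h)" by metis
  have B: "f (z - h) + g (z - h) = f z + g z - h * (f' z + g' z) + h ^ 2 * (q1 (z, h) + q2 (z, h))"
    if "z \<notin> P" "z - h \<notin> P" for z h
    using *(2,4)[OF that] by (simp add: algebra_simps)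
  show ?case by (rule bexI[OF _ rat2.rat2_add[OF *(1,3)]]) (intro allI impI B)
next
  case (rat_mult f f' g g')
  then obtain q1 q2 where *: "q1 \<in> rat2 P" "\<And>z h. z \<notin> P \<Longrightarrow> z - h \<notin> P \<Longrightarrow> f (z - h) = f z - h * f' z + h ^ 2 * q1 (z, h)"
    "q2 \<in> rat2 P" "\<And>z h. z \<notin> P \<Longrightarrow> z - h \<notin> P \<Longrightarrow> g (z - h) = g z - h * g' z + h ^ 2 * q2 (z, h)" by metis
  obtain f'' g'' where d: "rat_deriv P f' f''" "rat_deriv P g' g''"
    using rat_mult rat_deriv_deriv by metis
  note r = rat_deriv_rat2[OF rat_mult(1)] rat_deriv_rat2[OF rat_mult(2)]
    rat_deriv_rat2[OF d(1)] rat_deriv_rat2[OF d(2)]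
  \<comment> \<open>Only the second of the two expansions is substituted completely; next to
    \<open>q1\<close> the factor \<open>g (z - h)\<close> stays, as it is already in the
    class.\<close>
  let ?q = "\<lambda>t. f' (fst t) * g' (fst t) + q1 t * (g (fst t - snd t)) + (f (fst t) + - 1 * (snd t * f' (fst t))) * q2 t"
  have A: "?q \<in> rat2 P"
    using rat2_shift[OF r(2)] r * by (intro rat2.intros) simp_all
  have B: "f (z - h) * g (z - h) = f z * g z - h * (f' z * g z + f z * g' z) + h ^ 2 * ?q (z, h)"
    if "z \<notin> P" "z - h \<notin> P" for z h
  proof -
    have "f (z - h) * g (z - h) = (f z - h * f' z) * g (z - h) + h ^ 2 * q1 (z, h) * g (z - h)"
      unfolding *(2)[OF that] by (simp add: algebra_simps)
    also have "(f z - h * f' z) * g (z - h) = (f z - h * f' z) * (g z - h * g' z + h ^ 2 * q2 (z, h))"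
      using *(4)[OF that] by simp
    finally show ?thesis by (simp add: algebra_simps power2_eq_square)
  qed
  show ?case by (rule bexI[OF _ A]) (intro allI impI B)
qed

text \<open>The slope \<open>b\<close> will be 0 for the first argument of the commutator and 1/2
  for the second.\<close>

lemma rat2_isCont: "f \<in> rat2 P \<Longrightarrow> z \<notin> P \<Longrightarrow> isCont (\<lambda>h. f (z + b * h, h)) 0"
proof (induction rule: rat2.induct)
  case (rat2_pole a j)
  then have "z - a \<noteq> 0" by auto
  then show ?case by (auto intro!: continuous_intros)
qed (auto intro!: continuous_intros)

subsection \<open>Rational functions with values in an algebra\<close>

context c_algebra
begin

text \<open>Finite sums of scalar functions times fixed vectors. They make analysis with values in
  \<open>'e\<close> possible through the scalar coefficients alone, without a topology on
  \<open>'e\<close>.\<close>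

inductive_set lspan :: "('t \<Rightarrow> complex) set \<Rightarrow> ('t \<Rightarrow> 'e) set" for \<F>
  where
    lspan_base: "\<phi> \<in> \<F> \<Longrightarrow> (\<lambda>t. \<phi> t \<odot> x) \<in> lspan \<F>"
  | lspan_add: "f \<in> lspan \<F> \<Longrightarrow> g \<in> lspan \<F> \<Longrightarrow> (\<lambda>t. f t + g t) \<in> lspan \<F>"

lemma lspan_mult:
  assumes "\<And>\<phi> \<psi>. \<phi> \<in> \<F> \<Longrightarrow> \<psi> \<in> \<F> \<Longrightarrow> (\<lambda>t. \<phi> t * \<psi> t) \<in> \<F>" and f: "f \<in> lspan \<F>" and g: "g \<in> lspan \<F>"
  shows "(\<lambda>t. f t * g t) \<in> lspan \<F>"
  using f
proof (induction rule: lspan.induct)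
  case (lspan_base \<phi> x)
  from g show ?case
  proof (induction rule: lspan.induct)
    case (lspan_base \<psi> y)
    then show ?case
      using lspan.lspan_base[OF assms(1)[OF \<open>\<phi> \<in> \<F>\<close> lspan_base], of "x * y"]
      by (simp add: sc_simps mult.commute)
  qed (auto simp: distrib_left intro: lspan.lspan_add)
qed (auto simp: distrib_right intro: lspan.lspan_add)

lemma lspan_map:
  assumes "\<And>x y. L (x + y) = L x + L y" "\<And>c x. L (c \<odot> x) = c \<odot> L x" "f \<in> lspan \<F>"
  shows "(\<lambda>t. L (f t)) \<in> lspan \<F>"
  using assms(3) by (induction rule: lspan.induct) (auto simp: assms(1,2) intro: lspan.intros)

abbreviation crat2 :: "complex set \<Rightarrow> (complex \<times> complex \<Rightarrow> 'e) set"
  where "crat2 P \<equiv> lspan (rat2 P)"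

lemma crat2_mult: "f \<in> crat2 P \<Longrightarrow> g \<in> crat2 P \<Longrightarrow> (\<lambda>t. f t * g t) \<in> crat2 P"
  by (rule lspan_mult) (auto intro: rat2.intros)

lemma crat2_const: "(\<lambda>t. x) \<in> crat2 P"
  using lspan_base[OF rat2_const[of 1 P], of x] by simp

lemma crat2_scale: "\<phi> \<in> rat2 P \<Longrightarrow> f \<in> crat2 P \<Longrightarrow> (\<lambda>t. \<phi> t \<odot> f t) \<in> crat2 P"
  using crat2_mult[OF lspan_base[of \<phi> "rat2 P" 1], of f] by (simp add: sc_simps)

lemma crat2_minus: "f \<in> crat2 P \<Longrightarrow> (\<lambda>t. - f t) \<in> crat2 P"
  using crat2_scale[OF rat2_const[of "- 1"]] by simp

lemma crat2_shift: "f \<in> crat2 P \<Longrightarrow> (\<lambda>t. f (fst t - snd t, snd t)) \<in> crat2 P"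
proof (induction rule: lspan.induct)
  case (lspan_base \<phi> x)
  then show ?case using lspan.lspan_base[OF rat2_shift] by auto
qed (auto intro: lspan.intros)

lemma crat2_difference:
  "f \<in> crat2 P \<Longrightarrow> \<exists>q\<in>crat2 P. \<exists>n. \<forall>z h. avoids P n z h \<longrightarrow> f (z - h, h) = f (z, h) + h \<odot> q (z, h)"
proof (induction rule: lspan.induct)
  case (lspan_base \<phi> x)
  then obtain q n where q: "q \<in> rat2 P" "\<And>z h. avoids P n z h \<Longrightarrow> \<phi> (z - h, h) - \<phi> (z, h) = h * q (z, h)"
    using rat2_difference by metis
  have "\<phi> (z - h, h) \<odot> x = \<phi> (z, h) \<odot> x + h \<odot> (q (z, h) \<odot> x)" if "avoids P n z h" for z h
  proof -
    have "\<phi> (z - h, h) = \<phi> (z, h) + h * q (z, h)" using q(2)[OF that] by (simp add: algebra_simps)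
    then show ?thesis by (simp add: scale_left_distrib)
  qed
  then show ?case using lspan.lspan_base[OF q(1), of x] by (intro bexI[of _ "\<lambda>t. q t \<odot> x"] exI[of _ n]) auto
next
  case (lspan_add f g)
  then obtain q1 n1 q2 n2 where *: "q1 \<in> crat2 P" "\<And>z h. avoids P n1 z h \<Longrightarrow> f (z - h, h) = f (z, h) + h \<odot> q1 (z, h)"
    "q2 \<in> crat2 P" "\<And>z h. avoids P n2 z h \<Longrightarrow> g (z - h, h) = g (z, h) + h \<odot> q2 (z, h)" by metis
  have "f (z - h, h) + g (z - h, h) = f (z, h) + g (z, h) + h \<odot> (q1 (z, h) + q2 (z, h))"
    if "avoids P (max n1 n2) z h" for z h
    using *(2,4)[OF avoids_mono[OF that]] by (simp add: scale_right_distrib algebra_simps)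
  then show ?case
    using lspan.lspan_add[OF *(1,3)] by (intro bexI[of _ "\<lambda>t. q1 t + q2 t"] exI[of _ "max n1 n2"]) auto
qed

section \<open>Algebra-valued derivatives and limits\<close>

text \<open>The last rule forgets the values on \<open>P\<close>, where the coefficientwise
  derivative need not follow any formula.\<close>

inductive cder :: "complex set \<Rightarrow> (complex \<Rightarrow> 'e) \<Rightarrow> (complex \<Rightarrow> 'e) \<Rightarrow> bool" for P
  where
    cder_base: "rat_deriv P \<phi> \<phi>' \<Longrightarrow> cder P (\<lambda>z. \<phi> z \<odot> x) (\<lambda>z. \<phi>' z \<odot> x)"
  | cder_add: "cder P f f' \<Longrightarrow> cder P g g' \<Longrightarrow> cder P (\<lambda>z. f z + g z) (\<lambda>z. f' z + g' z)"
  | cder_cong: "cder P f f' \<Longrightarrow> (\<And>z. z \<notin> P \<Longrightarrow> f z = g z \<and> f' z = g' z) \<Longrightarrow> cder P g g'"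

lemma cder_const: "cder P (\<lambda>z. x) (\<lambda>z. 0)"
  using cder_base[OF rat_const[of P 1], of x] by simp

lemma cder_sum:
  "(\<And>i. i \<in> I \<Longrightarrow> cder P (f i) (f' i)) \<Longrightarrow> cder P (\<lambda>z. \<Sum>i\<in>I. f i z) (\<lambda>z. \<Sum>i\<in>I. f' i z)"
  by (induction I rule: infinite_finite_induct) (auto intro: cder_const cder_add)

lemma cder_mult:
  assumes f: "cder P f f'" and g: "cder P g g'"
  shows "\<exists>k. cder P (\<lambda>z. f z * g z) k"
  using f
proof (induction rule: cder.induct)
  case (cder_base \<phi> \<phi>' x)
  from g show ?case
  proof (induction rule: cder.induct)
    case (cder_base \<psi> \<psi>' y)
    then show ?case
      using cder.cder_base[OF rat_mult[OF \<open>rat_deriv P \<phi> \<phi>'\<close> cder_base], of "x * y"]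
      by (auto simp: sc_simps mult.commute)
  next
    case (cder_add f f' g g')
    then show ?case by (auto simp: distrib_left dest: cder.cder_add)
  next
    case (cder_cong f f' g g')
    then obtain k where "cder P (\<lambda>z. \<phi> z \<odot> x * f z) k" by blast
    then have "cder P (\<lambda>z. \<phi> z \<odot> x * g z) k" by (rule cder.cder_cong) (simp add: cder_cong)
    then show ?case by blast
  qed
next
  case (cder_add f f' g g')
  then show ?case by (auto simp: distrib_right dest: cder.cder_add)
next
  case (cder_cong f f' g' g'')
  then obtain k where "cder P (\<lambda>z. f z * g z) k" by blast
  then have "cder P (\<lambda>z. g' z * g z) k" by (rule cder.cder_cong) (simp add: cder_cong)
  then show ?case by blast
qed

lemma cder_deriv: "cder P f f' \<Longrightarrow> \<exists>f''. cder P f' f''"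
proof (induction rule: cder.induct)
  case (cder_base \<phi> \<phi>' x)
  then obtain \<phi>'' where "rat_deriv P \<phi>' \<phi>''" using rat_deriv_deriv by blast
  then show ?case using cder.cder_base by blast
next
  case (cder_add f f' g g')
  then show ?case using cder.cder_add by blast
next
  case (cder_cong f f' g g')
  then obtain f'' where "cder P f' f''" by blast
  then have "cder P g' f''" by (rule cder.cder_cong) (simp add: cder_cong)
  then show ?case by blast
qed

lemma cder_crat2: "cder P f f' \<Longrightarrow> \<exists>g\<in>crat2 P. \<forall>z h. z \<notin> P \<longrightarrow> f z = g (z, h)"
proof (induction rule: cder.induct)
  case (cder_base \<phi> \<phi>' x)
  then show ?case
    using lspan_base[OF rat_deriv_rat2[OF cder_base], of x] by (intro bexI[of _ "\<lambda>t. \<phi> (fst t) \<odot> x"]) auto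
next
  case (cder_add f f' g g')
  then obtain a b where "a \<in> crat2 P" "b \<in> crat2 P" "\<forall>z h. z \<notin> P \<longrightarrow> f z = a (z, h)" "\<forall>z h. z \<notin> P \<longrightarrow> g z = b (z, h)"
    by blast
  then show ?case using lspan_add[of a "rat2 P" b] by (intro bexI[of _ "\<lambda>t. a t + b t"]) auto
next
  case (cder_cong f f' g g')
  then show ?case by metis
qed

lemma cder_taylor:
  "cder P f f' \<Longrightarrow>
    \<exists>q\<in>crat2 P. \<forall>z h. z \<notin> P \<longrightarrow> z - h \<notin> P \<longrightarrow> f (z - h) = f z - h \<odot> f' z + h ^ 2 \<odot> q (z, h)"
proof (induction rule: cder.induct)
  case (cder_base \<phi> \<phi>' x)
  then obtain q where q: "q \<in> rat2 P"
      "\<And>z h. z \<notin> P \<Longrightarrow> z - h \<notin> P \<Longrightarrow> \<phi> (z - h) = \<phi> z - h * \<phi>' z + h ^ 2 * q (z, h)"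
    using rat_deriv_taylor by metis
  then show ?case using lspan_base[OF q(1), of x]
    by (intro bexI[of _ "\<lambda>t. q t \<odot> x"]) (auto simp: scale_left_distrib scale_left_diff_distrib)
next
  case (cder_add f f' g g')
  then obtain a b where *: "a \<in> crat2 P" "b \<in> crat2 P"
      "\<And>z h. z \<notin> P \<Longrightarrow> z - h \<notin> P \<Longrightarrow> f (z - h) = f z - h \<odot> f' z + h ^ 2 \<odot> a (z, h)"
      "\<And>z h. z \<notin> P \<Longrightarrow> z - h \<notin> P \<Longrightarrow> g (z - h) = g z - h \<odot> g' z + h ^ 2 \<odot> b (z, h)"
    by metis
  then show ?case using lspan_add[OF *(1,2)]
    by (intro bexI[of _ "\<lambda>t. a t + b t"]) (auto simp: scale_right_distrib scale_right_diff_distrib)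
next
  case (cder_cong f f' g g')
  then show ?case by metis
qed

abbreviation tame :: "(complex \<Rightarrow> 'e) set"
  where "tame \<equiv> lspan {\<phi>. isCont \<phi> 0}"

lemma tame_mult: "f \<in> tame \<Longrightarrow> g \<in> tame \<Longrightarrow> (\<lambda>t. f t * g t) \<in> tame"
  by (rule lspan_mult) (auto intro: continuous_intros)

lemma tame_const: "(\<lambda>t. x) \<in> tame"
  using lspan_base[of "\<lambda>t. 1" "{\<phi>. isCont \<phi> 0}" x] by simp

lemma tame_scale: "isCont \<phi> 0 \<Longrightarrow> f \<in> tame \<Longrightarrow> (\<lambda>t. \<phi> t \<odot> f t) \<in> tame"
  using tame_mult[OF lspan_base[of \<phi> "{\<phi>. isCont \<phi> 0}" 1], of f] by (simp add: sc_simps)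

lemma crat2_tame: "f \<in> crat2 P \<Longrightarrow> z \<notin> P \<Longrightarrow> (\<lambda>h. f (z + b * h, h)) \<in> tame"
proof (induction rule: lspan.induct)
  case (lspan_base \<phi> x)
  have "(\<lambda>h. (\<lambda>h. \<phi> (z + b * h, h)) h \<odot> x) \<in> tame"
    using rat2_isCont lspan_base by (intro lspan.lspan_base) auto
  then show ?case by simp
qed (auto intro: lspan.intros)

lemma eventually_avoid:
  assumes "finite P" "z \<notin> P"
  shows "\<forall>\<^sub>F h in at 0. z + b * h \<notin> (P :: complex set)"
proof -
  have "((\<lambda>h. z + b * h) \<longlongrightarrow> z + b * 0) (at 0)" by (intro tendsto_intros)
  moreover have "open (- P)" using assms(1) finite_imp_closed by blast
  ultimately show ?thesis using assms(2) topological_tendstoD[of _ "z + b * 0" _ "- P"] by auto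
qed

lemma cder_tame:
  assumes "cder P f f'" "z \<notin> P" "finite P"
  shows "\<exists>s\<in>tame. \<forall>\<^sub>F h in at 0. f (z + b * h) = f z + h \<odot> s h"
  using assms(1)
proof (induction rule: cder.induct)
  case (cder_base \<phi> \<phi>' x)
  \<comment> \<open>The difference quotient along the line of slope \<open>b\<close>, continued to
    \<open>h = 0\<close> by its limit.\<close>
  define s where "s h = (if h = 0 then b * \<phi>' z else (\<phi> (z + b * h) - \<phi> z) / h)" for h
  have "((\<lambda>h. \<phi> (z + b * h)) has_field_derivative \<phi>' (z + b * 0) * b) (at 0)"
    using rat_deriv_has_derivative[OF cder_base] assms(2)
    by (intro DERIV_chain2[where f = \<phi>]) (auto intro!: derivative_eq_intros)
  then have "(\<lambda>h. (\<phi> (z + b * h) - \<phi> z) / h) \<midarrow>0\<rightarrow> b * \<phi>' z"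
    by (simp add: DERIV_def mult.commute)
  moreover have "s \<midarrow>0\<rightarrow> L \<longleftrightarrow> (\<lambda>h. (\<phi> (z + b * h) - \<phi> z) / h) \<midarrow>0\<rightarrow> L" for L
    by (rule filterlim_cong) (auto simp: s_def eventually_at_filter)
  ultimately have "isCont s 0" by (simp add: isCont_def s_def)
  moreover have "\<phi> (z + b * h) \<odot> x = \<phi> z \<odot> x + h \<odot> (s h \<odot> x)" for h
  proof -
    have "\<phi> (z + b * h) = \<phi> z + h * s h" unfolding s_def by simp
    then show ?thesis by (simp add: scale_left_distrib)
  qed
  ultimately show ?case by (intro bexI[of _ "\<lambda>h. s h \<odot> x"] lspan_base) auto
next
  case (cder_add f f' g g')
  then obtain s1 s2 where *: "s1 \<in> tame" "s2 \<in> tame" "\<forall>\<^sub>F h in at 0. f (z + b * h) = f z + h \<odot> s1 h"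
      "\<forall>\<^sub>F h in at 0. g (z + b * h) = g z + h \<odot> s2 h" by blast
  have "\<forall>\<^sub>F h in at 0. f (z + b * h) + g (z + b * h) = f z + g z + h \<odot> (s1 h + s2 h)"
    using *(3,4) by eventually_elim (simp add: scale_right_distrib)
  then show ?case using lspan_add[OF *(1,2)] by (intro bexI[of _ "\<lambda>h. s1 h + s2 h"])
next
  case (cder_cong f f' g g')
  then obtain s where *: "s \<in> tame" "\<forall>\<^sub>F h in at 0. f (z + b * h) = f z + h \<odot> s h" by blast
  have "\<forall>\<^sub>F h in at 0. g (z + b * h) = g z + h \<odot> s h"
    using *(2) eventually_avoid[OF assms(3,2), of b] by eventually_elim (use cder_cong assms(2) in metis)
  then show ?case using *(1) by blast
qed

lemma separating_functional:
  assumes "x \<noteq> 0"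
  shows "\<exists>lf :: 'e \<Rightarrow> complex. (\<forall>x y. lf (x + y) = lf x + lf y) \<and> (\<forall>c x. lf (c \<odot> x) = c * lf x) \<and> lf x \<noteq> 0"
proof -
  interpret vs: vector_space_pair sc "(*) :: complex \<Rightarrow> complex \<Rightarrow> complex"
    by unfold_locales (simp_all add: algebra_simps)
  have "independent {x}" using assms by simp
  then obtain g where "Vector_Spaces.linear sc (*) g" "\<forall>y\<in>{x}. g y = (1 :: complex)"
    using vs.linear_independent_extend[of "{x}" "\<lambda>_. 1"] by blast
  then show ?thesis
    by (intro exI[of _ g]) (auto simp: Vector_Spaces.linear_iff)
qed

text \<open>The substitute for letting \<open>h\<close> tend to 0: if \<open>x\<close> were nonzero,
  a functional with nonzero value at \<open>x\<close> would turn the assumption into a scalar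
  identity that contradicts continuity.\<close>

lemma tame_limit:
  assumes "s \<in> tame" "\<forall>\<^sub>F h in at 0. x + h \<odot> s h = 0"
  shows "x = 0"
proof (rule ccontr)
  assume "x \<noteq> 0"
  then obtain lf :: "'e \<Rightarrow> complex" where l: "\<And>x y. lf (x + y) = lf x + lf y"
    "\<And>c x. lf (c \<odot> x) = c * lf x" "lf x \<noteq> 0" using separating_functional by metis
  have "isCont (\<lambda>h. lf (s h)) 0"
    using assms(1) by (induction rule: lspan.induct) (auto simp: l intro!: continuous_intros)
  then have "((\<lambda>h. lf x + h * lf (s h)) \<longlongrightarrow> lf x + 0 * lf (s 0)) (at 0)"
    by (intro tendsto_intros) (simp add: isCont_def)
  moreover have "\<forall>\<^sub>F h in at 0. lf x + h * lf (s h) = 0"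
    using assms(2) by eventually_elim (metis l(1,2) scale_zero_left mult_zero_left)
  then have "((\<lambda>h. lf x + h * lf (s h)) \<longlongrightarrow> 0) (at 0)"
    by (rule tendsto_eventually)
  ultimately have "lf x + 0 * lf (s 0) = 0"
    by (rule tendsto_unique[rotated]) simp
  then have "lf x = 0" by simp
  then show False using l(3) by simp
qed

end

subsection \<open>The free algebra\<close>

lemma lookup_fa_const_mult: "Poly_Mapping.lookup (fa_const c * x) w = c * Poly_Mapping.lookup x w"
  unfolding fa_const_def
  by (simp add: lookup_mult lookup_single when_mult)

lemma fa_const_comm: "fa_const c * x = x * (fa_const c :: 'g free_alg)"
proof (rule poly_mapping_eqI)
  fix w
  have "(\<Sum>q. c when q = 0 when w = l + q) = (c when w = l)" for l :: "'g fword"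
    using Sum_any_when_equal[of "\<lambda>q. c when w = l + q" 0] by (simp add: when_commute)
  then have "Poly_Mapping.lookup (x * fa_const c) w = Poly_Mapping.lookup x w * c"
    unfolding fa_const_def by (simp add: lookup_mult lookup_single mult_when)
  then show "Poly_Mapping.lookup (fa_const c * x) w = Poly_Mapping.lookup (x * fa_const c) w"
    unfolding lookup_fa_const_mult by simp
qed

interpretation fa: c_algebra "\<lambda>c (x :: 'g free_alg). fa_const c * x"
proof
  fix c :: complex and x y :: "'g free_alg"
  show "x * (fa_const c * y) = fa_const c * (x * y)"
    by (metis fa_const_comm mult.assoc)
qed (simp_all add: distrib_left distrib_right fa_const_add fa_const_mult fa_const_1 mult.assoc)

context c_algebra
begin

text \<open>The derivative is left open, which makes the closure properties easy to chain;
  \<open>cder_fa_deriv\<close> identifies it with \<open>fa_deriv\<close> afterwards.\<close>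

definition rational :: "complex set \<Rightarrow> (complex \<Rightarrow> 'e) \<Rightarrow> bool"
  where "rational P f \<longleftrightarrow> (\<exists>g. cder P f g)"

lemma rational_const: "rational P (\<lambda>z. x)"
  unfolding rational_def using cder_const by blast

lemma rational_pole: "a \<in> P \<Longrightarrow> rational P (\<lambda>z. (1 / (z - a)) \<odot> x)"
  unfolding rational_def using cder_base[OF rat_pole] by blast

lemma rational_add: "rational P f \<Longrightarrow> rational P g \<Longrightarrow> rational P (\<lambda>z. f z + g z)"
  unfolding rational_def using cder_add by blast

lemma rational_mult: "rational P f \<Longrightarrow> rational P g \<Longrightarrow> rational P (\<lambda>z. f z * g z)"
  unfolding rational_def using cder_mult by blast

lemma rational_diff: "rational P f \<Longrightarrow> rational P g \<Longrightarrow> rational P (\<lambda>z. f z - g z)"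
  using rational_add[of P f "\<lambda>z. (- 1) * g z"] rational_mult[OF rational_const[of P "- 1"], of g] by simp

lemma rational_sum: "(\<And>i. i \<in> I \<Longrightarrow> rational P (f i)) \<Longrightarrow> rational P (\<lambda>z. \<Sum>i\<in>I. f i z)"
  by (induction I rule: infinite_finite_induct) (auto intro: rational_const rational_add)

end

lemma cder_has_derivative:
  assumes "fa.cder P f f'" "finite P" "z \<notin> P"
  shows "((\<lambda>x. Poly_Mapping.lookup (f x) w) has_field_derivative Poly_Mapping.lookup (f' z) w) (at z)"
  using assms(1)
proof (induction rule: fa.cder.induct)
  case (cder_base \<phi> \<phi>' x)
  then show ?case
    unfolding lookup_fa_const_mult
    using rat_deriv_has_derivative[OF cder_base assms(3)] by (auto intro: DERIV_cmult_right)
next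
  case (cder_add f f' g g')
  show ?case unfolding lookup_add by (rule DERIV_add[OF cder_add.IH])
next
  case (cder_cong f f' g g')
  have "((\<lambda>x. Poly_Mapping.lookup (g x) w) has_field_derivative Poly_Mapping.lookup (f' z) w) (at z)"
    using cder_cong.IH
  proof (rule has_field_derivative_transform_within_open)
    show "open (- P)" using assms(2) finite_imp_closed by blast
  qed (use cder_cong assms(3) in auto)
  then show ?case using cder_cong assms(3) by simp
qed

text \<open>Coefficientwise the derivative is the lookup function of \<open>f' z\<close>, so it has
  finite support and the abstraction function may be cancelled.\<close>

lemma fa_deriv_cder:
  assumes "fa.cder P f f'" "finite P" "z \<notin> P"
  shows "fa_deriv f z = f' z"
  unfolding fa_deriv_def DERIV_imp_deriv[OF cder_has_derivative[OF assms]] by (rule lookup_inverse)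

lemma cder_fa_deriv:
  assumes "fa.rational P f" "finite P"
  shows "fa.cder P f (fa_deriv f)"
proof -
  obtain f' where f': "fa.cder P f f'" using assms(1) unfolding fa.rational_def by blast
  show ?thesis
    using f' by (rule fa.cder_cong) (simp add: fa_deriv_cder[OF f' assms(2)])
qed

lemma rational_fa_deriv:
  assumes "fa.rational P f" "finite P"
  shows "fa.rational P (fa_deriv f)"
  using fa.cder_deriv[OF cder_fa_deriv[OF assms]] unfolding fa.rational_def .

lemma rational_tensor_mult:
  assumes "\<And>i j. fa.rational P (\<lambda>z. X z i j)" "\<And>i j. fa.rational P (\<lambda>z. Y z i j)"
  shows "fa.rational P (\<lambda>z. tensor_mult S (X z) (Y z) i j)"
  unfolding tensor_mult_def by (intro fa.rational_sum fa.rational_mult assms)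

lemma rational_place1:
  assumes "\<And>a b. fa.rational P (\<lambda>z. X z $ a $ b)"
  shows "fa.rational P (\<lambda>z. place1 S c (X z) i j)"
proof (cases "\<forall>d\<in>S - {c}. i d = j d")
  case True
  then have "place1 S c (X z) i j = X z $ i c $ j c" for z by (simp add: place1_def)
  then show ?thesis using assms by simp
next
  case False
  then have "place1 S c (X z) i j = 0" for z unfolding place1_def by (intro if_not_P)
  then show ?thesis using fa.rational_const by simp
qed

lemma rational_overlined:
  assumes "\<And>a b. fa.rational P (\<lambda>z. X z $ a $ b)"
  shows "fa.rational P (\<lambda>z. overlined S R (X z) k i j)"
proof (induction k arbitrary: i j rule: induct_nat_012)
  case (ge2 k)
  show ?case
    unfolding overlined.simps Let_def tensor_prod_list_def foldr.simps o_apply id_apply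
    by (intro rational_tensor_mult fa.rational_const ge2)
qed (simp_all only: overlined.simps rational_place1 assms)

lemma rational_L_tilde: "fa.rational (range u) (\<lambda>z. L_tilde u z $ a $ b)"
  unfolding L_tilde_def vec_lambda_beta
  by (intro fa.rational_sum fa.rational_pole) simp

text \<open>Each further operator differentiates the result of the previous ones, so the induction
  needs that the class is closed under \<open>fa_deriv\<close>.\<close>

lemma rational_L_minus_d_prod:
  fixes u :: "'k::finite \<Rightarrow> complex"
  shows "fa.rational (range u) (\<lambda>z. foldr (L_minus_d S R u) js (\<lambda>z. tensor_one S) z i j)"
proof (induction js arbitrary: i j)
  case Nil
  then show ?case by (simp add: fa.rational_const)
next
  case (Cons k js)
  have "fa.rational (range u)
      (fa_deriv (\<lambda>x. foldr (L_minus_d S R u) js (\<lambda>z. tensor_one S) x i j))"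
    by (rule rational_fa_deriv[OF Cons]) simp
  then show ?case
    unfolding foldr.simps o_apply
    by (simp only: L_minus_d_def, intro fa.rational_diff rational_tensor_mult rational_overlined rational_L_tilde Cons)
qed

section \<open>The transfer matrices of the Gaudin model\<close>

locale gaudin = M_rep sc R \<Psi> e \<Phi>
  for sc :: "complex \<Rightarrow> 'e::ring_1 \<Rightarrow> 'e" (infixr "\<odot>" 75)
    and R \<Psi> :: "complex ^ ('n::finite \<times> 'n) ^ ('n \<times> 'n)" and e :: "nat \<Rightarrow> 'n \<Rightarrow> 'n \<Rightarrow> 'e"
    and \<Phi> :: "('k::finite \<times> 'n \<times> 'n) free_alg \<Rightarrow> 'e" +
  fixes u :: "'k \<Rightarrow> complex"
  assumes \<Phi>_relator: "x \<in> M_relators R \<Longrightarrow> \<Phi> x = 0"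
begin

definition M1 :: "'k \<Rightarrow> 'e"
  where "M1 k = at1 1 (M_gen k)"

definition M2 :: "'k \<Rightarrow> 'e"
  where "M2 k = r 1 * M1 k * r 1"

lemma tmap_diff: "tmap n (\<lambda>i j. X i j - Y i j) = tmap n X - tmap n Y"
  unfolding tmap_def by (simp add: \<Phi>_diff left_diff_distrib sum_subtractf)

lemma tmap_eq_0:
  assumes "\<And>i j. i \<in> multi_idx {1..n} \<Longrightarrow> j \<in> multi_idx {1..n} \<Longrightarrow> \<Phi> (X i j) = 0"
  shows "tmap n X = 0"
  unfolding tmap_def by (simp add: assms)

lemma tmap_M:
  "tmap 2 (overlined {1..2} R (M_gen k) 1) = M1 k"
  "tmap 2 (overlined {1..2} R (M_gen k) 2) = M2 k"
  using tmap_overlined[of 2 1 "M_gen k"] tmap_overlined[of 2 2 "M_gen k"] over_Suc[of 1 "M1 k"]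
  unfolding M1_def M2_def by (simp_all add: numeral_2_eq_2 One_nat_def)

lemma set12: "{1, 2} = {1..2::nat}"
  by auto

lemma M_comm:
  assumes "k \<noteq> l"
  shows "M1 k * M2 l = M2 l * M1 k"
proof -
  let ?A = "overlined {1..2} R (M_gen k) 1" and ?B = "overlined {1..2} R (M_gen l) 2"
  have "tmap 2 (\<lambda>i j. tensor_mult {1..2} ?A ?B i j - tensor_mult {1..2} ?B ?A i j) = 0"
  proof (rule tmap_eq_0, rule \<Phi>_relator)
    fix i j :: "nat \<Rightarrow> 'n" assume "i \<in> multi_idx {1..2}" "j \<in> multi_idx {1..2}"
    then show "tensor_mult {1..2} ?A ?B i j - tensor_mult {1..2} ?B ?A i j \<in> M_relators R"
      using assms unfolding M_relators_def Let_def set12 by blast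
  qed
  then show ?thesis unfolding tmap_diff tmap_mult tmap_M by simp
qed

lemma M_quad: "M1 k * M2 k - M2 k * M1 k = M1 k * r 1 - M2 k * r 1"
proof -
  let ?A = "overlined {1..2} R (M_gen k) 1" and ?B = "overlined {1..2} R (M_gen k) 2"
  let ?R = "lift_tensor (place2 {1..2} 1 2 R) :: ('n, ('k \<times> 'n \<times> 'n) free_alg) tensor"
  have "tmap 2 (\<lambda>i j. (tensor_mult {1..2} ?A ?B i j - tensor_mult {1..2} ?B ?A i j)
      - (tensor_mult {1..2} ?A ?R i j - tensor_mult {1..2} ?B ?R i j)) = 0"
  proof (rule tmap_eq_0, rule \<Phi>_relator)
    fix i j :: "nat \<Rightarrow> 'n" assume "i \<in> multi_idx {1..2}" "j \<in> multi_idx {1..2}"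
    then show "(tensor_mult {1..2} ?A ?B i j - tensor_mult {1..2} ?B ?A i j)
      - (tensor_mult {1..2} ?A ?R i j - tensor_mult {1..2} ?B ?R i j) \<in> M_relators R"
      unfolding M_relators_def Let_def set12 by blast
  qed
  moreover have "tmap 2 ?R = r 1" using tmap_place2[of 1 2] by simp
  ultimately show ?thesis unfolding tmap_diff tmap_mult tmap_M by simp
qed

section \<open>One-site Lax matrices and their product\<close>

definition Lax1 :: "complex \<Rightarrow> complex \<Rightarrow> 'k \<Rightarrow> 'e"
  where "Lax1 h z k = 1 + (h / (z - u k)) \<odot> M1 k"

definition Lax2 :: "complex \<Rightarrow> complex \<Rightarrow> 'k \<Rightarrow> 'e"
  where "Lax2 h z k = 1 + (h / (z - u k)) \<odot> M2 k"

lemma Lax_comm: "k \<noteq> l \<Longrightarrow> Lax1 h z k * Lax2 h w l = Lax2 h w l * Lax1 h z k"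
  unfolding Lax1_def Lax2_def using M_comm[of k l]
  by (simp add: distrib_left distrib_right sc_simps mult.commute)

text \<open>The quadratic relation of the \<open>M(k)\<close> enters only through \<open>q\<close>,
  and the partial fraction identity \<open>s\<close> makes the remaining coefficients agree.\<close>

lemma Lax_rtt:
  assumes "z \<noteq> u k" "w \<noteq> u k" "z \<noteq> w"
  shows "(r 1 + (h / (w - z)) \<odot> 1) * (Lax1 h z k * Lax2 h w k)
    = Lax1 h w k * Lax2 h z k * (r 1 + (h / (w - z)) \<odot> 1)"
proof -
  let ?r = "r 1" and ?m = "M1 k" and ?n = "M2 k"
  let ?x = "h / (z - u k)" and ?y = "h / (w - u k)" and ?s = "h / (w - z)"
  have rr: "?r * ?r = 1" by (rule r_square)
  have rm: "?r * ?m = ?n * ?r" "?r * ?n = ?m * ?r"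
    unfolding M2_def using rr by (simp_all add: mult.assoc r_sq')
  have rmn: "?r * (?m * ?n) = ?n * ?m * ?r"
  proof -
    have "?r * (?m * ?n) = (?r * ?m) * ?n" by (rule mult.assoc[symmetric])
    also have "\<dots> = ?n * (?r * ?n)" unfolding rm(1) by (rule mult.assoc)
    finally show ?thesis unfolding rm(2) by (simp only: mult.assoc)
  qed
  \<comment> \<open>The defining relation multiplied by \<open>r 1\<close> from the right, which
    turns its linear terms into \<open>M1 k\<close> and \<open>M2 k\<close>.\<close>
  have q: "?n * ?m * ?r = ?m * ?n * ?r - ?m + ?n"
  proof -
    have "?n * ?m = ?m * ?n - ?m * ?r + ?n * ?r" using M_quad[of k] by (simp add: algebra_simps)
    then have "?n * ?m * ?r = (?m * ?n - ?m * ?r + ?n * ?r) * ?r" by simp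
    also have "\<dots> = ?m * ?n * ?r - ?m * (?r * ?r) + ?n * (?r * ?r)"
      by (simp only: left_diff_distrib distrib_right mult.assoc)
    finally have "?n * ?m * ?r = ?m * ?n * ?r - ?m * (?r * ?r) + ?n * (?r * ?r)" .
    then show ?thesis using rr by simp
  qed
  have s: "?x * ?y = ?s * (?x - ?y)"
  proof -
    define a b where ab: "a = z - u k" "b = w - u k"
    have nz: "a \<noteq> 0" "b \<noteq> 0" "b - a \<noteq> 0" and wz: "w - z = b - a" using assms ab by auto
    have "h / a - h / b = h * (b - a) / (a * b)" using nz by (simp add: field_simps)
    then have "h / a * (h / b) = h / (b - a) * (h / a - h / b)" using nz by simp
    then show ?thesis by (simp only: wz ab[symmetric])
  qed
  have "(?r + c \<odot> 1) * ((1 + x \<odot> ?m) * (1 + y \<odot> ?n)) = (1 + y \<odot> ?m) * (1 + x \<odot> ?n) * (?r + c \<odot> 1)"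
    if c: "c * x = x * y + c * y" for c x y
  proof -
    have "(?r + c \<odot> 1) * ((1 + x \<odot> ?m) * (1 + y \<odot> ?n))
        = ?r + c \<odot> 1 + x \<odot> (?r * ?m) + y \<odot> (?r * ?n) + (x * y) \<odot> (?r * (?m * ?n))
          + (c * x) \<odot> ?m + (c * y) \<odot> ?n + (c * x * y) \<odot> (?m * ?n)"
      by (simp add: distrib_left distrib_right sc_simps add_ac mult_ac)
    also have "?r * (?m * ?n) = ?m * ?n * ?r - ?m + ?n" unfolding rmn q ..
    also have "?r + c \<odot> 1 + x \<odot> (?r * ?m) + y \<odot> (?r * ?n) + (x * y) \<odot> (?m * ?n * ?r - ?m + ?n)
          + (c * x) \<odot> ?m + (c * y) \<odot> ?n + (c * x * y) \<odot> (?m * ?n)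
        = ?r + c \<odot> 1 + x \<odot> (?n * ?r) + y \<odot> (?m * ?r) + (x * y) \<odot> (?m * ?n * ?r)
          + (c * y) \<odot> ?m + (c * x) \<odot> ?n + (c * x * y) \<odot> (?m * ?n)"
      unfolding rm c by (simp add: scale_right_distrib scale_right_diff_distrib scale_left_distrib)
    also have "\<dots> = (1 + y \<odot> ?m) * (1 + x \<odot> ?n) * (?r + c \<odot> 1)"
      by (simp add: distrib_left distrib_right sc_simps add_ac mult_ac)
    finally show ?thesis .
  qed
  moreover have "?s * ?x = ?x * ?y + ?s * ?y" using s by (simp add: algebra_simps)
  ultimately show ?thesis unfolding Lax1_def Lax2_def by blast
qed

definition lax_prod1 :: "complex \<Rightarrow> complex \<Rightarrow> 'k list \<Rightarrow> 'e"
  where "lax_prod1 h z ks = prod_list (map (Lax1 h z) ks)"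

definition lax_prod2 :: "complex \<Rightarrow> complex \<Rightarrow> 'k list \<Rightarrow> 'e"
  where "lax_prod2 h z ks = prod_list (map (Lax2 h z) ks)"

lemma r_lax_prod: "r 1 * lax_prod1 h z ks * r 1 = lax_prod2 h z ks"
proof (induction ks)
  case Nil
  then show ?case by (simp add: lax_prod1_def lax_prod2_def r_square)
next
  case (Cons k ks)
  have L: "r 1 * Lax1 h z k * r 1 = Lax2 h z k"
    unfolding Lax1_def Lax2_def M2_def by (simp add: distrib_left distrib_right sc_simps r_square)
  have "r 1 * lax_prod1 h z (k # ks) * r 1 = (r 1 * Lax1 h z k * r 1) * (r 1 * lax_prod1 h z ks * r 1)"
    by (simp add: lax_prod1_def mult.assoc r_sq')
  then show ?case unfolding Cons L by (simp add: lax_prod2_def)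
qed

lemma lax_prod_comm: "k \<notin> set ks \<Longrightarrow> Lax2 h w k * lax_prod1 h z ks = lax_prod1 h z ks * Lax2 h w k"
proof (induction ks)
  case (Cons l ks)
  have "Lax2 h w k * lax_prod1 h z ks = lax_prod1 h z ks * Lax2 h w k" using Cons by simp
  moreover have "Lax2 h w k * Lax1 h z l = Lax1 h z l * Lax2 h w k"
    using Cons.prems by (intro Lax_comm[symmetric]) auto
  ultimately show ?case by (simp add: lax_prod1_def comm_mult)
qed (simp add: lax_prod1_def)

text \<open>Matrices of different sites commute in overlined positions, so the factors can be
  regrouped site by site and the one-site relations multiplied.\<close>

lemma lax_prod_rtt:
  assumes "z \<notin> range u" "w \<notin> range u" "z \<noteq> w" "distinct ks"
  shows "(r 1 + (h / (w - z)) \<odot> 1) * (lax_prod1 h z ks * lax_prod2 h w ks)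
    = lax_prod1 h w ks * lax_prod2 h z ks * (r 1 + (h / (w - z)) \<odot> 1)"
  using assms(4)
proof (induction ks)
  case Nil
  then show ?case by (simp add: lax_prod1_def lax_prod2_def)
next
  case (Cons k ks)
  let ?s = "r 1 + (h / (w - z)) \<odot> 1"
  let ?p = "\<lambda>z. lax_prod1 h z ks" and ?q = "\<lambda>z. lax_prod2 h z ks"
  have c: "Lax2 h w k * ?p z = ?p z * Lax2 h w k" for w z using Cons.prems by (intro lax_prod_comm) simp
  have R: "?s * (Lax1 h z k * Lax2 h w k) = Lax1 h w k * Lax2 h z k * ?s"
    using assms by (intro Lax_rtt) auto
  have "?s * (lax_prod1 h z (k # ks) * lax_prod2 h w (k # ks))
      = ?s * (Lax1 h z k * (?p z * Lax2 h w k) * ?q w)"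
    by (simp add: lax_prod1_def lax_prod2_def mult.assoc)
  also have "\<dots> = (?s * (Lax1 h z k * Lax2 h w k)) * (?p z * ?q w)"
    unfolding c[symmetric] by (simp only: mult.assoc)
  also have "\<dots> = Lax1 h w k * Lax2 h z k * (?s * (?p z * ?q w))"
    unfolding R by (simp only: mult.assoc)
  also have "\<dots> = Lax1 h w k * (Lax2 h z k * ?p w) * ?q z * ?s"
    using Cons by (simp add: mult.assoc)
  also have "\<dots> = lax_prod1 h w (k # ks) * lax_prod2 h z (k # ks) * ?s"
    unfolding c by (simp add: lax_prod1_def lax_prod2_def mult.assoc)
  finally show ?case .
qed

text \<open>An arbitrary ordering of the sites. The product of Lax matrices may depend on it, but
  its first-order coefficient in \<open>h\<close> is a sum and does not.\<close>

definition sites :: "'k list"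
  where "sites = (SOME ks. set ks = UNIV \<and> distinct ks)"

lemma sites: "set sites = UNIV" "distinct sites"
proof -
  have "\<exists>ks :: 'k list. set ks = UNIV \<and> distinct ks"
    using finite_distinct_list[OF finite] by blast
  then have "set sites = UNIV \<and> distinct sites" unfolding sites_def by (rule someI_ex)
  then show "set sites = UNIV" "distinct sites" by auto
qed

definition T_over :: "complex \<Rightarrow> nat \<Rightarrow> complex \<Rightarrow> 'e"
  where "T_over h k z = over (lax_prod1 h z sites) k"

lemma M1_N: "M1 k \<in> N 1"
  unfolding M1_def at1_def by (intro N_sum N_times \<Phi>_N e_N) simp

lemma lax_prod1_N: "lax_prod1 h z ks' \<in> N 1"
  unfolding lax_prod1_def Lax1_def
  by (induction ks') (auto intro!: N_1 N_times N_plus N_scale M1_N)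

lemma rtt_tower_T_over:
  assumes "h \<noteq> 0"
  shows "rtt_tower sc r N E (\<Sum>a\<in>UNIV. C a a) (T_over h) (- range u) h"
proof unfold_locales
  show "T_over h 1 z \<in> N 1" for z
    unfolding T_over_def One_nat_def over.simps using lax_prod1_N by (simp add: One_nat_def)
  show "T_over h (Suc k) z = r k * T_over h k z * r k" if "1 \<le> k" for k z
    unfolding T_over_def using over_Suc[OF that] .
  show "(r 1 + (h / (v - x)) \<odot> 1) * (T_over h 1 x * T_over h 2 v) = T_over h 1 v * T_over h 2 x * (r 1 + (h / (v - x)) \<odot> 1)"
    if "x \<in> - range u" "v \<in> - range u" "x \<noteq> v" for x v
  proof -
    have "T_over h 1 z = lax_prod1 h z sites" "T_over h 2 z = lax_prod2 h z sites" for z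
      using over_Suc[of 1 "lax_prod1 h z sites"] r_lax_prod[of h z sites]
      unfolding T_over_def by (simp_all add: One_nat_def numeral_2_eq_2)
    then show ?thesis using lax_prod_rtt[OF _ _ that(3) sites(2)] that by simp
  qed
qed (rule assms)

subsection \<open>Expansion at \<open>h = 0\<close>\<close>

definition L1 :: "complex \<Rightarrow> 'k list \<Rightarrow> 'e"
  where "L1 z ks = (\<Sum>k\<leftarrow>ks. (1 / (z - u k)) \<odot> M1 k)"

lemma pole_crat2: "(\<lambda>t. (1 / (fst t - u k)) \<odot> x) \<in> crat2 (range u)"
  using lspan_base[OF rat2_pole[of "u k" "range u" 0], of x] by (simp add: case_prod_beta')

lemma L1_crat2: "(\<lambda>t. L1 (fst t) ks') \<in> crat2 (range u)"
  unfolding L1_def by (induction ks') (auto intro: crat2_const lspan_add pole_crat2)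

text \<open>No pole has to be avoided: the identity is polynomial in \<open>h\<close> and in the
  numbers \<open>1 / (z - u k)\<close>, whatever their values.\<close>

lemma lax_prod1_expansion:
  "\<exists>Y\<in>crat2 (range u). \<forall>z h. lax_prod1 h z ks' = 1 + h \<odot> L1 z ks' + h ^ 2 \<odot> Y (z, h)"
proof (induction ks')
  case Nil
  show ?case by (rule bexI[OF _ crat2_const[of 0]]) (simp add: lax_prod1_def L1_def)
next
  case (Cons k ks')
  then obtain Y where Y: "Y \<in> crat2 (range u)"
    "\<And>z h. lax_prod1 h z ks' = 1 + h \<odot> L1 z ks' + h ^ 2 \<odot> Y (z, h)" by blast
  let ?A = "\<lambda>t. (1 / (fst t - u k)) \<odot> M1 k"
  let ?Y = "\<lambda>t. Y t + ?A t * L1 (fst t) ks' + snd t \<odot> (?A t * Y t)"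
  have A: "?Y \<in> crat2 (range u)"
    by (intro lspan_add crat2_mult crat2_scale rat2_h pole_crat2 L1_crat2 Y)
  have B: "lax_prod1 h z (k # ks') = 1 + h \<odot> L1 z (k # ks') + h ^ 2 \<odot> ?Y (z, h)" for z h
  proof -
    have "lax_prod1 h z (k # ks') = (1 + h \<odot> ?A (z, h)) * lax_prod1 h z ks'"
      by (simp add: lax_prod1_def Lax1_def)
    also have "\<dots> = 1 + h \<odot> (?A (z, h) + L1 z ks') + h ^ 2 \<odot> (Y (z, h) + ?A (z, h) * L1 z ks' + h \<odot> (?A (z, h) * Y (z, h)))"
      unfolding Y(2) by (simp only: distrib_left distrib_right sc_simps mult_1_left mult_1_right scale_scale power2_eq_square add_ac mult_ac)
    finally show ?thesis by (simp add: L1_def)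
  qed
  show ?case by (rule bexI[OF _ A]) (intro allI B)
qed

lemma over_add: "over (x + y) k = over x k + over y k"
  by (induction k rule: induct_nat_012) (simp_all add: distrib_left distrib_right)

lemma over_sc: "over (c \<odot> x) k = c \<odot> over x k"
  by (induction k rule: induct_nat_012) (simp_all add: sc_simps)

lemma over_one: "over 1 k = 1"
  by (induction k rule: induct_nat_012) (simp_all add: r_square)

definition L_over :: "nat \<Rightarrow> complex \<Rightarrow> 'e"
  where "L_over j z = over (at1 1 (L_tilde u z)) j"

lemma at1_L_tilde: "at1 1 (L_tilde u z) = L1 z sites"
proof -
  have "at1 1 (L_tilde u z) = (\<Sum>x\<in>UNIV. \<Sum>y\<in>UNIV. \<Sum>k\<in>UNIV. (1 / (z - u k)) \<odot> (\<Phi> (M_gen k $ x $ y) * e 1 x y))"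
    unfolding at1_def L_tilde_def by (simp add: \<Phi>_sum \<Phi>_mult \<Phi>_const sum_distrib_right sc_simps)
  also have "\<dots> = (\<Sum>k\<in>UNIV. \<Sum>x\<in>UNIV. \<Sum>y\<in>UNIV. (1 / (z - u k)) \<odot> (\<Phi> (M_gen k $ x $ y) * e 1 x y))"
    unfolding sum.cartesian_product
    by (rule sum.reindex_bij_witness[where i = "\<lambda>(k, x, y). (x, y, k)" and j = "\<lambda>(x, y, k). (k, x, y)"]) auto
  also have "\<dots> = (\<Sum>k\<in>UNIV. (1 / (z - u k)) \<odot> M1 k)"
    unfolding M1_def at1_def by (simp add: scale_sum_right)
  also have "\<dots> = L1 z sites"
    unfolding L1_def using sites by (simp add: sum_list_distinct_conv_sum_set)
  finally show ?thesis .
qed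

lemma L_over_crat2: "(\<lambda>t. L_over j (fst t)) \<in> crat2 (range u)"
  unfolding L_over_def at1_L_tilde by (rule lspan_map[of "\<lambda>x. over x j", OF over_add over_sc L1_crat2])

lemma T_over_expansion:
  "\<exists>Y\<in>crat2 (range u). \<forall>z h. T_over h j z = 1 + h \<odot> L_over j z + h ^ 2 \<odot> Y (z, h)"
proof -
  obtain Y where Y: "Y \<in> crat2 (range u)"
    "\<And>z h. lax_prod1 h z sites = 1 + h \<odot> L1 z sites + h ^ 2 \<odot> Y (z, h)" using lax_prod1_expansion by blast
  have A: "(\<lambda>t. over (Y t) j) \<in> crat2 (range u)"
    by (rule lspan_map[of "\<lambda>x. over x j", OF over_add over_sc Y(1)])
  show ?thesis
    by (rule bexI[OF _ A]) (simp add: T_over_def L_over_def at1_L_tilde Y(2) over_add over_sc over_one)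
qed

text \<open>The list is general because the operators are peeled off from the left, so that products
  over the later positions occur in the induction.\<close>

definition L_prod :: "nat \<Rightarrow> nat list \<Rightarrow> complex \<Rightarrow> 'e"
  where "L_prod m js z = tmap m (foldr (L_minus_d {1..m} R u) js (\<lambda>z. tensor_one {1..m}) z)"

definition L_prod_deriv :: "nat \<Rightarrow> nat list \<Rightarrow> complex \<Rightarrow> 'e"
  where "L_prod_deriv m js z = tmap m (\<lambda>i j. fa_deriv
    (\<lambda>x. foldr (L_minus_d {1..m} R u) js (\<lambda>z. tensor_one {1..m}) x i j) z)"

lemma cder_map:
  fixes L :: "'g free_alg \<Rightarrow> 'e"
  assumes "\<And>x y. L (x + y) = L x + L y" "\<And>c x. L (fa_const c * x) = c \<odot> L x" "fa.cder P f f'"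
  shows "cder P (\<lambda>z. L (f z)) (\<lambda>z. L (f' z))"
  using assms(3)
proof (induction rule: fa.cder.induct)
  case (cder_cong f f' g g')
  show ?case by (rule cder.cder_cong[OF cder_cong.IH]) (simp add: cder_cong)
qed (auto simp: assms(1,2) intro: cder.intros)

lemma cder_L_prod: "cder (range u) (L_prod m js) (L_prod_deriv m js)"
proof -
  let ?I = "multi_idx {1..m} :: (nat \<Rightarrow> 'n) set"
  let ?F = "\<lambda>x. foldr (L_minus_d {1..m} R u) js (\<lambda>z. tensor_one {1..m}) x"
  have "cder (range u) (\<lambda>z. \<Phi> (?F z i j) * Eu m i j) (\<lambda>z. \<Phi> (fa_deriv (\<lambda>x. ?F x i j) z) * Eu m i j)" for i j
    by (rule cder_map[where L = "\<lambda>x. \<Phi> x * Eu m i j"])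
      (auto simp: \<Phi>_add \<Phi>_mult \<Phi>_const distrib_right sc_simps intro!: cder_fa_deriv rational_L_minus_d_prod)
  then show ?thesis
    unfolding L_prod_def[abs_def] L_prod_deriv_def[abs_def] tmap_def by (intro cder_sum)
qed

lemma L_prod_Cons:
  assumes "1 \<le> j" "j \<le> m"
  shows "L_prod m (j # js) z = L_over j z * L_prod m js z - L_prod_deriv m js z"
proof -
  have "L_prod m (j # js) z = tmap m (\<lambda>i i'. tensor_mult {1..m} (overlined {1..m} R (L_tilde u z) j)
      (foldr (L_minus_d {1..m} R u) js (\<lambda>z. tensor_one {1..m}) z) i i'
      - fa_deriv (\<lambda>x. foldr (L_minus_d {1..m} R u) js (\<lambda>z. tensor_one {1..m}) x i i') z)"
    unfolding L_prod_def foldr.simps o_apply by (simp only: L_minus_d_def)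
  then show ?thesis
    using assms by (simp only: tmap_diff tmap_mult L_prod_def L_prod_deriv_def L_over_def tmap_overlined order.trans)
qed

lemma L_prod_Nil: "L_prod m [] z = 1"
  unfolding L_prod_def by (simp add: tmap_one)

text \<open>This is \<open>diff_op\<close> with \<open>h\<close> as an argument: the tower is
  available for one fixed nonzero \<open>h\<close>, while the expansion lets \<open>h\<close>
  vary.\<close>

fun shift_prod :: "complex \<Rightarrow> nat \<Rightarrow> nat \<Rightarrow> complex \<Rightarrow> 'e"
  where
    "shift_prod h p 0 z = 1"
  | "shift_prod h p (Suc n) z = T_over h (Suc p) z * shift_prod h (Suc p) n (z - h) - shift_prod h (Suc p) n z"

text \<open>As \<open>T\<close> begins with 1, the terms of order \<open>h ^ n\<close> cancel. The
  next order is \<open>L * F - G\<close>, one more operator \<open>L - d/dz\<close> applied to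
  \<open>F\<close>; primes mark values at the shifted argument.\<close>

lemma shift_prod_step:
  assumes "F' = F - h \<odot> G + h ^ 2 \<odot> q" "H' = H + h \<odot> q2" "T = 1 + h \<odot> L + h ^ 2 \<odot> (Y :: 'e)"
  shows "T * (h ^ n \<odot> (F' + h \<odot> H')) - h ^ n \<odot> (F + h \<odot> H)
    = h ^ Suc n \<odot> ((L * F - G) + h \<odot> (q + q2 + L * (H' - G + h \<odot> q) + Y * (F' + h \<odot> H')))"
  unfolding assms by (simp add: algebra_simps sc_simps scale_left_distrib power2_eq_square)


lemma shift_prod_expansion:
  "p + n \<le> m \<Longrightarrow> \<exists>H\<in>crat2 (range u). \<exists>b. \<forall>z h. avoids (range u) b z h
    \<longrightarrow> shift_prod h p n z = h ^ n \<odot> (L_prod m [Suc p..<Suc (p + n)] z + h \<odot> H (z, h))"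
proof (induction n arbitrary: p)
  case 0
  show ?case
    by (rule bexI[OF _ crat2_const[of 0]]) (simp add: L_prod_Nil)
next
  case (Suc n)
  let ?P = "range u" and ?js = "[Suc (Suc p)..<Suc (Suc p + n)]"
  obtain H b where H: "H \<in> crat2 ?P"
    "\<And>z h. avoids ?P b z h \<Longrightarrow> shift_prod h (Suc p) n z = h ^ n \<odot> (L_prod m ?js z + h \<odot> H (z, h))"
    using Suc.IH[of "Suc p"] Suc.prems by auto
  obtain q where q: "q \<in> crat2 ?P"
    "\<And>z h. z \<notin> ?P \<Longrightarrow> z - h \<notin> ?P \<Longrightarrow>
      L_prod m ?js (z - h) = L_prod m ?js z - h \<odot> L_prod_deriv m ?js z + h ^ 2 \<odot> q (z, h)"
    using cder_taylor[OF cder_L_prod] by metis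
  obtain q2 b2 where q2: "q2 \<in> crat2 ?P"
    "\<And>z h. avoids ?P b2 z h \<Longrightarrow> H (z - h, h) = H (z, h) + h \<odot> q2 (z, h)"
    using crat2_difference[OF H(1)] by metis
  obtain Y where Y: "Y \<in> crat2 ?P"
    "\<And>z h. T_over h (Suc p) z = 1 + h \<odot> L_over (Suc p) z + h ^ 2 \<odot> Y (z, h)"
    using T_over_expansion by metis
  \<comment> \<open>The new remainder must lie in \<open>crat2\<close>, so \<open>L_prod\<close> and
    its derivative are replaced by members of that class agreeing with them off the poles.\<close>
  obtain F where F: "F \<in> crat2 ?P" "\<And>z h. z \<notin> ?P \<Longrightarrow> L_prod m ?js z = F (z, h)"
    using cder_crat2[OF cder_L_prod] by metis
  obtain dF' where "cder ?P (L_prod_deriv m ?js) dF'" using cder_deriv[OF cder_L_prod] by blast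
  then obtain G where G: "G \<in> crat2 ?P" "\<And>z h. z \<notin> ?P \<Longrightarrow> L_prod_deriv m ?js z = G (z, h)"
    using cder_crat2 by metis
  let ?sh = "\<lambda>f t. f (fst t - snd t, snd t)"
  let ?K = "\<lambda>t. q t + q2 t + L_over (Suc p) (fst t) * (?sh H t + - G t + snd t \<odot> q t)
      + Y t * (?sh F t + snd t \<odot> ?sh H t)"
  have K: "?K \<in> crat2 ?P"
    by (intro lspan_add crat2_mult crat2_scale crat2_shift crat2_minus rat2_h L_over_crat2 H(1) q(1) q2(1) Y(1) F(1) G(1))
  \<comment> \<open>The bound is raised by one because the induction hypothesis is also used at
    \<open>z - h\<close>.\<close>
  have "shift_prod h p (Suc n) z = h ^ Suc n \<odot> (L_prod m [Suc p..<Suc (p + Suc n)] z + h \<odot> ?K (z, h))"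
    if av: "avoids ?P (Suc (max b b2)) z h" for z h
  proof -
    have z: "z \<notin> ?P" "z - h \<notin> ?P" using avoids_0[OF av] avoids_1[OF av] by auto
    have a1: "avoids ?P b (z - h) h" using avoids_mono[OF avoids_shift[OF av]] by simp
    have a2: "avoids ?P b z h" "avoids ?P b2 z h" using avoids_mono[OF av] by simp_all
    have js: "[Suc p..<Suc (p + Suc n)] = Suc p # ?js" by (simp add: upt_conv_Cons del: upt_Suc)
    have "shift_prod h p (Suc n) z = T_over h (Suc p) z * (h ^ n \<odot> (L_prod m ?js (z - h) + h \<odot> H (z - h, h)))
        - h ^ n \<odot> (L_prod m ?js z + h \<odot> H (z, h))"
      unfolding shift_prod.simps H(2)[OF a1] H(2)[OF a2(1)] ..
    also have "\<dots> = h ^ Suc n \<odot> ((L_over (Suc p) z * L_prod m ?js z - L_prod_deriv m ?js z)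
        + h \<odot> (q (z, h) + q2 (z, h) + L_over (Suc p) z * (H (z - h, h) - L_prod_deriv m ?js z + h \<odot> q (z, h))
          + Y (z, h) * (L_prod m ?js (z - h) + h \<odot> H (z - h, h))))"
      by (rule shift_prod_step[OF q(2)[OF z] q2(2)[OF a2(2)] Y(2)])
    also have "L_over (Suc p) z * L_prod m ?js z - L_prod_deriv m ?js z = L_prod m [Suc p..<Suc (p + Suc n)] z"
      unfolding js using Suc.prems by (intro L_prod_Cons[symmetric]) auto
    finally show ?thesis
      using G(2)[OF z(1), of h] F(2)[OF z(2), of h] by simp
  qed
  then show ?case
    by (intro bexI[OF _ K] exI[of _ "Suc (max b b2)"]) blast
qed

section \<open>Passage to the limit\<close>

definition qh :: "nat \<Rightarrow> nat \<Rightarrow> complex \<Rightarrow> 'e"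
  where "qh m k z = tr m (skewer 0 m * L_prod m [1..<k + 1] z)"

lemma \<Phi>_QH: "\<Phi> (QH R \<Psi> m u k z) = qh m k z"
  unfolding QH_def Let_def \<Phi>_R_trace tmap_mult tmap_skew_sym[OF order_refl] qh_def L_prod_def
    L_minus_d_prod_unit_def ..

lemma eventually_avoids:
  assumes "z \<notin> range u"
  shows "\<forall>\<^sub>F h in at 0. avoids (range u) n (z + b * h) h"
proof -
  have "\<forall>\<^sub>F h in at 0. \<forall>l\<in>{..n}. z + (b - of_nat l) * h \<notin> range u"
    using assms by (intro eventually_ball_finite ballI eventually_avoid) auto
  then show ?thesis
    by (rule eventually_mono) (auto simp: avoids_def algebra_simps)
qed

text \<open>Shifting the second argument by \<open>h / 2\<close> keeps the two arguments generic even if they coincide.\<close>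

lemma eventually_generic:
  "\<forall>\<^sub>F h in at 0. \<forall>a<k. \<forall>b<l. \<forall>c\<in>{0, h, - h}.
    (w + 1 / 2 * h) - of_nat b * h - (z - of_nat a * h) \<noteq> (c :: complex)"
proof -
  have *: "\<forall>\<^sub>F h in at 0. (w + 1 / 2 * h) - of_nat b * h - (z - of_nat a * h) \<noteq> of_int c * h"
    for a b :: nat and c :: int
  proof -
    \<comment> \<open>The coefficient of \<open>h\<close> after collecting terms. Twice this number
      is an odd integer, so it does not vanish and the inequality holds near 0 even if
      \<open>w = z\<close>.\<close>
    let ?b = "1 / 2 - of_nat b + of_nat a - of_int c :: complex"
    have "2 * ?b = of_int (2 * (int a - int b - c) + 1)" by simp
    moreover have "2 * (int a - int b - c) + 1 \<noteq> 0" by presburger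
    ultimately have b: "?b \<noteq> 0"
      by (metis mult_zero_right of_int_eq_0_iff)
    have "\<forall>\<^sub>F h in at 0. (w - z) + ?b * h \<noteq> 0"
    proof (cases "w - z = 0")
      case True
      then show ?thesis using b by (simp add: eventually_at_filter)
    next
      case False
      then show ?thesis using eventually_avoid[of "{0}" "w - z" ?b] by simp
    qed
    then show ?thesis
      by (rule eventually_mono) (auto simp: algebra_simps)
  qed
  have "\<forall>\<^sub>F h in at 0. \<forall>a\<in>{..<k}. \<forall>b\<in>{..<l}. \<forall>c\<in>{0, 1, - 1 :: int}.
      (w + 1 / 2 * h) - of_nat b * h - (z - of_nat a * h) \<noteq> of_int c * h"
    by (intro eventually_ball_finite ballI * finite_lessThan) auto
  then show ?thesis
    by (rule eventually_mono) auto
qed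

lemma shift_prod_trace_comm:
  assumes "1 \<le> k" "k \<le> m" "1 \<le> l" "l \<le> m" and "h \<noteq> 0"
    and "avoids (range u) k z h" "avoids (range u) l w h"
    and "\<forall>a<k. \<forall>b<l. \<forall>c\<in>{0, h, - h}. w - of_nat b * h - (z - of_nat a * h) \<noteq> c"
  shows "tr m (skewer 0 m * shift_prod h 0 k z) * tr m (skewer 0 m * shift_prod h 0 l w)
    = tr m (skewer 0 m * shift_prod h 0 l w) * tr m (skewer 0 m * shift_prod h 0 k z)"
proof -
  interpret t: rtt_tower sc r N E "\<Sum>a\<in>UNIV. C a a" "T_over h" "- range u" h
    using assms(5) by (rule rtt_tower_T_over)
  have "t.diff_op p n z = shift_prod h p n z" for p n z
    by (induction n arbitrary: p z) simp_all
  then show ?thesis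
    using t.diff_op_traces_comm[of k m l z w] assms avoidsD[OF assms(6)] avoidsD[OF assms(7)]
    unfolding t.generic_def by auto
qed

lemma comm_limit:
  assumes "s \<in> tame" "t \<in> tame"
    "\<forall>\<^sub>F h in at 0. (x + h \<odot> s h) * (y + h \<odot> t h) = (y + h \<odot> t h) * (x + h \<odot> s h)"
  shows "x * y = y * x"
proof -
  \<comment> \<open>The commutator of the perturbed elements minus that of \<open>x\<close> and
    \<open>y\<close>, divided by \<open>h\<close>.\<close>
  let ?s = "\<lambda>h. (s h * y + x * t h + h \<odot> (s h * t h)) + (- 1) \<odot> (t h * x + y * s h + h \<odot> (t h * s h))"
  have "?s \<in> tame"
    using assms by (intro lspan_add tame_mult tame_scale tame_const) auto
  moreover have "\<forall>\<^sub>F h in at 0. (x * y - y * x) + h \<odot> ?s h = 0"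
    using assms(3)
  proof eventually_elim
    case (elim h)
    have "(x * y - y * x) + h \<odot> ?s h = (x + h \<odot> s h) * (y + h \<odot> t h) - (y + h \<odot> t h) * (x + h \<odot> s h)"
      by (simp add: algebra_simps sc_simps)
    then show ?case using elim by simp
  qed
  ultimately have "x * y - y * x = 0" by (rule tame_limit)
  then show ?thesis by simp
qed

theorem qh_comm:
  assumes "1 \<le> k" "k \<le> m" "1 \<le> l" "l \<le> m" "z \<notin> range u" "w \<notin> range u"
  shows "qh m k z * qh m l w = qh m l w * qh m k z"
proof -
  let ?P = "range u"
  define S where "S x = tr m (skewer 0 m * x)" for x
  have S_add: "S (x + y) = S x + S y" and S_sc: "S (c \<odot> x) = c \<odot> S x" for x y c
    unfolding S_def by (simp_all add: distrib_left ptr_add sc_simps ptr_sc)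
  obtain H b where H: "H \<in> crat2 ?P"
    "\<And>z h. avoids ?P b z h \<Longrightarrow> shift_prod h 0 k z = h ^ k \<odot> (L_prod m [1..<k + 1] z + h \<odot> H (z, h))"
    using shift_prod_expansion[of 0 k m] assms by (auto simp: One_nat_def)
  obtain H' b' where H': "H' \<in> crat2 ?P"
    "\<And>z h. avoids ?P b' z h \<Longrightarrow> shift_prod h 0 l z = h ^ l \<odot> (L_prod m [1..<l + 1] z + h \<odot> H' (z, h))"
    using shift_prod_expansion[of 0 l m] assms by (auto simp: One_nat_def)
  \<comment> \<open>Moving the argument from \<open>w\<close> to \<open>w + h / 2\<close> changes
    the leading coefficient by a term of order \<open>h\<close> only, which is added to the
    remainder \<open>t\<close>.\<close>
  obtain f where f: "f \<in> tame" "\<forall>\<^sub>F h in at 0. L_prod m [1..<l + 1] (w + 1 / 2 * h) = L_prod m [1..<l + 1] w + h \<odot> f h"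
    using cder_tame[OF cder_L_prod assms(6), of m "[1..<l + 1]" "1 / 2"] by auto
  let ?s = "\<lambda>h. S (H (z + 0 * h, h))"
  let ?t = "\<lambda>h. S (f h) + S (H' (w + 1 / 2 * h, h))"
  have tame: "?s \<in> tame" "?t \<in> tame"
    using crat2_tame[OF H(1) assms(5), of 0] crat2_tame[OF H'(1) assms(6), of "1 / 2"] f(1)
    by (auto intro!: lspan_add lspan_map[of S, OF S_add S_sc])
  have "\<forall>\<^sub>F h in at (0 :: complex). h \<noteq> 0" by (simp add: eventually_at_filter)
  then have "\<forall>\<^sub>F h in at 0. (qh m k z + h \<odot> ?s h) * (qh m l w + h \<odot> ?t h)
      = (qh m l w + h \<odot> ?t h) * (qh m k z + h \<odot> ?s h)"
    using f(2) eventually_avoids[OF assms(5), of "max b k" 0] eventually_avoids[OF assms(6), of "max b' l" "1 / 2"]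
      eventually_generic[of k l w z]
  proof eventually_elim
    case (elim h)
    have av: "avoids ?P b z h" "avoids ?P k z h" "avoids ?P b' (w + 1 / 2 * h) h" "avoids ?P l (w + 1 / 2 * h) h"
      using avoids_mono[OF elim(3)] avoids_mono[OF elim(4)] by simp_all
    have 1: "S (shift_prod h 0 k z) = h ^ k \<odot> (qh m k z + h \<odot> ?s h)"
      unfolding H(2)[OF av(1)] S_add S_sc by (simp add: qh_def S_def)
    have 2: "S (shift_prod h 0 l (w + 1 / 2 * h)) = h ^ l \<odot> (qh m l w + h \<odot> ?t h)"
      unfolding H'(2)[OF av(3)] elim(2) S_add S_sc by (simp add: qh_def S_def scale_right_distrib add.assoc)
    have "S (shift_prod h 0 k z) * S (shift_prod h 0 l (w + 1 / 2 * h)) = S (shift_prod h 0 l (w + 1 / 2 * h)) * S (shift_prod h 0 k z)"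
      unfolding S_def using assms elim av by (intro shift_prod_trace_comm) auto
    then have "(h ^ k * h ^ l) \<odot> ((qh m k z + h \<odot> ?s h) * (qh m l w + h \<odot> ?t h))
        = (h ^ k * h ^ l) \<odot> ((qh m l w + h \<odot> ?t h) * (qh m k z + h \<odot> ?s h))"
      unfolding 1 2 sc_mult_left sc_mult_right scale_scale by (simp only: mult.commute)
    then show ?case using elim(1) by (simp only: scale_cancel_left) simp
  qed
  then show ?thesis by (rule comm_limit[OF tame])
qed

end

section \<open>A faithful model\<close>

type_synonym ('n, 'g) vecs = "(nat \<Rightarrow> 'n) \<Rightarrow> 'g free_alg"

text \<open>All positions are present at once. Operators need to be linear over the complex numbers
  only, so an algebra element may act on the coefficients by something other than
  multiplication.\<close>

typedef ('n, 'g) tensor_op = "{f :: ('n, 'g) vecs \<Rightarrow> ('n, 'g) vecs.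
    (\<forall>x y. f (\<lambda>i. x i + y i) = (\<lambda>i. f x i + f y i)) \<and> (\<forall>c x. f (\<lambda>i. fa_const c * x i) = (\<lambda>i. fa_const c * f x i))}"
  morphisms app Op
  by (rule exI[of _ "\<lambda>x. x"]) simp

lemma app_add: "app f (\<lambda>i. x i + y i) = (\<lambda>i. app f x i + app f y i)"
  using app[of f] by simp

lemma app_scale: "app f (\<lambda>i. fa_const c * x i) = (\<lambda>i. fa_const c * app f x i)"
  using app[of f] by simp

lemma app_Op:
  assumes "\<And>x y. f (\<lambda>i. x i + y i) = (\<lambda>i. f x i + f y i)"
    "\<And>c x. f (\<lambda>i. fa_const c * x i) = (\<lambda>i. fa_const c * f x i)"
  shows "app (Op f) = f"
  using assms by (intro Op_inverse) simp

lemma tensor_op_eqI: "(\<And>x i. app f x i = app g x i) \<Longrightarrow> f = g"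
  by (metis app_inject ext)

instantiation tensor_op :: (type, type) ring_1
begin

definition "0 = Op (\<lambda>x i. 0)"
definition "1 = Op (\<lambda>x. x)"
definition "f + g = Op (\<lambda>x i. app f x i + app g x i)"
definition "f - g = Op (\<lambda>x i. app f x i - app g x i)"
definition "- f = Op (\<lambda>x i. - app f x i)"
definition "f * g = Op (\<lambda>x. app f (app g x))"

lemma app_zero [simp]: "app 0 x = (\<lambda>i. 0)"
  unfolding zero_tensor_op_def by (subst app_Op) auto

lemma app_one [simp]: "app 1 x = x"
  unfolding one_tensor_op_def by (subst app_Op) auto

lemma app_plus [simp]: "app (f + g) x = (\<lambda>i. app f x i + app g x i)"
  unfolding plus_tensor_op_def by (subst app_Op) (auto simp: app_add app_scale algebra_simps)

lemma app_minus [simp]: "app (f - g) x = (\<lambda>i. app f x i - app g x i)"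
  unfolding minus_tensor_op_def by (subst app_Op) (auto simp: app_add app_scale algebra_simps)

lemma app_uminus [simp]: "app (- f) x = (\<lambda>i. - app f x i)"
  unfolding uminus_tensor_op_def by (subst app_Op) (auto simp: app_add app_scale algebra_simps)

lemma app_times [simp]: "app (f * g) x = app f (app g x)"
  unfolding times_tensor_op_def by (subst app_Op) (auto simp: app_add app_scale)

instance
proof
  have "app 0 (\<lambda>i. 1) \<noteq> app (1 :: ('a, 'b) tensor_op) (\<lambda>i. 1)" by (simp add: fun_eq_iff)
  then show "(0 :: ('a, 'b) tensor_op) \<noteq> 1" by metis
qed (auto intro!: tensor_op_eqI simp: app_add algebra_simps)

end

definition op_scale :: "complex \<Rightarrow> ('n, 'g) tensor_op \<Rightarrow> ('n, 'g) tensor_op"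
  where "op_scale c f = Op (\<lambda>x i. fa_const c * app f x i)"

lemma app_op_scale [simp]: "app (op_scale c f) x = (\<lambda>i. fa_const c * app f x i)"
  unfolding op_scale_def
  by (subst app_Op) (auto simp: app_add app_scale distrib_left mult.commute)

interpretation op: c_algebra op_scale
proof
  fix a b c :: complex and x y :: "('n, 'g) tensor_op"
  show "op_scale a (x + y) = op_scale a x + op_scale a y"
    by (rule tensor_op_eqI) (simp add: distrib_left)
  show "op_scale (a + b) x = op_scale a x + op_scale b x"
    by (rule tensor_op_eqI) (simp add: distrib_right fa_const_add)
  show "op_scale a (op_scale b x) = op_scale (a * b) x"
    by (rule tensor_op_eqI) simp
  show "op_scale 1 x = x"
    by (rule tensor_op_eqI) (simp add: fa_const_1)
  show "op_scale c x * y = op_scale c (x * y)"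
    by (rule tensor_op_eqI) simp
  show "x * op_scale c y = op_scale c (x * y)"
  proof (rule tensor_op_eqI)
    show "app (x * op_scale c y) f i = app (op_scale c (x * y)) f i" for f i
      unfolding app_times app_op_scale app_scale ..
  qed
qed

definition unit_op :: "nat \<Rightarrow> 'n \<Rightarrow> 'n \<Rightarrow> ('n, 'g) tensor_op"
  where "unit_op p a b = Op (\<lambda>x i. if i p = a then x (i(p := b)) else 0)"

lemma app_unit_op [simp]: "app (unit_op p a b) x = (\<lambda>i. if i p = a then x (i(p := b)) else 0)"
  unfolding unit_op_def by (subst app_Op) auto

lemma app_sum: "app (\<Sum>a\<in>A. f a) x i = (\<Sum>a\<in>A. app (f a) x i)"
  by (induction A rule: infinite_finite_induct) auto

text \<open>The augmentation, a character that kills the generators and hence the relators; it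
  provides a unital action on the part of the space where the quotient algebra does not act.\<close>

definition eps :: "'g free_alg \<Rightarrow> complex"
  where "eps x = Poly_Mapping.lookup x 0"

lemma eps_add: "eps (x + y) = eps x + eps y"
  unfolding eps_def by (simp add: lookup_add)

lemma eps_diff: "eps (x - y) = eps x - eps y"
  unfolding eps_def by (simp add: lookup_minus)

lemma eps_0: "eps 0 = 0"
  unfolding eps_def by simp

lemma eps_sum: "eps (\<Sum>a\<in>A. f a) = (\<Sum>a\<in>A. eps (f a))"
  by (induction A rule: infinite_finite_induct) (auto simp: eps_0 eps_add)

lemma fword_add_eq_0: "l + q = 0 \<longleftrightarrow> l = 0 \<and> q = (0 :: 'g fword)"
  by (cases l; cases q) (simp add: zero_fword_def)

text \<open>A product of words is empty only if both factors are, so a single term of the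
  convolution remains.\<close>

lemma eps_mult: "eps (x * y) = eps x * eps y"
proof -
  have "(\<Sum>q. Poly_Mapping.lookup y q when 0 = l + q) = (Poly_Mapping.lookup y 0 when l = 0)" for l
  proof -
    have "(Poly_Mapping.lookup y q when 0 = l + q) = ((Poly_Mapping.lookup y q when l = 0) when q = 0)" for q
      using fword_add_eq_0[of l q] by (auto simp: when_def)
    then show ?thesis by simp
  qed
  then show ?thesis
    unfolding eps_def lookup_mult by (simp add: mult_when)
qed

lemma eps_const: "eps (fa_const c) = c"
  unfolding eps_def fa_const_def by simp

lemma eps_gen: "eps (fa_gen g) = 0"
  unfolding eps_def fa_gen_def by (simp add: lookup_single zero_fword_def)

text \<open>A basis of the ideal is extended to the whole space and projected away. The complement
  represents the quotient, which depends on the value \<open>rels\<close> and is therefore not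
  formed as a type.\<close>

lemma ideal_projection:
  fixes rels :: "'g free_alg set"
  obtains \<pi> :: "'g free_alg \<Rightarrow> 'g free_alg"
  where "\<And>x y. \<pi> (x + y) = \<pi> x + \<pi> y" "\<And>c x. \<pi> (fa_const c * x) = fa_const c * \<pi> x"
    "\<And>x. x \<in> two_sided_ideal rels \<Longrightarrow> \<pi> x = 0" "\<And>x. x - \<pi> x \<in> two_sided_ideal rels"
proof -
  let ?I = "two_sided_ideal rels"
  interpret vs: vector_space_pair "\<lambda>c (x :: 'g free_alg). fa_const c * x" "\<lambda>c (x :: 'g free_alg). fa_const c * x"
    ..
  have sub: "fa.subspace ?I"
    by (auto simp: fa.subspace_def intro: two_sided_ideal.intros)
  obtain B where B: "B \<subseteq> ?I" "fa.independent B" "?I \<subseteq> fa.span B"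
    by (rule fa.maximal_independent_subset)
  obtain B' where B': "B \<subseteq> B'" "fa.independent B'" "UNIV \<subseteq> fa.span B'"
    using fa.maximal_independent_subset_extend[OF subset_UNIV B(2)] by metis
  obtain \<pi> where lin: "Vector_Spaces.linear (\<lambda>c (x :: 'g free_alg). fa_const c * x) (\<lambda>c x. fa_const c * x) \<pi>"
    and \<pi>: "\<forall>x\<in>B'. \<pi> x = (if x \<in> B then 0 else x)"
    using vs.linear_independent_extend[OF B'(2), of "\<lambda>x. if x \<in> B then 0 else x"] by blast
  have add: "\<pi> (x + y) = \<pi> x + \<pi> y" and scale: "\<pi> (fa_const c * x) = fa_const c * \<pi> x" for x y c
    using lin by (auto simp: Vector_Spaces.linear_iff)
  have "fa.subspace {x. \<pi> x = 0}"
    using add scale scale[of 0 0] by (auto simp: fa.subspace_def fa_const_0)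
  then have "fa.span B \<subseteq> {x. \<pi> x = 0}"
    using \<pi> B' by (intro fa.span_minimal) auto
  then have 1: "\<pi> x = 0" if "x \<in> ?I" for x using B(3) that by auto
  have "fa.subspace {x. x - \<pi> x \<in> ?I}"
  proof -
    have "x + y - (\<pi> x + \<pi> y) \<in> ?I" if "x - \<pi> x \<in> ?I" "y - \<pi> y \<in> ?I" for x y
      using two_sided_ideal.add[OF that] by (simp add: algebra_simps)
    moreover have "fa_const c * x - fa_const c * \<pi> x \<in> ?I" if "x - \<pi> x \<in> ?I" for c x
      using two_sided_ideal.lmult[OF that, of "fa_const c"] by (simp add: algebra_simps)
    moreover have "\<pi> 0 = 0" using scale[of 0 0] by (simp add: fa_const_0)
    ultimately show ?thesis
      by (auto simp: fa.subspace_def add scale intro: two_sided_ideal.zero)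
  qed
  then have "fa.span B' \<subseteq> {x. x - \<pi> x \<in> ?I}"
    using \<pi> B(1) by (intro fa.span_minimal) (auto intro: two_sided_ideal.zero)
  then have 2: "x - \<pi> x \<in> ?I" for x using B'(3) by auto
  show ?thesis using that[OF add scale 1 2] .
qed

text \<open>
  The quotient algebra acts on a complement of the ideal; on the ideal itself the generators act
  by zero, so that the free algebra acts unitally on the direct sum.
\<close>

lemma faithful_model:
  fixes rels :: "'g free_alg set"
  assumes "\<And>x. x \<in> rels \<Longrightarrow> eps x = 0"
  obtains \<Phi> :: "'g free_alg \<Rightarrow> ('n, 'g) tensor_op"
  where "\<And>x y. \<Phi> (x + y) = \<Phi> x + \<Phi> y" "\<And>x y. \<Phi> (x * y) = \<Phi> x * \<Phi> y" "\<And>c. \<Phi> (fa_const c) = op_scale c 1"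
    "\<And>x p a b. \<Phi> x * unit_op p a b = unit_op p a b * \<Phi> x" "\<And>x. x \<in> rels \<Longrightarrow> \<Phi> x = 0"
    "\<And>x. \<Phi> x = 0 \<Longrightarrow> x \<in> two_sided_ideal rels"
proof -
  let ?I = "two_sided_ideal rels"
  obtain \<pi> :: "'g free_alg \<Rightarrow> 'g free_alg" where add: "\<And>x y. \<pi> (x + y) = \<pi> x + \<pi> y"
    and scale: "\<And>c x. \<pi> (fa_const c * x) = fa_const c * \<pi> x"
    and I0: "\<And>x. x \<in> ?I \<Longrightarrow> \<pi> x = 0" and I: "\<And>x. x - \<pi> x \<in> ?I"
    using ideal_projection[of rels] by blast
  have \<pi>0: "\<pi> 0 = 0" by (intro I0 two_sided_ideal.zero)
  have diff: "\<pi> (x - y) = \<pi> x - \<pi> y" for x y using add[of "x - y" y] by simp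
  have idem: "\<pi> (\<pi> x) = \<pi> x" for x using I0[OF I[of x]] diff[of x "\<pi> x"] by simp
  define \<phi> where "\<phi> a x = \<pi> (a * x) + fa_const (eps a) * (x - \<pi> x)" for a x
  have \<phi>_add: "\<phi> a (x + y) = \<phi> a x + \<phi> a y" for a x y
    unfolding \<phi>_def by (simp add: distrib_left add algebra_simps)
  have \<phi>_scale: "\<phi> a (fa_const c * x) = fa_const c * \<phi> a x" for a c x
    unfolding \<phi>_def by (simp add: distrib_left right_diff_distrib scale fa.sc_mult_right[of a c] mult.commute)
  have \<pi>\<phi>: "\<pi> (\<phi> a x) = \<pi> (a * x)" for a x
    unfolding \<phi>_def by (simp add: add scale diff idem)
  have \<phi>_mult: "\<phi> a (\<phi> b x) = \<phi> (a * b) x" for a b x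
  proof -
    have "\<pi> (a * (b * x - \<pi> (b * x))) = 0" by (intro I0 two_sided_ideal.lmult I)
    then have 1: "\<pi> (a * \<pi> (b * x)) = \<pi> (a * (b * x))"
      by (simp add: right_diff_distrib diff)
    have "a * (fa_const (eps b) * (x - \<pi> x)) \<in> ?I" by (intro two_sided_ideal.lmult I)
    then have "\<pi> (a * \<phi> b x) = \<pi> (a * b * x)"
      unfolding \<phi>_def distrib_left add by (simp add: I0 1 mult.assoc)
    moreover have "\<phi> b x - \<pi> (\<phi> b x) = fa_const (eps b) * (x - \<pi> x)"
      unfolding \<pi>\<phi> by (simp add: \<phi>_def)
    ultimately show ?thesis
      unfolding \<phi>_def[of a] \<phi>_def[of "a * b"] by (simp add: eps_mult)
  qed
  define \<Phi> :: "'g free_alg \<Rightarrow> ('n, 'g) tensor_op" where "\<Phi> a = Op (\<lambda>x i. \<phi> a (x i))" for a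
  have app: "app (\<Phi> a) x = (\<lambda>i. \<phi> a (x i))" for a x
    unfolding \<Phi>_def by (subst app_Op) (auto simp: \<phi>_add \<phi>_scale)
  have \<phi>0: "\<phi> a 0 = 0" for a unfolding \<phi>_def by (simp add: \<pi>0)
  show ?thesis
  proof (rule that[of \<Phi>])
    show "\<Phi> (x + y) = \<Phi> x + \<Phi> y" for x y
      by (rule tensor_op_eqI) (simp add: app \<phi>_def distrib_right add eps_add fa_const_add)
    show "\<Phi> (x * y) = \<Phi> x * \<Phi> y" for x y
      by (rule tensor_op_eqI) (simp add: app \<phi>_mult)
    show "\<Phi> (fa_const c) = op_scale c 1" for c
      by (rule tensor_op_eqI) (simp add: app \<phi>_def scale eps_const right_diff_distrib)
    show "\<Phi> x * unit_op p a b = unit_op p a b * \<Phi> x" for x p a b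
      by (rule tensor_op_eqI) (simp add: app \<phi>0)
    show "\<Phi> x = 0" if "x \<in> rels" for x
    proof (rule tensor_op_eqI)
      have "x * y \<in> ?I" for y using that by (intro two_sided_ideal.rmult two_sided_ideal.base)
      then show "app (\<Phi> x) f i = app 0 f i" for f i
        by (simp add: app \<phi>_def I0 assms[OF that] fa_const_0)
    qed
    show "x \<in> ?I" if "\<Phi> x = 0" for x
    proof -
      \<comment> \<open>Acting on the constant vector 1 recovers \<open>\<pi> x\<close>.\<close>
      have "\<phi> x 1 = 0" using app[of x "\<lambda>i. 1"] that by (simp add: fun_eq_iff)
      then have "\<pi> (x * 1) = 0" using \<pi>\<phi>[of x 1] by (simp add: \<pi>0)
      then show ?thesis using I[of x] by simp
    qed
  qed
qed

text \<open>Overlined copies are linear in the generators without constant term, so a relator has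
  terms of degree one and two only.\<close>

lemma eps_M_relators:
  fixes R :: "complex ^ ('n::finite \<times> 'n) ^ ('n \<times> 'n)" and x :: "('k \<times> 'n \<times> 'n) free_alg"
  assumes "x \<in> M_relators R"
  shows "eps x = 0"
proof -
  let ?S = "{1, 2} :: nat set"
  have one: "eps (overlined ?S R (M_gen k) 1 i j) = 0" for k :: 'k and i j :: "nat \<Rightarrow> 'n"
    by (simp add: One_nat_def place1_def M_gen_def eps_gen eps_0)
  then have two: "eps (overlined ?S R (M_gen k) 2 i j) = 0" for k :: 'k and i j :: "nat \<Rightarrow> 'n"
    by (simp add: numeral_2_eq_2 One_nat_def tensor_prod_list_def tensor_mult_def eps_sum eps_mult)
  show ?thesis
    using assms unfolding M_relators_def Let_def
    by (auto simp: tensor_mult_def eps_diff eps_sum eps_mult one two)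
qed

section \<open>The hypotheses in index notation\<close>

lemma sum_multi_idx_insert:
  fixes f :: "(nat \<Rightarrow> 'n::finite) \<Rightarrow> 'a::comm_monoid_add"
  assumes "a \<notin> S"
  shows "(\<Sum>i\<in>multi_idx (insert a S). f i) = (\<Sum>x\<in>UNIV. \<Sum>j\<in>multi_idx S. f (j(a := x)))"
  unfolding sum.cartesian_product
proof (rule sum.reindex_bij_witness[where i = "\<lambda>(x, j). j(a := x)" and j = "\<lambda>i. (i a, i(a := undefined))"])
  fix p :: "'n \<times> (nat \<Rightarrow> 'n)" assume "p \<in> UNIV \<times> multi_idx S"
  then show "(\<lambda>i. (i a, i(a := undefined))) (case p of (x, j) \<Rightarrow> j(a := x)) = p"
    "(case p of (x, j) \<Rightarrow> j(a := x)) \<in> multi_idx (insert a S)"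
    using assms unfolding multi_idx_def by (auto simp: PiE_def extensional_def fun_eq_iff)
next
  fix i :: "nat \<Rightarrow> 'n" assume "i \<in> multi_idx (insert a S)"
  then show "(i a, i(a := undefined)) \<in> UNIV \<times> multi_idx S"
    using assms unfolding multi_idx_def by (auto simp: PiE_def extensional_def)
qed auto

lemma multi_idx_empty: "multi_idx {} = {\<lambda>x. undefined}"
  unfolding multi_idx_def by simp

definition idx3 :: "'n \<Rightarrow> 'n \<Rightarrow> 'n \<Rightarrow> nat \<Rightarrow> 'n"
  where "idx3 a b c = (\<lambda>x. undefined)(3 := c, 2 := b, 1 := a)"

lemma sum_multi_idx_single:
  fixes f :: "(nat \<Rightarrow> 'n::finite) \<Rightarrow> 'a::comm_monoid_add"
  shows "(\<Sum>i\<in>multi_idx {p}. f i) = (\<Sum>c\<in>UNIV. f ((\<lambda>x. undefined)(p := c)))"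
  using sum_multi_idx_insert[of p "{}" f] unfolding multi_idx_empty by (simp del: fun_upd_apply)

lemma sum_multi_idx_3:
  fixes f :: "(nat \<Rightarrow> 'n::finite) \<Rightarrow> 'a::comm_monoid_add"
  shows "(\<Sum>i\<in>multi_idx {1, 2, 3}. f i) = (\<Sum>a\<in>UNIV. \<Sum>b\<in>UNIV. \<Sum>c\<in>UNIV. f (idx3 a b c))"
proof -
  have "(\<Sum>i\<in>multi_idx {1, 2, 3}. f i) = (\<Sum>a\<in>UNIV. \<Sum>j\<in>multi_idx {2, 3}. f (j(1 := a)))"
    by (rule sum_multi_idx_insert) simp
  moreover have "(\<Sum>j\<in>multi_idx {2, 3}. g j) = (\<Sum>b\<in>UNIV. \<Sum>j\<in>multi_idx {3}. g (j(2 := b)))"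
    for g :: "(nat \<Rightarrow> 'n) \<Rightarrow> 'a"
    by (rule sum_multi_idx_insert) simp
  ultimately show ?thesis
    unfolding sum_multi_idx_single idx3_def by (simp only:)
qed

lemma idx3: "idx3 a b c \<in> multi_idx {1, 2, 3}"
  unfolding idx3_def multi_idx_def PiE_def extensional_def by simp

lemma idx3_simps [simp]: "idx3 a b c 1 = a" "idx3 a b c 2 = b" "idx3 a b c 3 = c"
  unfolding idx3_def by simp_all

lemma place2_12:
  "place2 {1, 2, 3} 1 2 R (idx3 a b c) (idx3 d f g) = (if c = g then R $ (a, b) $ (d, f) else 0)"
  unfolding place2_def by (simp add: insert_Diff_if)

lemma place2_23:
  "place2 {1, 2, 3} 2 3 R (idx3 a b c) (idx3 d f g) = (if a = d then R $ (b, c) $ (f, g) else 0)"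
  unfolding place2_def by (simp add: insert_Diff_if)

lemma one_3:
  "tensor_one {1, 2, 3} (idx3 a b c) (idx3 d f g) = (if a = d \<and> b = f \<and> c = g then 1 else 0)"
  unfolding tensor_one_def by simp


lemma tensor_prod_3:
  fixes X Y Z :: "('n::finite, complex) tensor"
  shows "tensor_prod_list {1, 2, 3} [X, Y, Z] (idx3 i j k) (idx3 l m n)
    = (\<Sum>a\<in>UNIV. \<Sum>b\<in>UNIV. \<Sum>c\<in>UNIV. X (idx3 i j k) (idx3 a b c) *
        (\<Sum>a'\<in>UNIV. \<Sum>b'\<in>UNIV. \<Sum>c'\<in>UNIV. Y (idx3 a b c) (idx3 a' b' c') * Z (idx3 a' b' c') (idx3 l m n)))"
proof -
  have one: "(\<Sum>a\<in>UNIV. \<Sum>b\<in>UNIV. \<Sum>c\<in>UNIV. W (idx3 a b c) * tensor_one {1, 2, 3} (idx3 a b c) (idx3 l m n))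
      = W (idx3 l m n)" for W :: "(nat \<Rightarrow> 'n) \<Rightarrow> complex"
  proof -
    have "(\<Sum>a\<in>UNIV. \<Sum>b\<in>UNIV. \<Sum>c\<in>UNIV. W (idx3 a b c) * tensor_one {1, 2, 3} (idx3 a b c) (idx3 l m n))
        = (\<Sum>a\<in>UNIV. \<Sum>b\<in>UNIV. \<Sum>c\<in>UNIV. if a = l then if b = m then if c = n then W (idx3 a b c) else 0 else 0 else 0)"
      unfolding one_3 by (intro sum.cong refl) auto
    then show ?thesis by (simp add: sum_if_out)
  qed
  show ?thesis
    unfolding tensor_prod_list_def foldr.simps o_apply id_apply tensor_mult_def sum_multi_idx_3 one ..
qed

text \<open>The operator identities are read off at index triples, where the Kronecker deltas of the
  idle positions collapse the sums.\<close>

lemma skew_braiding_entries: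
  fixes R \<Psi> :: "complex ^ ('n::finite \<times> 'n) ^ ('n \<times> 'n)"
  assumes "involutive_symmetry R" "skew_inverse R \<Psi>"
  shows "skew_braiding (\<lambda>a b c d. R $ (a, b) $ (c, d)) (\<lambda>a b c d. \<Psi> $ (a, b) $ (c, d))"
proof
  fix i j k l m n :: 'n
  let ?R = "\<lambda>a b c d. R $ (a, b) $ (c, d)"
  let ?S = "{1, 2, 3} :: nat set"
  have "tensor_prod_list ?S [place2 ?S 1 2 R, place2 ?S 2 3 R, place2 ?S 1 2 R] (idx3 i j k) (idx3 l m n)
      = tensor_prod_list ?S [place2 ?S 2 3 R, place2 ?S 1 2 R, place2 ?S 2 3 R] (idx3 i j k) (idx3 l m n)"
  proof -
    have T: "tensor_eq ?S (tensor_prod_list ?S [place2 ?S 1 2 R, place2 ?S 2 3 R, place2 ?S 1 2 R])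
        (tensor_prod_list ?S [place2 ?S 2 3 R, place2 ?S 1 2 R, place2 ?S 2 3 R])"
      using assms(1) unfolding involutive_symmetry_def Let_def by (rule conjunct1)
    show ?thesis by (rule T[unfolded tensor_eq_def, rule_format, OF idx3 idx3])
  qed
  moreover have "tensor_prod_list ?S [place2 ?S 1 2 R, place2 ?S 2 3 R, place2 ?S 1 2 R] (idx3 i j k) (idx3 l m n)
      = (\<Sum>s\<in>UNIV. \<Sum>t\<in>UNIV. \<Sum>u\<in>UNIV. ?R i j s t * ?R t k u n * ?R s u l m)"
    unfolding tensor_prod_3 place2_12 place2_23
    by (simp add: if_distrib[where f = "\<lambda>z. z * _"] if_distrib[where f = "\<lambda>z. _ * z"] sum_if_out
        sum_distrib_left mult.assoc cong: if_cong)
  moreover have "tensor_prod_list ?S [place2 ?S 2 3 R, place2 ?S 1 2 R, place2 ?S 2 3 R] (idx3 i j k) (idx3 l m n)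
      = (\<Sum>t\<in>UNIV. \<Sum>s\<in>UNIV. \<Sum>u\<in>UNIV. ?R j k t s * ?R i t l u * ?R u s m n)"
    unfolding tensor_prod_3 place2_12 place2_23
    by (simp add: if_distrib[where f = "\<lambda>z. z * _"] if_distrib[where f = "\<lambda>z. _ * z"] sum_if_out
        sum_distrib_left mult.assoc cong: if_cong)
  moreover have "\<dots> = (\<Sum>s\<in>UNIV. \<Sum>t\<in>UNIV. \<Sum>u\<in>UNIV. ?R j k t s * ?R i t l u * ?R u s m n)"
    by (rule sum.swap)
  ultimately show "(\<Sum>s\<in>UNIV. \<Sum>t\<in>UNIV. \<Sum>u\<in>UNIV. ?R i j s t * ?R t k u n * ?R s u l m)
      = (\<Sum>s\<in>UNIV. \<Sum>t\<in>UNIV. \<Sum>u\<in>UNIV. ?R j k t s * ?R i t l u * ?R u s m n)"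
    by simp
next
  fix a b c d :: 'n
  have "R ** R = mat 1" using assms(1) unfolding involutive_symmetry_def by blast
  then have "(R ** R) $ (a, b) $ (c, d) = mat 1 $ (a, b) $ (c, d)" by simp
  then show "(\<Sum>s\<in>UNIV. \<Sum>t\<in>UNIV. R $ (a, b) $ (s, t) * R $ (s, t) $ (c, d)) = (if a = c \<and> b = d then 1 else 0)"
    unfolding matrix_matrix_mult_def mat_def by (simp add: sum_UNIV_pair)
next
  fix a c e f :: 'n
  let ?S = "{1, 2, 3} :: nat set"
  define i where "i = (\<lambda>x :: nat. undefined :: 'n)(3 := e, 1 := a)"
  define j where "j = (\<lambda>x :: nat. undefined :: 'n)(3 := f, 1 := c)"
  have ij: "i \<in> multi_idx {1, 3}" "j \<in> multi_idx {1, 3}"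
    unfolding i_def j_def multi_idx_def PiE_def extensional_def by simp_all
  \<comment> \<open>Filling the traced position 2 turns an index on the positions 1 and 3 into a
    triple.\<close>
  have ov: "override_on i ((\<lambda>x. undefined)(2 := x)) {2} = idx3 a x e"
    "override_on j ((\<lambda>x. undefined)(2 := x)) {2} = idx3 c x f" for x
    unfolding i_def j_def idx3_def override_on_def by auto
  have flip: "place2 {1, 3} 1 3 flip i j = (if f = a \<and> e = c then 1 else 0)"
    unfolding place2_def flip_def i_def j_def by auto
  have tr: "partial_trace {2} (tensor_mult ?S (place2 ?S 1 2 X) (place2 ?S 2 3 Y)) i j
      = (\<Sum>b\<in>UNIV. \<Sum>d\<in>UNIV. X $ (a, b) $ (c, d) * Y $ (d, e) $ (b, f))"
    for X Y :: "complex ^ ('n \<times> 'n) ^ ('n \<times> 'n)"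
    unfolding partial_trace_def tensor_mult_def sum_multi_idx_single ov sum_multi_idx_3 place2_12 place2_23
    by (simp add: if_distrib[where f = "\<lambda>z. z * _"] if_distrib[where f = "\<lambda>z. _ * z"] sum_if_out cong: if_cong)
  have sk: "tensor_eq {1, 3} (partial_trace {2} (tensor_mult ?S (place2 ?S 1 2 R) (place2 ?S 2 3 \<Psi>)))
        (place2 {1, 3} 1 3 flip)"
      "tensor_eq {1, 3} (place2 {1, 3} 1 3 flip)
        (partial_trace {2} (tensor_mult ?S (place2 ?S 1 2 \<Psi>) (place2 ?S 2 3 R)))"
    using assms(2) unfolding skew_inverse_def Let_def by (rule conjunct1, rule conjunct2)
  show "(\<Sum>b\<in>UNIV. \<Sum>d\<in>UNIV. R $ (a, b) $ (c, d) * \<Psi> $ (d, e) $ (b, f)) = (if f = a \<and> e = c then 1 else 0)"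
    unfolding tr[symmetric] flip[symmetric] by (rule bspec[OF bspec[OF sk(1)[unfolded tensor_eq_def] ij(1)] ij(2)])
  show "(\<Sum>b\<in>UNIV. \<Sum>d\<in>UNIV. \<Psi> $ (a, b) $ (c, d) * R $ (d, e) $ (b, f)) = (if f = a \<and> e = c then 1 else 0)"
    unfolding tr[symmetric] flip[symmetric]
    by (rule bspec[OF bspec[OF sk(2)[unfolded tensor_eq_def] ij(1)] ij(2), symmetric])
qed

theorem mainTheorem3:
  fixes R \<Psi> :: "complex ^ ('n::finite \<times> 'n) ^ ('n \<times> 'n)"
    and u :: "'k::finite \<Rightarrow> complex"
    and m :: nat
  assumes "involutive_symmetry R"
    and "skew_inverse R \<Psi>"
    and "even_bi_rank R m"
    and "inj u"
  shows "\<forall>k\<in>{1..m}. \<forall>l\<in>{1..m}. \<forall>z w. z \<notin> range u \<longrightarrow> w \<notin> range u \<longrightarrow>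
    presented_eq (M_relators R)
      (QH R \<Psi> m u k z * QH R \<Psi> m u l w)
      (QH R \<Psi> m u l w * QH R \<Psi> m u k z)"
proof (intro ballI allI impI)
  fix k l z w
  assume *: "k \<in> {1..m}" "l \<in> {1..m}" "z \<notin> range u" "w \<notin> range u"
  \<comment> \<open>The kernel of \<Phi> is contained in the ideal of the relators, so it is enough
    that the images commute.\<close>
  obtain \<Phi> :: "('k \<times> 'n \<times> 'n) free_alg \<Rightarrow> ('n, 'k \<times> 'n \<times> 'n) tensor_op"
    where \<Phi>: "\<And>x y. \<Phi> (x + y) = \<Phi> x + \<Phi> y" "\<And>x y. \<Phi> (x * y) = \<Phi> x * \<Phi> y" "\<And>c. \<Phi> (fa_const c) = op_scale c 1"
    "\<And>x p a b. \<Phi> x * unit_op p a b = unit_op p a b * \<Phi> x" "\<And>x. x \<in> M_relators R \<Longrightarrow> \<Phi> x = 0"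
    "\<And>x. \<Phi> x = 0 \<Longrightarrow> x \<in> two_sided_ideal (M_relators R)"
    using faithful_model[of "M_relators R"] eps_M_relators by blast
  interpret skew_braiding "\<lambda>a b c d. R $ (a, b) $ (c, d)" "\<lambda>a b c d. \<Psi> $ (a, b) $ (c, d)"
    using assms(1,2) by (rule skew_braiding_entries)
  interpret g: gaudin op_scale R \<Psi> unit_op \<Phi> u
  proof
    fix p q :: nat and a b c d :: 'n
    show "unit_op p a b * unit_op p c d = (if b = c then unit_op p a d else 0)"
      by (rule tensor_op_eqI) auto
    show "(\<Sum>a\<in>UNIV. unit_op p (a :: 'n) a :: ('n, 'k \<times> 'n \<times> 'n) tensor_op) = 1"
      by (rule tensor_op_eqI) (simp add: app_sum)
    show "unit_op p a b * unit_op q c d = unit_op q c d * unit_op p a b" if "p \<noteq> q"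
      by (rule tensor_op_eqI) (use that in \<open>auto simp: fun_upd_twist\<close>)
  qed (fact \<Phi>)+
  have "\<Phi> (QH R \<Psi> m u k z) * \<Phi> (QH R \<Psi> m u l w) = \<Phi> (QH R \<Psi> m u l w) * \<Phi> (QH R \<Psi> m u k z)"
    unfolding g.\<Phi>_QH using * by (intro g.qh_comm) auto
  then have "\<Phi> (QH R \<Psi> m u k z * QH R \<Psi> m u l w - QH R \<Psi> m u l w * QH R \<Psi> m u k z) = 0"
    by (simp add: g.\<Phi>_diff \<Phi>(2))
  then show "presented_eq (M_relators R) (QH R \<Psi> m u k z * QH R \<Psi> m u l w)
      (QH R \<Psi> m u l w * QH R \<Psi> m u k z)"
    unfolding presented_eq_def by (rule \<Phi>(6))
qed

end
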